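(* There exist universal constants $\bar\varepsilon>0$ and $\eta\in(0,1)$ such that the following holds. Let $\mathbf{u}=(u^1,\dots,u^m)$ be a viscosity solution to $\Delta\mathbf{u}=|\mathbf{u}|^{p-2}\mathbf{u}$ in $B_1$, let $x_0\in B_1(\mathbf{u})\cup\Gamma(\mathbf{u})$, $r>0$ with $B_r(x_0)\subset B_1$, and let $a_0\le b_0$ be real numbers with $b_0-a_0\le\bar\varepsilon r$ such that $$|\mathbf{u}|\le u_0(x_n+b_0)\ \text{ in } B_r(x_0),\qquad u_0(x_n+a_0)\le u^1\ \text{ in } B_r(x_0)\cap\{x_n\ge -a_0\},$$ $$|u^i|\le r^\kappa\left(\frac{b_0-a_0}{r}\right)^{5/8}\ \text{ in } B_r(x_0),\quad i=2,\dots,m.$$ Then there exist $a_1,b_1$ with $a_0\le a_1\le b_1\le b_0$ and $b_1-a_1=(1-\eta)(b_0-a_0)$ such that $$|\mathbf{u}|\le u_0(x_n+b_1)\ \text{ in } B_{\eta r}(x_0),\qquad u_0(x_n+a_1)\le u^1\ \text{ in } B_{\eta r}(x_0)\cap\{x_n\ge -a_1\}.$$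
   Context: Fix integers $n\ge 2$, $m\ge 1$ and $0<p<1$; universal means depending only on $n,m,p$. Set $\kappa:=\frac{2}{2-p}$, $c_p:=[\kappa(\kappa-1)]^{\frac{1}{p-2}}$, $u_0(t):=c_p(\max\{t,0\})^\kappa$. Points of $\mathbb{R}^n$ are $x=(x',x_n)$. For $\mathbf{u}\in C(\Omega;\mathbb{R}^m)$, $\Omega(\mathbf{u}):=\Omega\cap\{|\mathbf{u}|>0\}$ (so $B_1(\mathbf{u})=B_1\cap\{|\mathbf{u}|>0\}$) and $\Gamma(\mathbf{u}):=\Omega\cap\partial\Omega(\mathbf{u})$. Viscosity solution: $\mathbf{u}\in C(\Omega;\mathbb{R}^m)$ is a viscosity solution of $\Delta\mathbf{u}=|\mathbf{u}|^{p-2}\mathbf{u}$ in $\Omega$ if (i) $\Delta u^i=|\mathbf{u}|^{p-2}u^i$ in $\Omega(\mathbf{u})$ for all $i$, and (ii) for every $x_0\in\Gamma(\mathbf{u})$ and every $f\in\mathbb{R}^m$, $\langle\mathbf{u},f\rangle$ cannot be touched from below at $x_0$ by a function $\varphi\in C^1$ with $\varphi(x_0)=0$, $|\nabla\varphi(x_0)|\ne0$, such that on $\{\varphi\ne0\}$, $\varphi\in C^2$ and $\Delta\varphi>\varphi^{p-1}\chi_{\{\varphi>0\}}$. *)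

theory Defs
  imports "HOL-Analysis.Analysis"
begin

definition C1_on :: "'a::euclidean_space set \<Rightarrow> ('a \<Rightarrow> real) \<Rightarrow> bool" where
  "C1_on S f \<longleftrightarrow> (\<exists>Df :: 'a \<Rightarrow> ('a \<Rightarrow>\<^sub>L real).
      (\<forall>x\<in>S. (f has_derivative blinfun_apply (Df x)) (at x)) \<and> continuous_on S Df)"

definition has_hessian_on :: "'a::euclidean_space set \<Rightarrow> ('a \<Rightarrow> real) \<Rightarrow> ('a \<Rightarrow> ('a \<Rightarrow>\<^sub>L ('a \<Rightarrow>\<^sub>L real))) \<Rightarrow> bool" where
  "has_hessian_on S f H \<longleftrightarrow> (\<exists>Df :: 'a \<Rightarrow> ('a \<Rightarrow>\<^sub>L real).
      (\<forall>x\<in>S. (f has_derivative blinfun_apply (Df x)) (at x)) \<and>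
      (\<forall>x\<in>S. (Df has_derivative blinfun_apply (H x)) (at x)) \<and> continuous_on S H)"

definition trace_hess :: "('a::euclidean_space \<Rightarrow>\<^sub>L ('a \<Rightarrow>\<^sub>L real)) \<Rightarrow> real" where
  "trace_hess A = (\<Sum>i\<in>Basis. blinfun_apply (blinfun_apply A i) i)"

definition classical_laplace_eq :: "'a::euclidean_space set \<Rightarrow> ('a \<Rightarrow> real) \<Rightarrow> ('a \<Rightarrow> real) \<Rightarrow> bool" where
  "classical_laplace_eq S f g \<longleftrightarrow> (\<exists>H. has_hessian_on S f H \<and> (\<forall>x\<in>S. trace_hess (H x) = g x))"

definition classical_laplace_gt :: "'a::euclidean_space set \<Rightarrow> ('a \<Rightarrow> real) \<Rightarrow> ('a \<Rightarrow> real) \<Rightarrow> bool" where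
  "classical_laplace_gt S f g \<longleftrightarrow> (\<exists>H. has_hessian_on S f H \<and> (\<forall>x\<in>S. trace_hess (H x) > g x))"

definition kappa :: "real \<Rightarrow> real" where
  "kappa p = 2 / (2 - p)"

definition c_p :: "real \<Rightarrow> real" where
  "c_p p = (kappa p * (kappa p - 1)) powr (1 / (p - 2))"

definition u0 :: "real \<Rightarrow> real \<Rightarrow> real" where
  "u0 p t = c_p p * (max t 0) powr (kappa p)"

definition posset :: "'a::euclidean_space set \<Rightarrow> ('a \<Rightarrow> real^'m) \<Rightarrow> 'a set" where
  "posset \<Omega> u = \<Omega> \<inter> {x. norm (u x) > 0}"

definition freebd :: "'a::euclidean_space set \<Rightarrow> ('a \<Rightarrow> real^'m) \<Rightarrow> 'a set" where
  "freebd \<Omega> u = \<Omega> \<inter> frontier (posset \<Omega> u)"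

definition admissible_test :: "real \<Rightarrow> 'a::euclidean_space set \<Rightarrow> 'a \<Rightarrow> ('a \<Rightarrow> real) \<Rightarrow> bool" where
  "admissible_test p N x0 \<phi> \<longleftrightarrow>
     C1_on N \<phi> \<and> \<phi> x0 = 0 \<and>
     (\<exists>D. (\<phi> has_derivative D) (at x0) \<and> D \<noteq> (\<lambda>_. 0)) \<and>
     classical_laplace_gt (N \<inter> {x. \<phi> x \<noteq> 0}) \<phi>
        (\<lambda>x. if \<phi> x > 0 then \<phi> x powr (p - 1) else 0)"

definition viscosity_solution :: "real \<Rightarrow> 'a::euclidean_space set \<Rightarrow> ('a \<Rightarrow> real^'m) \<Rightarrow> bool" where
  "viscosity_solution p \<Omega> u \<longleftrightarrow>
     continuous_on \<Omega> u \<and>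
     (\<forall>i. classical_laplace_eq (posset \<Omega> u) (\<lambda>x. u x $ i) (\<lambda>x. norm (u x) powr (p - 2) * u x $ i)) \<and>
     (\<forall>x0\<in>freebd \<Omega> u. \<forall>f :: real^'m. \<not> (\<exists>\<phi> \<rho>. \<rho> > 0 \<and> ball x0 \<rho> \<subseteq> \<Omega> \<and>
          admissible_test p (ball x0 \<rho>) x0 \<phi> \<and>
          (\<forall>x\<in>ball x0 \<rho>. \<phi> x \<le> inner (u x) f)))"

definition xn :: "real^'n::{finite,linorder} \<Rightarrow> real" where
  "xn x = x $ (Max UNIV)"

definition first_idx :: "'m::{finite,linorder}" where
  "first_idx = Min UNIV"

end

(*
  After rescaling to the unit ball, put d = b - a. The functions V = u^1 - u0(x_n + a) and
  W = u0(x_n + b) - |u| are nonnegative and superharmonic where x_n + a > 0, because s^(p-1) is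
  decreasing, and V + W is at least a multiple of d away from the free boundary, where the bound on the other
  components makes |u| - u^1 negligible. A doubling of variables shows that one of V, W is bounded
  below by a multiple of d on a whole small ball; this replaces the Harnack inequality and needs no
  integration. If the free boundary is near, the gain is carried to the origin by barriers
  g(x_n + c +- d w) with w(x) = exp(-k |x - z|^2) in an annulus around z = e_n / 5. From above, the profile
  u0 is perturbed to a positive supersolution, so that no contact occurs at zeros of u. From below, u0 is
  perturbed to u0(s) + delta s, which is an admissible test function at the free boundary; in the strip
  -b < x_n < -a the possible negative part of u^1 is of the smaller order d^(kappa + 2).
*)
theory Submission
  imports Defs
begin

subsection \<open>Second derivatives along lines\<close>

text \<open>For a distorted height S the Laplacian of u0(S) is u0''(S) |grad S|^2 + u0'(S) Lap S.
  The obstacle is u0'': it blows up at the free boundary, it multiplies |grad S|^2 - 1, and no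
  choice of k lets u0' dominate it there. This dictates the centre z at height 1/5. To first order
  |grad S|^2 - 1 has the favourable sign below z, hence near the free boundary; above z the height
  is bounded below, u0'' is at most a multiple of u0', and a large k wins. The two profiles differ
  because the viscosity condition speaks of contact from below only. Contact from above has to be
  settled by the equation in the set where u does not vanish. The ball of radius 3/4 about z stays
  inside the unit ball, and the ball of radius 1/2 about z contains a neighbourhood of 0.
  Subtracting from w the mean of its values at these two distances makes the barrier lose height at
  the outer sphere, where only the old bounds hold, and gain height near 0. The exponent 5/8 exceeds
  1/2, so |u| - u^1 is of order d^(5/4) away from the free boundary, less than the gap of order d
  between the two planes.\<close>

definition D2 :: "(real \<Rightarrow> real) \<Rightarrow> real \<Rightarrow> real \<Rightarrow> bool" where
  "D2 g d1 d2 \<longleftrightarrow> (\<exists>g'. (\<forall>\<^sub>F t in nhds 0. (g has_real_derivative g' t) (at t)) \<and> g' 0 = d1 \<and>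
     (g' has_real_derivative d2) (at 0))"

lemma D2_imp_deriv: "D2 g d1 d2 \<Longrightarrow> (g has_real_derivative d1) (at 0)"
  unfolding D2_def by (auto dest: eventually_nhds_x_imp_x)

lemma D2_add: "D2 f a1 a2 \<Longrightarrow> D2 g b1 b2 \<Longrightarrow> D2 (\<lambda>t. f t + g t) (a1 + b1) (a2 + b2)"
  unfolding D2_def
proof clarify
  fix f' g'
  assume "\<forall>\<^sub>F t in nhds 0. (f has_real_derivative f' t) (at t)" "(f' has_real_derivative a2) (at 0)"
    "\<forall>\<^sub>F t in nhds 0. (g has_real_derivative g' t) (at t)" "(g' has_real_derivative b2) (at 0)"
  then show "\<exists>g''. (\<forall>\<^sub>F t in nhds 0. ((\<lambda>t. f t + g t) has_real_derivative g'' t) (at t)) \<and>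
          g'' 0 = f' 0 + g' 0 \<and> (g'' has_real_derivative a2 + b2) (at 0)"
    by (intro exI[of _ "\<lambda>t. f' t + g' t"])
       (auto intro!: derivative_intros elim: eventually_elim2[where P="\<lambda>t. (f has_real_derivative f' t) (at t)"])
qed

lemma D2_cmult: "D2 f a1 a2 \<Longrightarrow> D2 (\<lambda>t. c * f t) (c * a1) (c * a2)"
  unfolding D2_def
proof clarify
  fix f'
  assume "\<forall>\<^sub>F t in nhds 0. (f has_real_derivative f' t) (at t)" "(f' has_real_derivative a2) (at 0)"
  then show "\<exists>g''. (\<forall>\<^sub>F t in nhds 0. ((\<lambda>t. c * f t) has_real_derivative g'' t) (at t)) \<and>
          g'' 0 = c * f' 0 \<and> (g'' has_real_derivative c * a2) (at 0)"
    by (intro exI[of _ "\<lambda>t. c * f' t"])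
       (auto intro!: derivative_eq_intros elim: eventually_mono)
qed

lemma D2_diff: "D2 f a1 a2 \<Longrightarrow> D2 g b1 b2 \<Longrightarrow> D2 (\<lambda>t. f t - g t) (a1 - b1) (a2 - b2)"
  using D2_add[of f a1 a2 "\<lambda>t. (-1) * g t" "(-1) * b1" "(-1) * b2"] D2_cmult[of g b1 b2 "-1"] by simp

lemma D2_quadratic: "D2 (\<lambda>t. c0 + c1 * t + c2 * t\<^sup>2) c1 (2 * c2)"
  unfolding D2_def
  by (intro exI[of _ "\<lambda>t. c1 + 2 * c2 * t"]) (auto intro!: derivative_eq_intros always_eventually)

lemma D2_cong:
  assumes fg: "\<forall>\<^sub>F t in nhds 0. f t = g t" and "D2 g d1 d2"
  shows "D2 f d1 d2"
proof -
  obtain g' where g: "\<forall>\<^sub>F t in nhds 0. (g has_real_derivative g' t) (at t)" "g' 0 = d1"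
    "(g' has_real_derivative d2) (at 0)"
    using assms(2) unfolding D2_def by blast
  have "\<forall>\<^sub>F t in nhds 0. \<forall>\<^sub>F s in nhds t. f s = g s"
    using fg by (simp only: eventually_eventually)
  with g(1) have "\<forall>\<^sub>F t in nhds 0. (f has_real_derivative g' t) (at t)"
  proof eventually_elim
    case (elim t)
    show ?case by (rule iffD2[OF DERIV_cong_ev[OF refl elim(2) refl] elim(1)])
  qed
  then show ?thesis
    unfolding D2_def using g by blast
qed

lemma D2_compose:
  assumes "D2 g d1 d2"
    and G: "\<forall>\<^sub>F v in nhds (g 0). (G has_real_derivative G' v) (at v)"
    and G': "(G' has_real_derivative G2) (at (g 0))"
  shows "D2 (\<lambda>t. G (g t)) (G' (g 0) * d1) (G2 * d1\<^sup>2 + G' (g 0) * d2)"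
proof -
  obtain g' where g: "\<forall>\<^sub>F t in nhds 0. (g has_real_derivative g' t) (at t)" "g' 0 = d1"
    "(g' has_real_derivative d2) (at 0)"
    using assms(1) unfolding D2_def by blast
  have g0: "(g has_real_derivative d1) (at 0)"
    using assms(1) by (rule D2_imp_deriv)
  then have "filterlim g (nhds (g 0)) (nhds 0)"
    by (metis DERIV_isCont isCont_def tendsto_at_iff_tendsto_nhds)
  then have "\<forall>\<^sub>F t in nhds 0. (G has_real_derivative G' (g t)) (at (g t))"
    using eventually_compose_filterlim[OF G] by blast
  with g(1) have 1: "\<forall>\<^sub>F t in nhds 0. ((\<lambda>t. G (g t)) has_real_derivative G' (g t) * g' t) (at t)"
    by eventually_elim (rule DERIV_chain2)
  have "((\<lambda>t. G' (g t) * g' t) has_real_derivative (G2 * d1) * g' 0 + d2 * G' (g 0)) (at 0)"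
    by (intro DERIV_mult g(3) DERIV_chain2[OF G' g0])
  then show ?thesis
    unfolding D2_def using 1 g(2)
    by (intro exI[of _ "\<lambda>t. G' (g t) * g' t"]) (auto simp: power2_eq_square algebra_simps)
qed

text \<open>If \<open>d2\<close> were negative, \<open>g'\<close> would be negative just to the
  right of 0 and the mean value theorem would give a smaller value there. Laplacians are sums of
  second derivatives along lines, so every maximum principle argument below reduces to this
  test.\<close>

lemma D2_min:
  assumes D: "D2 g d1 d2" and min: "\<forall>\<^sub>F t in nhds 0. g 0 \<le> g t"
  shows "d1 = 0" "d2 \<ge> 0"
proof -
  obtain g' where g: "\<forall>\<^sub>F t in nhds 0. (g has_real_derivative g' t) (at t)" "g' 0 = d1"
    "(g' has_real_derivative d2) (at 0)"
    using D unfolding D2_def by blast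
  obtain d where d: "d > 0" "\<And>t. \<bar>t\<bar> < d \<Longrightarrow> g 0 \<le> g t"
    "\<And>t. \<bar>t\<bar> < d \<Longrightarrow> (g has_real_derivative g' t) (at t)"
    using eventually_conj[OF min g(1)] unfolding eventually_nhds_metric dist_real_def by auto
  show d10: "d1 = 0"
    using DERIV_local_min[OF D2_imp_deriv[OF D] d(1)] d(2) by auto
  show "d2 \<ge> 0"
  proof (rule ccontr)
    assume "\<not> d2 \<ge> 0"
    then obtain e where e: "e > 0" "\<And>h. 0 < h \<Longrightarrow> h < e \<Longrightarrow> g' (0 + h) < g' 0"
      using DERIV_neg_dec_right[OF g(3)] by (auto simp: not_le)
    define h where "h = min d e / 2"
    have h: "0 < h" "h < d" "h < e" using d(1) e(1) by (auto simp: h_def min_def)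
    obtain z where z: "0 < z" "z < h" "g h - g 0 = (h - 0) * g' z"
      using MVT2[of 0 h g g'] h d(3) by auto
    have "g' z < 0" using e(2)[of z] z h g(2) d10 by auto
    then have "h * g' z < 0" using h by (simp add: mult_pos_neg)
    then have "g h < g 0" using z by simp
    then show False using d(2)[of h] h by auto
  qed
qed

text \<open>\<open>D2\<close> provides a second derivative at 0 alone, so Taylor's formula is
  replaced by two steps: the difference quotient of \<open>g'\<close> at 0 bounds
  \<open>g' t\<close> by a multiple of t, and the mean value theorem integrates this.
  \<open>lower_touch\<close> plays the bound against a power smaller than 2.\<close>

lemma D2_quadratic_bound:
  assumes D: "D2 g 0 d2" and "g 0 = 0"
  shows "\<exists>C. \<forall>\<^sub>F t in at_right 0. g t \<le> C * t\<^sup>2"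
proof -
  obtain g' where g: "\<forall>\<^sub>F t in nhds 0. (g has_real_derivative g' t) (at t)" "g' 0 = 0"
    "(g' has_real_derivative d2) (at 0)"
    using D unfolding D2_def by blast
  let ?C = "\<bar>d2\<bar> + 1"
  have "((\<lambda>t. g' t / t) \<longlongrightarrow> d2) (at 0)"
    using g(2,3) by (simp add: has_field_derivative_iff)
  then have "\<forall>\<^sub>F t in at 0. g' t / t < ?C"
    by (rule order_tendstoD) auto
  then obtain e where e: "e > 0" "\<And>t. 0 < t \<Longrightarrow> t < e \<Longrightarrow> g' t / t < ?C"
    unfolding eventually_at dist_real_def by force
  obtain d where d: "d > 0" "\<And>t. \<bar>t\<bar> < d \<Longrightarrow> (g has_real_derivative g' t) (at t)"
    using g(1) unfolding eventually_nhds_metric dist_real_def by auto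
  have "g t \<le> ?C * t\<^sup>2" if t: "0 < t" "t < min d e" for t
  proof -
    obtain z where z: "0 < z" "z < t" "g t - g 0 = (t - 0) * g' z"
      using MVT2[of 0 t g g'] t d(2) by auto
    have "g' z \<le> ?C * z" using e(2)[of z] z t by (auto simp: field_simps)
    also have "\<dots> \<le> ?C * t" using z by (intro mult_left_mono) auto
    finally show ?thesis using z t assms(2) by (auto simp: power2_eq_square mult.left_commute)
  qed
  then show ?thesis
    using d(1) e(1) unfolding eventually_at_right_field
    by (intro exI[of _ ?C] exI[of _ "min d e"]) auto
qed

subsection \<open>Hessians\<close>

lemma has_hessian_on_subset: "has_hessian_on S f H \<Longrightarrow> T \<subseteq> S \<Longrightarrow> has_hessian_on T f H"
  unfolding has_hessian_on_def by (meson continuous_on_subset subsetD)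

lemma has_hessian_on_D2:
  assumes "has_hessian_on S f H" "open S" "x \<in> S"
  shows "\<exists>L. \<forall>z. D2 (\<lambda>t. f (x + t *\<^sub>R z)) (blinfun_apply L z) (blinfun_apply (blinfun_apply (H x) z) z)"
proof -
  obtain Df where Df: "\<And>x. x \<in> S \<Longrightarrow> (f has_derivative blinfun_apply (Df x)) (at x)"
    "\<And>x. x \<in> S \<Longrightarrow> (Df has_derivative blinfun_apply (H x)) (at x)"
    using assms(1) unfolding has_hessian_on_def by blast
  have "D2 (\<lambda>t. f (x + t *\<^sub>R z)) (Df x z) (H x z z)" for z
  proof -
    have l: "((\<lambda>t. x + t *\<^sub>R z) has_derivative (\<lambda>h. h *\<^sub>R z)) (at t)" for t
      by (auto intro!: derivative_eq_intros)
    have "((\<lambda>t. x + t *\<^sub>R z) \<longlongrightarrow> x + 0 *\<^sub>R z) (nhds 0)"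
      by (intro tendsto_intros filterlim_ident)
    then have "\<forall>\<^sub>F t in nhds 0. x + t *\<^sub>R z \<in> S"
      using assms(2,3) by (intro topological_tendstoD) auto
    then have 1: "\<forall>\<^sub>F t in nhds 0. ((\<lambda>t. f (x + t *\<^sub>R z)) has_real_derivative Df (x + t *\<^sub>R z) z) (at t)"
    proof eventually_elim
      case (elim t)
      from has_derivative_compose[OF l Df(1)[OF elim]]
      show ?case
        unfolding has_field_derivative_def
        by (rule has_derivative_eq_rhs) (simp add: blinfun.scaleR_right fun_eq_iff)
    qed
    have "((\<lambda>t. Df (x + t *\<^sub>R z)) has_derivative (\<lambda>h. h *\<^sub>R H x z)) (at 0)"
      using has_derivative_compose[OF l, of Df "H x" 0] Df(2)[OF assms(3)]
      by (simp add: blinfun.scaleR_right)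
    then have "((\<lambda>t. Df (x + t *\<^sub>R z) z) has_derivative (\<lambda>h. h * H x z z)) (at 0)"
      by (rule has_derivative_eq_rhs[OF bounded_linear.has_derivative[OF blinfun.bounded_linear_left]])
         (simp add: blinfun.scaleR_left)
    then have "((\<lambda>t. Df (x + t *\<^sub>R z) z) has_real_derivative H x z z) (at 0)"
      unfolding has_field_derivative_def by (rule has_derivative_eq_rhs) (simp add: fun_eq_iff)
    with 1 show ?thesis
      unfolding D2_def by (intro exI[of _ "\<lambda>t. Df (x + t *\<^sub>R z) z"]) auto
  qed
  then show ?thesis by blast
qed

lemma eventually_line:
  fixes x z :: "'a::real_normed_vector"
  assumes "\<forall>\<^sub>F y in nhds x. P y"
  shows "\<forall>\<^sub>F t in nhds 0. P (x + t *\<^sub>R z)"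
proof -
  have "((\<lambda>t. x + t *\<^sub>R z) \<longlongrightarrow> x + 0 *\<^sub>R z) (nhds 0)"
    by (intro tendsto_intros filterlim_ident)
  then show ?thesis using assms by (simp add: filterlim_iff)
qed

lemma trace_hess_min:
  assumes f: "has_hessian_on S f H" "open S" "x \<in> S"
    and g: "has_hessian_on T g K" "open T" "x \<in> T"
    and min: "\<forall>\<^sub>F y in nhds x. f y - g y \<ge> f x - g x"
  shows "trace_hess (K x) \<le> trace_hess (H x)"
proof -
  obtain L where L: "\<And>z. D2 (\<lambda>t. f (x + t *\<^sub>R z)) (blinfun_apply L z) (H x z z)"
    using has_hessian_on_D2[OF f] by blast
  obtain M where M: "\<And>z. D2 (\<lambda>t. g (x + t *\<^sub>R z)) (blinfun_apply M z) (K x z z)"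
    using has_hessian_on_D2[OF g] by blast
  have "K x z z \<le> H x z z" for z
    using D2_min(2)[OF D2_diff[OF L M], of z z] eventually_line[OF min, of z] by simp
  then show ?thesis
    unfolding trace_hess_def by (intro sum_mono)
qed

lemma has_hessian_on_diff:
  assumes "has_hessian_on S f H" "has_hessian_on S g K"
  shows "has_hessian_on S (\<lambda>x. f x - g x) (\<lambda>x. H x - K x)"
proof -
  obtain Df where Df: "\<And>x. x \<in> S \<Longrightarrow> (f has_derivative blinfun_apply (Df x)) (at x)"
    "\<And>x. x \<in> S \<Longrightarrow> (Df has_derivative blinfun_apply (H x)) (at x)" "continuous_on S H"
    using assms(1) unfolding has_hessian_on_def by blast
  obtain Dg where Dg: "\<And>x. x \<in> S \<Longrightarrow> (g has_derivative blinfun_apply (Dg x)) (at x)"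
    "\<And>x. x \<in> S \<Longrightarrow> (Dg has_derivative blinfun_apply (K x)) (at x)" "continuous_on S K"
    using assms(2) unfolding has_hessian_on_def by blast
  show ?thesis
    unfolding has_hessian_on_def using Df Dg
    by (intro exI[of _ "\<lambda>x. Df x - Dg x"]) (auto intro!: derivative_eq_intros continuous_intros simp: blinfun.diff_left)
qed

lemma trace_hess_diff: "trace_hess (A - B) = trace_hess A - trace_hess B"
  unfolding trace_hess_def by (simp add: blinfun.diff_left sum_subtractf)

lemma has_hessian_on_inner:
  fixes u :: "'a::euclidean_space \<Rightarrow> real^'m"
  assumes "\<And>i. has_hessian_on S (\<lambda>x. u x $ i) (H i)"
  shows "has_hessian_on S (\<lambda>x. u x \<bullet> f) (\<lambda>x. \<Sum>i\<in>UNIV. (f $ i) *\<^sub>R H i x)"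
proof -
  have "\<forall>i. \<exists>Df. (\<forall>x\<in>S. ((\<lambda>x. u x $ i) has_derivative blinfun_apply (Df x)) (at x)) \<and>
      (\<forall>x\<in>S. (Df has_derivative blinfun_apply (H i x)) (at x)) \<and> continuous_on S (H i)"
    using assms unfolding has_hessian_on_def by blast
  then obtain Df where Df: "\<And>i x. x \<in> S \<Longrightarrow> ((\<lambda>x. u x $ i) has_derivative blinfun_apply (Df i x)) (at x)"
    "\<And>i x. x \<in> S \<Longrightarrow> (Df i has_derivative blinfun_apply (H i x)) (at x)" "\<And>i. continuous_on S (H i)"
    by metis
  have "((\<lambda>x. u x \<bullet> f) has_derivative (\<lambda>h. \<Sum>i\<in>UNIV. Df i x h * f $ i)) (at x)" if "x \<in> S" for x
    unfolding inner_vec_def inner_real_def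
    by (intro has_derivative_sum has_derivative_mult_left Df(1)[OF that])
  moreover have "((\<lambda>x. \<Sum>i\<in>UNIV. f $ i *\<^sub>R Df i x) has_derivative (\<lambda>h. \<Sum>i\<in>UNIV. f $ i *\<^sub>R H i x h)) (at x)"
    if "x \<in> S" for x
    using Df(2)[OF that] by (intro has_derivative_sum has_derivative_scaleR_right)
  ultimately have 1: "((\<lambda>x. u x \<bullet> f) has_derivative blinfun_apply (\<Sum>i\<in>UNIV. f $ i *\<^sub>R Df i x)) (at x)"
    "((\<lambda>x. \<Sum>i\<in>UNIV. f $ i *\<^sub>R Df i x) has_derivative blinfun_apply (\<Sum>i\<in>UNIV. f $ i *\<^sub>R H i x)) (at x)"
    if "x \<in> S" for x
    using that by (auto simp: blinfun.sum_left[abs_def] blinfun.scaleR_left[abs_def] mult.commute)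
  show ?thesis
    unfolding has_hessian_on_def
    by (intro exI[of _ "\<lambda>x. \<Sum>i\<in>UNIV. f $ i *\<^sub>R Df i x"] conjI ballI 1 continuous_intros Df(3))
qed

lemma trace_hess_sum: "trace_hess (\<Sum>i\<in>I. c i *\<^sub>R A i) = (\<Sum>i\<in>I. c i * trace_hess (A i))"
  unfolding trace_hess_def blinfun.sum_left blinfun.scaleR_left sum_distrib_left
  by (subst sum.swap) simp

text \<open>The vectors fed into \<open>A\<close> are the standard basis reflected in the hyperplane
  orthogonal to \<open>e\<close>, again an orthonormal basis, and the trace is the same in all of
  these. In the expansion each mixed sum equals \<open>A e e\<close>, so the coefficients -2, -2 and
  4 cancel.\<close>

lemma trace_hess_reflect:
  fixes e :: "'a::euclidean_space"
  assumes "norm e = 1"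
  shows "(\<Sum>i\<in>Basis. blinfun_apply (blinfun_apply A (i - (2 * (i \<bullet> e)) *\<^sub>R e)) (i - (2 * (i \<bullet> e)) *\<^sub>R e)) = trace_hess A"
proof -
  have e1: "(\<Sum>i\<in>Basis. (i \<bullet> e) *\<^sub>R i) = e"
    using euclidean_representation[of e] by (simp add: inner_commute)
  have "(\<Sum>i\<in>Basis. (i \<bullet> e) * A i e) = A (\<Sum>i\<in>Basis. (i \<bullet> e) *\<^sub>R i) e"
    by (simp add: blinfun.sum_right blinfun.sum_left blinfun.scaleR_right blinfun.scaleR_left)
  then have 1: "(\<Sum>i\<in>Basis. (i \<bullet> e) * A i e) = A e e" using e1 by simp
  have "(\<Sum>i\<in>Basis. (i \<bullet> e) * A e i) = A e (\<Sum>i\<in>Basis. (i \<bullet> e) *\<^sub>R i)"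
    by (simp add: blinfun.sum_right blinfun.scaleR_right)
  then have 2: "(\<Sum>i\<in>Basis. (i \<bullet> e) * A e i) = A e e" using e1 by simp
  have 3: "(\<Sum>i\<in>Basis. (i \<bullet> e)\<^sup>2) = 1"
    using assms euclidean_inner[of e e] by (simp add: norm_eq_1 inner_commute power2_eq_square)
  have "A (i - (2 * (i \<bullet> e)) *\<^sub>R e) (i - (2 * (i \<bullet> e)) *\<^sub>R e) =
      A i i - 2 * ((i \<bullet> e) * A i e) - 2 * ((i \<bullet> e) * A e i) + 4 * ((i \<bullet> e)\<^sup>2 * A e e)" for i
    by (simp add: blinfun.diff_right blinfun.diff_left blinfun.scaleR_right blinfun.scaleR_left
        power2_eq_square algebra_simps)
  then show ?thesis
    unfolding trace_hess_def
    by (simp add: sum.distrib sum_subtractf sum_distrib_left[symmetric] sum_distrib_right[symmetric] 1 2 3)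
qed

text \<open>Gradient vectors are easier to differentiate than functionals. Composing with the Riesz
  map \<open>?J\<close> turns the derivative of the gradient field into a Hessian in the sense of
  \<open>has_hessian_on\<close>.\<close>

lemma has_hessian_on_gradient:
  assumes f: "\<And>x. x \<in> S \<Longrightarrow> (f has_derivative (\<lambda>h. g x \<bullet> h)) (at x)"
    and g: "\<And>x. x \<in> S \<Longrightarrow> (g has_derivative blinfun_apply (A x)) (at x)"
    and A: "continuous_on S A"
  shows "\<exists>H. has_hessian_on S f H \<and> (\<forall>x. trace_hess (H x) = (\<Sum>i\<in>Basis. blinfun_apply (A x) i \<bullet> i))"
proof -
  let ?J = "Blinfun (blinfun_inner_right :: 'a \<Rightarrow> 'a \<Rightarrow>\<^sub>L real)"
  have J: "blinfun_apply ?J = blinfun_inner_right"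
    by (rule bounded_linear_Blinfun_apply) (rule bounded_linear_blinfun_inner_right)
  have "has_hessian_on S f (\<lambda>x. ?J o\<^sub>L A x)"
    unfolding has_hessian_on_def
  proof (intro exI[of _ "\<lambda>x. blinfun_inner_right (g x)"] conjI ballI)
    show "(f has_derivative blinfun_apply (blinfun_inner_right (g x))) (at x)" if "x \<in> S" for x
      using f[OF that] by simp
    show "((\<lambda>x. blinfun_inner_right (g x)) has_derivative blinfun_apply (?J o\<^sub>L A x)) (at x)" if "x \<in> S" for x
      by (rule has_derivative_eq_rhs[OF bounded_linear.has_derivative[OF bounded_linear_blinfun_inner_right g[OF that]]])
         (simp add: J fun_eq_iff)
    show "continuous_on S (\<lambda>x. ?J o\<^sub>L A x)"
      by (intro continuous_intros A)
  qed
  then show ?thesis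
    by (intro exI[of _ "\<lambda>x. ?J o\<^sub>L A x"]) (simp add: trace_hess_def J)
qed

subsection \<open>The one-dimensional profile\<close>

definition du0 :: "real \<Rightarrow> real \<Rightarrow> real" where
  "du0 p t = c_p p * kappa p * max t 0 powr (kappa p - 1)"

text \<open>This is u0'' away from 0, written as the right-hand side of the equation, so that
  \<open>du0_deriv\<close> is the one-dimensional equation for u0. At 0 there is no second
  derivative, since kappa < 2.\<close>

definition ddu0 :: "real \<Rightarrow> real \<Rightarrow> real" where
  "ddu0 p t = (if t > 0 then u0 p t powr (p - 1) else 0)"

context
  fixes p :: real
  assumes p0: "0 < p" and p1: "p < 1"
begin

lemma kappa_gt_1: "1 < kappa p" and kappa_lt_2: "kappa p < 2"
  using p0 p1 by (auto simp: kappa_def field_simps)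

lemma kappa_mult: "kappa p * (p - 2) = -2" "kappa p * (p - 1) = kappa p - 2"
  using p0 p1 by (auto simp: kappa_def field_simps)

lemma c_p_pos: "c_p p > 0"
  using kappa_gt_1 by (simp add: c_p_def)

lemma c_p_powr: "c_p p powr (p - 2) = kappa p * (kappa p - 1)"
  using kappa_gt_1 p1 by (simp add: c_p_def powr_powr)

lemma c_p_powr': "c_p p powr (p - 1) = c_p p * kappa p * (kappa p - 1)"
proof -
  have "c_p p powr (p - 1) = c_p p powr (p - 2) * c_p p powr 1"
    by (subst powr_add[symmetric]) simp
  then show ?thesis using c_p_powr c_p_pos by simp
qed

lemma u0_pos_eq: "t > 0 \<Longrightarrow> u0 p t = c_p p * t powr kappa p"
  by (simp add: u0_def)

lemma u0_nonpos: "t \<le> 0 \<Longrightarrow> u0 p t = 0"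
  by (simp add: u0_def)

lemma u0_pos: "t > 0 \<Longrightarrow> u0 p t > 0"
  using c_p_pos by (simp add: u0_def)

lemma u0_nonneg: "u0 p t \<ge> 0"
  using c_p_pos by (simp add: u0_def)

lemma u0_mono: "s \<le> t \<Longrightarrow> u0 p s \<le> u0 p t"
  unfolding u0_def using c_p_pos kappa_gt_1 by (intro mult_left_mono powr_mono2) auto

lemma u0_scale: "r > 0 \<Longrightarrow> u0 p (r * t) = r powr kappa p * u0 p t"
proof -
  assume r: "r > 0"
  have "max (r * t) 0 = r * max t 0" using r by (simp add: max_def mult_le_0_iff)
  then show ?thesis using r by (simp add: u0_def powr_mult)
qed

lemma du0_nonneg: "du0 p t \<ge> 0"
  using c_p_pos kappa_gt_1 by (simp add: du0_def)

lemma du0_mono: "s \<le> t \<Longrightarrow> du0 p s \<le> du0 p t"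
  unfolding du0_def using c_p_pos kappa_gt_1 by (intro mult_left_mono powr_mono2) auto

lemma u0_powr: "t > 0 \<Longrightarrow> u0 p t powr (p - 1) = c_p p * kappa p * (kappa p - 1) * t powr (kappa p - 2)"
  using c_p_pos by (simp add: u0_pos_eq powr_mult powr_powr kappa_mult c_p_powr')

text \<open>Along the profile the coefficient of the equation is an inverse square of the height.
  This yields the equation for the height of |u| in \<open>upper_touch\<close> and the large
  coefficient in \<open>strip_bound\<close>.\<close>

lemma u0_powr': "t > 0 \<Longrightarrow> u0 p t powr (p - 2) = kappa p * (kappa p - 1) / t\<^sup>2"
  using c_p_pos powr_minus_divide[of t 2] powr_realpow[of t 2]
  by (simp add: u0_pos_eq powr_mult powr_powr kappa_mult c_p_powr)

text \<open>Euler's relation for the homogeneous function u0'. At heights bounded below it lets u0'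
  control u0''.\<close>

lemma ddu0_eq: "t > 0 \<Longrightarrow> ddu0 p t = (kappa p - 1) * du0 p t / t"
proof -
  assume t: "t > 0"
  have "t powr (kappa p - 1) = t powr (kappa p - 2) * t powr 1"
    by (subst powr_add[symmetric]) simp
  then show ?thesis using t by (simp add: ddu0_def du0_def u0_powr)
qed

lemma u0_deriv: "(u0 p has_real_derivative du0 p t) (at t)"
proof -
  consider "t > 0" | "t < 0" | "t = 0" by linarith
  then show ?thesis
  proof cases
    case 1
    have "((\<lambda>t. c_p p * t powr kappa p) has_real_derivative du0 p t) (at t)"
      using 1 by (auto intro!: derivative_eq_intros simp: du0_def)
    moreover have "\<forall>\<^sub>F s in nhds t. u0 p s = c_p p * s powr kappa p"
      using eventually_nhds_in_open[of "{0<..}" t] 1 by (auto elim!: eventually_mono simp: u0_pos_eq)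
    ultimately show ?thesis by (subst DERIV_cong_ev) auto
  next
    case 2
    have "\<forall>\<^sub>F s in nhds t. u0 p s = 0"
      using eventually_nhds_in_open[of "{..<0}" t] 2 by (auto elim!: eventually_mono simp: u0_nonpos)
    then show ?thesis using 2 by (subst DERIV_cong_ev[where g = "\<lambda>_. 0"]) (auto simp: du0_def)
  next
    case 3
    have "((\<lambda>s. c_p p * max s 0 powr (kappa p - 1)) \<longlongrightarrow> c_p p * max 0 0 powr (kappa p - 1)) (at 0)"
      using kappa_gt_1 by (intro tendsto_intros tendsto_powr') auto
    then have 0: "((\<lambda>s. c_p p * max s 0 powr (kappa p - 1)) \<longlongrightarrow> 0) (at 0)"
      by simp
    have 1: "\<bar>u0 p s / s\<bar> \<le> c_p p * max s 0 powr (kappa p - 1)" for s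
    proof (cases "s > 0")
      case True
      have "s powr kappa p = s powr (kappa p - 1) * s powr 1"
        by (subst powr_add[symmetric]) simp
      then show ?thesis using True c_p_pos by (simp add: u0_pos_eq)
    qed (use c_p_pos in \<open>auto simp: u0_nonpos not_less\<close>)
    have lim: "((\<lambda>s. u0 p s / s) \<longlongrightarrow> 0) (at 0)"
      by (rule Lim_null_comparison[OF _ 0], rule always_eventually) (simp only: real_norm_def 1 simp_thms)
    have "u0 p 0 = 0" "du0 p 0 = 0" by (simp_all add: u0_def du0_def)
    then show ?thesis unfolding 3 has_field_derivative_iff using lim by simp
  qed
qed

lemma du0_deriv:
  assumes "t \<noteq> 0"
  shows "(du0 p has_real_derivative ddu0 p t) (at t)"
proof (cases "t > 0")
  case True
  have "((\<lambda>t. c_p p * kappa p * t powr (kappa p - 1)) has_real_derivative ddu0 p t) (at t)"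
    using True by (auto intro!: derivative_eq_intros simp: ddu0_def u0_powr)
  moreover have "\<forall>\<^sub>F s in nhds t. du0 p s = c_p p * kappa p * s powr (kappa p - 1)"
    by (rule eventually_mono[OF eventually_nhds_in_open[of "{0<..}" t]]) (use True in \<open>auto simp: du0_def max_def\<close>)
  ultimately show ?thesis by (subst DERIV_cong_ev) auto
next
  case False
  then have "t < 0" using assms by auto
  then have "\<forall>\<^sub>F s in nhds t. du0 p s = 0"
    by (intro eventually_mono[OF eventually_nhds_in_open[of "{..<0}" t]]) (auto simp: du0_def max_def)
  then show ?thesis using \<open>t < 0\<close> by (subst DERIV_cong_ev[where g = "\<lambda>_. 0"]) (auto simp: ddu0_def)
qed

lemma continuous_on_u0 [continuous_intros]: "continuous_on A f \<Longrightarrow> continuous_on A (\<lambda>x. u0 p (f x))"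
proof -
  have "continuous_on UNIV (u0 p)"
    using u0_deriv by (auto simp: continuous_on_eq_continuous_at dest: DERIV_isCont)
  then show "continuous_on A f \<Longrightarrow> continuous_on A (\<lambda>x. u0 p (f x))"
    by (rule continuous_on_compose2) auto
qed

lemma continuous_on_du0 [continuous_intros]: "continuous_on A f \<Longrightarrow> continuous_on A (\<lambda>x. du0 p (f x))"
  unfolding du0_def using kappa_gt_1 by (intro continuous_intros continuous_on_powr') auto

lemma continuous_on_ddu0: "continuous_on (- {0}) (ddu0 p)"
proof -
  have "isCont (ddu0 p) t" if "t \<noteq> 0" for t
  proof (cases "t > 0")
    case True
    have "isCont (\<lambda>t. u0 p t powr (p - 1)) t"
      using True DERIV_isCont[OF u0_deriv] u0_pos[OF True] by (intro continuous_intros) auto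
    moreover have "\<forall>\<^sub>F s in nhds t. ddu0 p s = u0 p s powr (p - 1)"
      using eventually_nhds_in_open[of "{0<..}" t] True by (auto elim!: eventually_mono simp: ddu0_def)
    ultimately show ?thesis by (simp add: isCont_cong)
  next
    case False
    then have "t < 0" using that by auto
    then have "\<forall>\<^sub>F s in nhds t. ddu0 p s = 0"
      using eventually_nhds_in_open[of "{..<0}" t] by (auto elim!: eventually_mono simp: ddu0_def)
    then show ?thesis by (simp add: isCont_cong)
  qed
  then show ?thesis by (simp add: continuous_at_imp_continuous_on)
qed

text \<open>Convexity of u0. The two bounds translate between a shift of the plane and a gap in the
  values.\<close>

lemma u0_increment:
  assumes "0 \<le> h"
  shows "u0 p t + du0 p t * h \<le> u0 p (t + h)" "u0 p (t + h) \<le> u0 p t + du0 p (t + h) * h"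
proof -
  have *: "\<exists>z. t \<le> z \<and> z \<le> t + h \<and> u0 p (t + h) - u0 p t = h * du0 p z"
  proof (cases "h = 0")
    case False
    then obtain z where "t < z" "z < t + h" "u0 p (t + h) - u0 p t = (t + h - t) * du0 p z"
      using assms MVT2[of t "t + h" "u0 p" "du0 p"] u0_deriv by auto
    then show ?thesis by (intro exI[of _ z]) auto
  qed auto
  then obtain z where z: "t \<le> z" "z \<le> t + h" "u0 p (t + h) - u0 p t = h * du0 p z" by blast
  have "h * du0 p t \<le> h * du0 p z" "h * du0 p z \<le> h * du0 p (t + h)"
    using z assms du0_mono by (auto intro!: mult_left_mono)
  then show "u0 p t + du0 p t * h \<le> u0 p (t + h)" "u0 p (t + h) \<le> u0 p t + du0 p (t + h) * h"
    using z by (auto simp: mult.commute)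
qed

end

subsection \<open>The barrier functions\<close>

definition gauss :: "real \<Rightarrow> 'a::real_inner \<Rightarrow> 'a \<Rightarrow> real" where
  "gauss k z x = exp (- k * ((x - z) \<bullet> (x - z)))"

definition level :: "'a::real_inner \<Rightarrow> real \<Rightarrow> real \<Rightarrow> real \<Rightarrow> 'a \<Rightarrow> 'a \<Rightarrow> real" where
  "level e c h k z x = x \<bullet> e + c + h * gauss k z x"

definition level_grad :: "'a::real_inner \<Rightarrow> real \<Rightarrow> real \<Rightarrow> 'a \<Rightarrow> 'a \<Rightarrow> 'a" where
  "level_grad e h k z x = e - (2 * k * h * gauss k z x) *\<^sub>R (x - z)"

text \<open>The bracket is positive once \<open>2 * k * (norm (x - z))\<^sup>2\<close> exceeds the
  dimension. A large k thus gives the level function a strict Laplacian with the sign of h in an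
  annulus around z.\<close>

definition level_lap :: "real \<Rightarrow> real \<Rightarrow> 'a::euclidean_space \<Rightarrow> 'a \<Rightarrow> real" where
  "level_lap h k z x = h * gauss k z x * (4 * k\<^sup>2 * (norm (x - z))\<^sup>2 - 2 * k * DIM('a))"

lemma gauss_pos: "gauss k z x > 0"
  by (simp add: gauss_def)

lemma gauss_le_1: "k \<ge> 0 \<Longrightarrow> gauss k z x \<le> 1"
  by (simp add: gauss_def)

lemma gauss_derivative:
  "(gauss k z has_derivative (\<lambda>h. - 2 * k * gauss k z x * ((x - z) \<bullet> h))) (at x)"
  unfolding gauss_def[abs_def]
  by (auto intro!: derivative_eq_intros simp: inner_commute algebra_simps)

lemma level_derivative:
  "(level e c h k z has_derivative (\<lambda>v. level_grad e h k z x \<bullet> v)) (at x)"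
  unfolding level_def[abs_def]
  by (rule derivative_eq_intros gauss_derivative refl)+
     (auto simp: level_grad_def inner_commute algebra_simps)

lemma continuous_on_gauss [continuous_intros]:
  "continuous_on A f \<Longrightarrow> continuous_on A (\<lambda>x. gauss k z (f x))"
  unfolding gauss_def by (intro continuous_intros)

lemma continuous_on_level [continuous_intros]:
  "continuous_on A f \<Longrightarrow> continuous_on A (\<lambda>x. level e c h k z (f x))"
  unfolding level_def by (intro continuous_intros)

text \<open>The deviation from 1 is what multiplies the singular u0''. Its leading part has the sign
  of \<open>- h * ((x - z) \<bullet> e)\<close>, which is the favourable one below z for both
  barriers.\<close>

lemma norm_level_grad:
  assumes "norm e = 1"
  shows "level_grad e h k z x \<bullet> level_grad e h k z x = 1 - 4 * k * h * gauss k z x * ((x - z) \<bullet> e)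
    + (2 * k * h * gauss k z x)\<^sup>2 * (norm (x - z))\<^sup>2"
proof -
  have e: "e \<bullet> e = 1" using assms by (simp add: norm_eq_1)
  have *: "(e - c *\<^sub>R d) \<bullet> (e - c *\<^sub>R d) = 1 - 2 * c * (d \<bullet> e) + c\<^sup>2 * (norm d)\<^sup>2" for c d
    by (simp add: e inner_diff_left inner_diff_right inner_commute[of e d] power2_norm_eq_inner power2_eq_square[of c] algebra_simps)
  show ?thesis unfolding level_grad_def * by simp
qed

text \<open>Chain rule for the Laplacian of a profile composed with the level function. The
  derivatives of \<open>G\<close> and \<open>G'\<close> are asked for only at the values attained on
  \<open>X\<close>, because u0 has no second derivative at 0.\<close>

lemma has_hessian_on_level:
  fixes z e :: "'a::euclidean_space"
  assumes G: "\<And>x. x \<in> X \<Longrightarrow> (G has_real_derivative G' (level e c h k z x)) (at (level e c h k z x))"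
    and G': "\<And>x. x \<in> X \<Longrightarrow> (G' has_real_derivative G'' (level e c h k z x)) (at (level e c h k z x))"
    and G'': "continuous_on X (\<lambda>x. G'' (level e c h k z x))"
  shows "\<exists>H. has_hessian_on X (\<lambda>x. G (level e c h k z x)) H \<and> (\<forall>x. trace_hess (H x) =
    G'' (level e c h k z x) * (level_grad e h k z x \<bullet> level_grad e h k z x) + G' (level e c h k z x) * level_lap h k z x)"
proof -
  let ?S = "level e c h k z" and ?N = "level_grad e h k z" and ?w = "gauss k z"
  define a where "a x v = (G'' (?S x) * (?N x \<bullet> v)) *\<^sub>R ?N x + G' (?S x) *\<^sub>R
     (- (2 * k * h) *\<^sub>R (?w x *\<^sub>R v + (- 2 * k * ?w x * ((x - z) \<bullet> v)) *\<^sub>R (x - z)))" for x v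
  have "linear (a x)" for x
    unfolding a_def by (rule linearI) (auto simp: inner_add_right algebra_simps)
  then have a: "blinfun_apply (Blinfun (a x)) = a x" for x
    by (simp add: bounded_linear_Blinfun_apply linear_conv_bounded_linear)
  have cG': "continuous_on X (\<lambda>x. G' (?S x))"
    unfolding continuous_on_eq_continuous_within
  proof
    fix x assume "x \<in> X"
    then have "isCont G' (?S x)" using G' DERIV_isCont by blast
    moreover have "isCont ?S x" using level_derivative has_derivative_continuous by blast
    ultimately show "continuous (at x within X) (\<lambda>x. G' (?S x))"
      using continuous_at_imp_continuous_at_within isCont_o2 by blast
  qed
  have "\<exists>H. has_hessian_on X (\<lambda>x. G (?S x)) H \<and> (\<forall>x. trace_hess (H x) = (\<Sum>i\<in>Basis. blinfun_apply (Blinfun (a x)) i \<bullet> i))"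
  proof (rule has_hessian_on_gradient)
    fix x assume x: "x \<in> X"
    show "((\<lambda>x. G (?S x)) has_derivative (\<lambda>v. (G' (?S x) *\<^sub>R ?N x) \<bullet> v)) (at x)"
      using has_derivative_compose[OF level_derivative, of G "(*) (G' (?S x))" e c h k z x] G[OF x]
      by (simp add: has_field_derivative_def)
    have 1: "((\<lambda>x. G' (?S x)) has_derivative (\<lambda>v. G'' (?S x) * (?N x \<bullet> v))) (at x)"
      using has_derivative_compose[OF level_derivative, of G' "(*) (G'' (?S x))" e c h k z x] G'[OF x]
      by (simp add: has_field_derivative_def)
    have 2: "(?N has_derivative (\<lambda>v. - (2 * k * h) *\<^sub>R (?w x *\<^sub>R v + (- 2 * k * ?w x * ((x - z) \<bullet> v)) *\<^sub>R (x - z)))) (at x)"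
      unfolding level_grad_def[abs_def]
      by (rule derivative_eq_intros gauss_derivative refl)+ (auto simp: algebra_simps)
    show "((\<lambda>x. G' (?S x) *\<^sub>R ?N x) has_derivative blinfun_apply (Blinfun (a x))) (at x)"
      using has_derivative_scaleR[OF 1 2] by (simp only: a, simp add: a_def[abs_def] add.commute)
  next
    show "continuous_on X (\<lambda>x. Blinfun (a x))"
    proof (rule continuous_on_blinfun_componentwise)
      fix i :: 'a
      show "continuous_on X (\<lambda>x. blinfun_apply (Blinfun (a x)) i)"
        unfolding a a_def level_grad_def by (intro continuous_intros cG' G'')
    qed
  qed
  moreover have "(\<Sum>i\<in>Basis. a x i \<bullet> i) = G'' (?S x) * (?N x \<bullet> ?N x) + G' (?S x) * level_lap h k z x" for x
  proof -
    have "a x i \<bullet> i = G'' (?S x) * ((?N x \<bullet> i) * (?N x \<bullet> i)) - (G' (?S x) * (2 * k * h * ?w x)) * (i \<bullet> i)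
      + (G' (?S x) * (4 * k\<^sup>2 * h * ?w x)) * (((x - z) \<bullet> i) * ((x - z) \<bullet> i))" for i
      by (simp add: a_def inner_add_left inner_diff_left power2_eq_square algebra_simps)
    moreover have "(\<Sum>i\<in>Basis. (i::'a) \<bullet> i) = DIM('a)"
      by (simp add: inner_same_Basis)
    ultimately have "(\<Sum>i\<in>Basis. a x i \<bullet> i) = G'' (?S x) * (?N x \<bullet> ?N x) - (G' (?S x) * (2 * k * h * ?w x)) * DIM('a)
      + (G' (?S x) * (4 * k\<^sup>2 * h * ?w x)) * ((x - z) \<bullet> (x - z))"
      by (simp only: sum.distrib sum_subtractf sum_distrib_left[symmetric] euclidean_inner[symmetric])
    then show ?thesis
      by (simp add: level_lap_def power2_norm_eq_inner algebra_simps)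
  qed
  ultimately show ?thesis by (simp add: a)
qed

subsection \<open>Viscosity solutions\<close>

lemma open_posset: "open \<Omega> \<Longrightarrow> continuous_on \<Omega> u \<Longrightarrow> open (posset \<Omega> u)"
  unfolding posset_def using continuous_on_open_vimage[of \<Omega> "\<lambda>x. norm (u x)"]
  by (force simp: vimage_def Int_def conj_commute dest!: spec[of _ "{0<..}"] intro: continuous_intros)

lemma viscosity_solution_continuous: "viscosity_solution p \<Omega> u \<Longrightarrow> continuous_on \<Omega> u"
  by (simp add: viscosity_solution_def)

text \<open>All components share the coefficient |u|^(p-2), so the equation passes to every linear
  combination of them.\<close>

lemma viscosity_solution_hessian:
  assumes "viscosity_solution p \<Omega> u"
  shows "\<exists>H. has_hessian_on (posset \<Omega> u) (\<lambda>x. u x \<bullet> f) H \<and>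
    (\<forall>x\<in>posset \<Omega> u. trace_hess (H x) = norm (u x) powr (p - 2) * (u x \<bullet> f))"
proof -
  have "\<forall>i. \<exists>H. has_hessian_on (posset \<Omega> u) (\<lambda>x. u x $ i) H \<and>
    (\<forall>x\<in>posset \<Omega> u. trace_hess (H x) = norm (u x) powr (p - 2) * u x $ i)"
    using assms unfolding viscosity_solution_def classical_laplace_eq_def by blast
  then obtain H where H: "\<And>i. has_hessian_on (posset \<Omega> u) (\<lambda>x. u x $ i) (H i)"
    "\<And>i x. x \<in> posset \<Omega> u \<Longrightarrow> trace_hess (H i x) = norm (u x) powr (p - 2) * u x $ i"
    by metis
  show ?thesis
    using has_hessian_on_inner[OF H(1)] H(2)
    by (intro exI[of _ "\<lambda>x. \<Sum>i\<in>UNIV. f $ i *\<^sub>R H i x"])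
       (auto simp: trace_hess_sum inner_vec_def sum_distrib_left algebra_simps)
qed

subsection \<open>Rescaling\<close>

lemma affine_derivative: "((\<lambda>x. a + s *\<^sub>R x) has_derivative (\<lambda>h. s *\<^sub>R h)) (at x)"
  by (auto intro!: derivative_eq_intros)

lemma has_derivative_affine:
  fixes f :: "'a::real_normed_vector \<Rightarrow> 'b::real_normed_vector"
  assumes "(f has_derivative blinfun_apply D) (at (a + s *\<^sub>R x))"
  shows "((\<lambda>x. c *\<^sub>R f (a + s *\<^sub>R x)) has_derivative blinfun_apply ((c * s) *\<^sub>R D)) (at x)"
  using has_derivative_scaleR_right[OF has_derivative_compose[OF affine_derivative assms], of c]
  by (rule has_derivative_eq_rhs) (simp add: fun_eq_iff blinfun.scaleR_left blinfun.scaleR_right)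

lemma has_hessian_on_affine:
  assumes "has_hessian_on S f H" "\<And>x. x \<in> T \<Longrightarrow> a + s *\<^sub>R x \<in> S"
  shows "has_hessian_on T (\<lambda>x. c * f (a + s *\<^sub>R x)) (\<lambda>x. (c * s\<^sup>2) *\<^sub>R H (a + s *\<^sub>R x))"
proof -
  obtain Df where Df: "\<And>x. x \<in> S \<Longrightarrow> (f has_derivative blinfun_apply (Df x)) (at x)"
    "\<And>x. x \<in> S \<Longrightarrow> (Df has_derivative blinfun_apply (H x)) (at x)" "continuous_on S H"
    using assms(1) unfolding has_hessian_on_def by blast
  show ?thesis
    unfolding has_hessian_on_def
  proof (intro exI[of _ "\<lambda>x. (c * s) *\<^sub>R Df (a + s *\<^sub>R x)"] conjI ballI)
    fix x assume x: "x \<in> T"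
    show "((\<lambda>x. c * f (a + s *\<^sub>R x)) has_derivative blinfun_apply ((c * s) *\<^sub>R Df (a + s *\<^sub>R x))) (at x)"
      using has_derivative_affine[OF Df(1)[OF assms(2)[OF x]], of c] by simp
    show "((\<lambda>x. (c * s) *\<^sub>R Df (a + s *\<^sub>R x)) has_derivative blinfun_apply ((c * s\<^sup>2) *\<^sub>R H (a + s *\<^sub>R x))) (at x)"
      using has_derivative_affine[OF Df(2)[OF assms(2)[OF x]], of "c * s"] by (simp add: power2_eq_square mult.assoc)
  next
    show "continuous_on T (\<lambda>x. (c * s\<^sup>2) *\<^sub>R H (a + s *\<^sub>R x))"
      using assms(2) by (intro continuous_intros continuous_on_compose2[OF Df(3)]) auto
  qed
qed

lemma C1_on_affine:
  assumes "C1_on S f" "\<And>x. x \<in> T \<Longrightarrow> a + s *\<^sub>R x \<in> S"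
  shows "C1_on T (\<lambda>x. c * f (a + s *\<^sub>R x))"
proof -
  obtain Df where Df: "\<And>x. x \<in> S \<Longrightarrow> (f has_derivative blinfun_apply (Df x)) (at x)" "continuous_on S Df"
    using assms(1) unfolding C1_on_def by blast
  show ?thesis
    unfolding C1_on_def
  proof (intro exI[of _ "\<lambda>x. (c * s) *\<^sub>R Df (a + s *\<^sub>R x)"] conjI ballI)
    fix x assume x: "x \<in> T"
    show "((\<lambda>x. c * f (a + s *\<^sub>R x)) has_derivative blinfun_apply ((c * s) *\<^sub>R Df (a + s *\<^sub>R x))) (at x)"
      using has_derivative_affine[OF Df(1)[OF assms(2)[OF x]], of c] by simp
  next
    show "continuous_on T (\<lambda>x. (c * s) *\<^sub>R Df (a + s *\<^sub>R x))"
      using assms(2) by (intro continuous_intros continuous_on_compose2[OF Df(2)]) auto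
  qed
qed

lemma trace_hess_scaleR: "trace_hess (c *\<^sub>R A) = c * trace_hess A"
  by (simp add: trace_hess_def blinfun.scaleR_left sum_distrib_left)

text \<open>Test functions travel from the rescaled solution back to the original one. Since
  \<open>kappa p * (p - 1) = kappa p - 2\<close>, both sides of the differential inequality pick up
  the same power of r.\<close>

lemma admissible_test_rescale:
  assumes p: "0 < p" "p < 1" and r: "r > 0" and adm: "admissible_test p (ball y0 \<rho>) y0 \<phi>"
  shows "admissible_test p (ball (x0 + r *\<^sub>R y0) (r * \<rho>)) (x0 + r *\<^sub>R y0)
    (\<lambda>x. r powr kappa p * \<phi> (- (1 / r) *\<^sub>R x0 + (1 / r) *\<^sub>R x))"
proof -
  let ?A = "\<lambda>x. - (1 / r) *\<^sub>R x0 + (1 / r) *\<^sub>R x"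
  have A0: "?A (x0 + r *\<^sub>R y0) = y0" using r by (simp add: algebra_simps)
  have in_ball: "?A x \<in> ball y0 \<rho>" if "x \<in> ball (x0 + r *\<^sub>R y0) (r * \<rho>)" for x
  proof -
    have "y0 - ?A x = (1 / r) *\<^sub>R ((x0 + r *\<^sub>R y0) - x)" using r by (simp add: algebra_simps)
    then have "r * dist y0 (?A x) = dist (x0 + r *\<^sub>R y0) x" using r by (simp add: dist_norm)
    then show ?thesis using that r mult_less_cancel_left_pos[of r "dist y0 (?A x)" \<rho>] by simp
  qed
  have 1: "C1_on (ball y0 \<rho>) \<phi>" "\<phi> y0 = 0"
    using adm by (auto simp: admissible_test_def)
  obtain D where D: "(\<phi> has_derivative D) (at y0)" "D \<noteq> (\<lambda>_. 0)"
    using adm by (auto simp: admissible_test_def)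
  obtain H where H: "has_hessian_on (ball y0 \<rho> \<inter> {x. \<phi> x \<noteq> 0}) \<phi> H"
    "\<And>x. x \<in> ball y0 \<rho> \<inter> {x. \<phi> x \<noteq> 0} \<Longrightarrow> (if \<phi> x > 0 then \<phi> x powr (p - 1) else 0) < trace_hess (H x)"
    using adm by (auto simp: admissible_test_def classical_laplace_gt_def)
  have D': "((\<lambda>x. r powr kappa p * \<phi> (?A x)) has_derivative (\<lambda>h. r powr kappa p * D ((1 / r) *\<^sub>R h))) (at (x0 + r *\<^sub>R y0))"
  proof -
    have "(\<phi> has_derivative D) (at (?A (x0 + r *\<^sub>R y0)))" using D(1) A0 by simp
    from has_derivative_mult_right[OF has_derivative_compose[OF affine_derivative this], of "r powr kappa p"]
    show ?thesis by simp
  qed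
  obtain h where h: "D h \<noteq> 0" using D(2) by auto
  have D'': "(\<lambda>h. r powr kappa p * D ((1 / r) *\<^sub>R h)) \<noteq> (\<lambda>_. 0)"
    using h r by (intro notI) (drule fun_cong[of _ _ "r *\<^sub>R h"], simp)
  show ?thesis
    unfolding admissible_test_def classical_laplace_gt_def
  proof (intro conjI exI)
    show "C1_on (ball (x0 + r *\<^sub>R y0) (r * \<rho>)) (\<lambda>x. r powr kappa p * \<phi> (?A x))"
      by (rule C1_on_affine[OF 1(1) in_ball])
    show "r powr kappa p * \<phi> (?A (x0 + r *\<^sub>R y0)) = 0" using A0 1 by simp
    show "((\<lambda>x. r powr kappa p * \<phi> (?A x)) has_derivative (\<lambda>h. r powr kappa p * D ((1 / r) *\<^sub>R h))) (at (x0 + r *\<^sub>R y0))"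
      by (rule D')
    show "(\<lambda>h. r powr kappa p * D ((1 / r) *\<^sub>R h)) \<noteq> (\<lambda>_. 0)" by (rule D'')
    show "has_hessian_on (ball (x0 + r *\<^sub>R y0) (r * \<rho>) \<inter> {x. r powr kappa p * \<phi> (?A x) \<noteq> 0})
        (\<lambda>x. r powr kappa p * \<phi> (?A x)) (\<lambda>x. (r powr kappa p * (1 / r)\<^sup>2) *\<^sub>R H (?A x))"
      using in_ball by (intro has_hessian_on_affine[OF H(1)]) auto
    show "\<forall>x\<in>ball (x0 + r *\<^sub>R y0) (r * \<rho>) \<inter> {x. r powr kappa p * \<phi> (?A x) \<noteq> 0}.
       (if 0 < r powr kappa p * \<phi> (?A x) then (r powr kappa p * \<phi> (?A x)) powr (p - 1) else 0)
       < trace_hess ((r powr kappa p * (1 / r)\<^sup>2) *\<^sub>R H (?A x))"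
    proof
      fix x assume "x \<in> ball (x0 + r *\<^sub>R y0) (r * \<rho>) \<inter> {x. r powr kappa p * \<phi> (?A x) \<noteq> 0}"
      then have x: "?A x \<in> ball y0 \<rho> \<inter> {x. \<phi> x \<noteq> 0}" using in_ball by auto
      have pos: "r powr kappa p * (1 / r)\<^sup>2 > 0" using r by simp
      have eq: "(r powr kappa p * \<phi> (?A x)) powr (p - 1) = (r powr kappa p * (1 / r)\<^sup>2) * \<phi> (?A x) powr (p - 1)"
        if "\<phi> (?A x) > 0"
      proof -
        have "r powr (kappa p - 2) = r powr kappa p * r powr (-2)"
          by (subst powr_add[symmetric]) simp
        then show ?thesis
          using r that powr_realpow[of r 2]
          by (simp add: powr_mult powr_powr kappa_mult[OF p] powr_minus_divide power_one_over)
      qed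
      have "(r powr kappa p * (1 / r)\<^sup>2) * (if \<phi> (?A x) > 0 then \<phi> (?A x) powr (p - 1) else 0)
          < (r powr kappa p * (1 / r)\<^sup>2) * trace_hess (H (?A x))"
        using H(2)[OF x] pos by (rule mult_strict_left_mono)
      then show "(if 0 < r powr kappa p * \<phi> (?A x) then (r powr kappa p * \<phi> (?A x)) powr (p - 1) else 0)
        < trace_hess ((r powr kappa p * (1 / r)\<^sup>2) *\<^sub>R H (?A x))"
        using eq r by (auto simp: trace_hess_scaleR zero_less_mult_iff)
    qed
  qed
qed

text \<open>kappa is the scaling exponent of the equation: the coefficient |u|^(p-2) of the rescaled
  function gains exactly the factor \<open>r\<^sup>2\<close> that two derivatives produce. A
  forbidden test function for the rescaled solution would give one for \<open>u\<close>.\<close>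

lemma viscosity_solution_rescale:
  fixes u :: "'a::euclidean_space \<Rightarrow> real^'m"
  assumes p: "0 < p" "p < 1" and r: "r > 0" and sub: "ball x0 r \<subseteq> \<Omega>"
    and u: "viscosity_solution p \<Omega> u"
  shows "viscosity_solution p (ball 0 1) (\<lambda>y. (r powr - kappa p) *\<^sub>R u (x0 + r *\<^sub>R y))"
    (is "viscosity_solution p _ ?v")
proof -
  let ?c = "r powr - kappa p"
  have c: "?c > 0" using r by simp
  have in_ball: "x0 + r *\<^sub>R y \<in> ball x0 r" if "y \<in> ball 0 1" for y
    using that r by (simp add: dist_norm)
  then have in_\<Omega>: "x0 + r *\<^sub>R y \<in> \<Omega>" if "y \<in> ball 0 1" for y
    using that sub by blast
  have cu: "continuous_on \<Omega> u" using u by (rule viscosity_solution_continuous)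
  have cv: "continuous_on (ball 0 1) ?v"
    using in_\<Omega> by (intro continuous_intros continuous_on_compose2[OF cu]) auto
  have pos: "x0 + r *\<^sub>R y \<in> posset \<Omega> u" if "y \<in> posset (ball 0 1) ?v" for y
    using that in_\<Omega> by (auto simp: posset_def)
  show ?thesis
    unfolding viscosity_solution_def
  proof (intro conjI cv allI ballI notI)
    fix i
    obtain H where H: "has_hessian_on (posset \<Omega> u) (\<lambda>x. u x $ i) H"
      "\<And>x. x \<in> posset \<Omega> u \<Longrightarrow> trace_hess (H x) = norm (u x) powr (p - 2) * u x $ i"
      using u unfolding viscosity_solution_def classical_laplace_eq_def by blast
    show "classical_laplace_eq (posset (ball 0 1) ?v) (\<lambda>x. ?v x $ i)
        (\<lambda>x. norm (?v x) powr (p - 2) * ?v x $ i)"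
      unfolding classical_laplace_eq_def
    proof (intro exI conjI ballI)
      show "has_hessian_on (posset (ball 0 1) ?v) (\<lambda>x. ?v x $ i) (\<lambda>y. (?c * r\<^sup>2) *\<^sub>R H (x0 + r *\<^sub>R y))"
        using has_hessian_on_affine[OF H(1) pos, of "posset (ball 0 1) ?v" ?c] by simp
      fix y assume y: "y \<in> posset (ball 0 1) ?v"
      have "?c powr (p - 2) = r powr 2"
        using r kappa_mult(1)[OF p] by (simp add: powr_powr)
      then have "?c powr (p - 2) = r\<^sup>2" using r by (simp add: powr_realpow)
      then show "trace_hess ((?c * r\<^sup>2) *\<^sub>R H (x0 + r *\<^sub>R y)) = norm (?v y) powr (p - 2) * ?v y $ i"
        using H(2)[OF pos[OF y]] by (simp add: trace_hess_scaleR powr_mult)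
    qed
  next
    fix y0 f
    assume y0: "y0 \<in> freebd (ball 0 1) ?v"
    assume "\<exists>\<phi> \<rho>. 0 < \<rho> \<and> ball y0 \<rho> \<subseteq> ball 0 1 \<and> admissible_test p (ball y0 \<rho>) y0 \<phi> \<and>
       (\<forall>x\<in>ball y0 \<rho>. \<phi> x \<le> ?v x \<bullet> f)"
    then obtain \<phi> \<rho> where \<rho>: "\<rho> > 0" "ball y0 \<rho> \<subseteq> ball 0 1" "admissible_test p (ball y0 \<rho>) y0 \<phi>"
      "\<And>x. x \<in> ball y0 \<rho> \<Longrightarrow> \<phi> x \<le> ?v x \<bullet> f" by blast
    let ?x = "x0 + r *\<^sub>R y0"
    have yb: "y0 \<in> ball 0 1" using y0 by (simp add: freebd_def)
    \<comment> \<open>The positivity set is open, so a free boundary point is a zero. Conversely a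
      zero in the closure of the positivity set is a free boundary point, and this is what is
      verified for \<open>?x\<close>.\<close>
    have "y0 \<notin> posset (ball 0 1) ?v"
      using y0 open_posset[OF open_ball cv] by (auto simp: freebd_def frontier_def interior_open)
    then have "u ?x = 0" using yb c by (auto simp: posset_def zero_less_mult_iff)
    then have "?x \<notin> posset \<Omega> u" by (simp add: posset_def)
    then have "?x \<notin> interior (posset \<Omega> u)" using interior_subset by blast
    moreover have "?x \<in> closure (posset \<Omega> u)"
    proof -
      have "y0 \<in> closure (posset (ball 0 1) ?v)" using y0 by (simp add: freebd_def frontier_def)
      moreover have "(\<lambda>y. x0 + r *\<^sub>R y) ` closure (posset (ball 0 1) ?v) \<subseteq> closure (posset \<Omega> u)"
        by (rule image_closure_subset)
           (use pos closure_subset in \<open>auto intro!: continuous_intros\<close>)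
      ultimately show ?thesis by blast
    qed
    ultimately have x: "?x \<in> freebd \<Omega> u"
      using in_\<Omega>[OF yb] by (simp add: freebd_def frontier_def)
    let ?A = "\<lambda>x. - (1 / r) *\<^sub>R x0 + (1 / r) *\<^sub>R x"
    have inv_in: "?A x \<in> ball y0 \<rho>" "x0 + r *\<^sub>R ?A x = x" if "x \<in> ball ?x (r * \<rho>)" for x
    proof -
      show "x0 + r *\<^sub>R ?A x = x" using r by (simp add: algebra_simps)
      have "y0 - ?A x = (1 / r) *\<^sub>R (?x - x)" using r by (simp add: algebra_simps)
      then have "r * dist y0 (?A x) = dist ?x x" using r by (simp add: dist_norm)
      then show "?A x \<in> ball y0 \<rho>"
        using that r mult_less_cancel_left_pos[of r "dist y0 (?A x)" \<rho>] by simp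
    qed
    have "ball ?x (r * \<rho>) \<subseteq> \<Omega>"
      using inv_in in_\<Omega> \<rho>(2) by (metis subsetD subsetI)
    moreover have "r powr kappa p * \<phi> (?A x) \<le> u x \<bullet> f" if "x \<in> ball ?x (r * \<rho>)" for x
    proof -
      have "\<phi> (?A x) \<le> ?v (?A x) \<bullet> f" using inv_in(1)[OF that] \<rho>(4) by blast
      also have "?v (?A x) = ?c *\<^sub>R u x" using inv_in(2)[OF that] by metis
      finally have "r powr kappa p * \<phi> (?A x) \<le> r powr kappa p * (?c * (u x \<bullet> f))"
        by (intro mult_left_mono) auto
      also have "\<dots> = (r powr kappa p * ?c) * (u x \<bullet> f)" by simp
      also have "r powr kappa p * ?c = 1" using r by (simp add: powr_minus)
      finally show ?thesis by simp
    qed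
    ultimately show False
      using u x \<rho>(1) r admissible_test_rescale[OF p r \<rho>(3)] unfolding viscosity_solution_def
      by (meson mult_pos_pos)
  qed
qed

subsection \<open>A Harnack dichotomy by doubling of variables\<close>

text \<open>A barrier-sense notion: \<open>V\<close> has at x a smooth majorant with nonpositive
  Laplacian at that point. At a minimum of \<open>V\<close> minus a smooth function, the majorant
  has the same minimum, so the second derivative test applies although |u| - u0 need not satisfy an
  equation.\<close>

definition superharmonic_at :: "('a::euclidean_space \<Rightarrow> real) \<Rightarrow> 'a \<Rightarrow> bool" where
  "superharmonic_at V x \<longleftrightarrow> (\<exists>T f H. open T \<and> x \<in> T \<and> has_hessian_on T f H \<and> trace_hess (H x) \<le> 0 \<and>
     f x = V x \<and> (\<forall>y\<in>T. V y \<le> f y))"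

lemma norm_line:
  "(norm (x + t *\<^sub>R v))\<^sup>2 = (norm x)\<^sup>2 + 2 * t * (v \<bullet> x) + t\<^sup>2 * (v \<bullet> v)"
  unfolding power2_norm_eq_inner
  by (simp add: inner_add_left inner_add_right inner_commute[of x v] power2_eq_square algebra_simps)

text \<open>If \<open>V x + W y\<close> were too small off the diagonal, minimise \<open>V x + W y - \<Phi> x y\<close> with a suitable \<open>\<Phi>\<close>. At a
  minimum \<open>(x, y)\<close> one tests with the directions \<open>(i, m i)\<close>, \<open>m\<close> the reflection along \<open>x - y\<close> (a reflection
  coupling): the sum over \<open>i\<close> sees only the convexity of \<open>\<Phi>\<close> in \<open>|x - y|\<close>.\<close>

lemma doubling:
  fixes V W :: "'a::euclidean_space \<Rightarrow> real"
  assumes R: "R > 0" and lam: "lam > 0"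
    and cont: "continuous_on (cball z R) V" "continuous_on (cball z R) W"
    and nn: "\<And>x. x \<in> cball z R \<Longrightarrow> V x \<ge> 0" "\<And>x. x \<in> cball z R \<Longrightarrow> W x \<ge> 0"
    and sh: "\<And>x. x \<in> ball z R \<Longrightarrow> superharmonic_at V x" "\<And>x. x \<in> ball z R \<Longrightarrow> superharmonic_at W x"
    and sum: "\<And>x. x \<in> cball z R \<Longrightarrow> V x + W x \<ge> lam"
    and xy: "x \<in> cball z (R / (20 * DIM('a)))" "y \<in> cball z (R / (20 * DIM('a)))"
  shows "V x + W y \<ge> lam / 2"
proof -
  define n where "n = real DIM('a)"
  have n: "n \<ge> 1" using DIM_positive[where 'a = 'a] unfolding n_def by linarith
  \<comment> \<open>Three requirements fix the constants of \<open>\<Phi>\<close>. With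
    \<open>\<beta> = 1 / R\<^sup>2\<close> a negative minimum cannot sit on the boundary of either
    ball; with \<open>A = 2 * R * B\<close> the part in s = |x - y|, which is - B s (2 R - s), is
    nonpositive for s up to 2 R; with \<open>B = n * \<beta>\<close> the coupled second derivatives
    of the bracket sum to 8 B - 4 n \<beta> = 4 B > 0.\<close>
  define \<beta> where "\<beta> = 1 / R\<^sup>2"
  define B where "B = n * \<beta>"
  define A where "A = 2 * R * B"
  have pos: "\<beta> > 0" "B > 0" "A > 0" using R n by (auto simp: \<beta>_def B_def A_def)
  define \<Phi> where "\<Phi> x y = lam * (1 - A * norm (x - y) + B * (norm (x - y))\<^sup>2
     - \<beta> * ((norm (x - z))\<^sup>2 + (norm (y - z))\<^sup>2))" for x y
  let ?K = "cball z R \<times> cball z R"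
  let ?F = "\<lambda>q. V (fst q) + W (snd q) - \<Phi> (fst q) (snd q)"
  have "continuous_on ?K ?F"
    unfolding \<Phi>_def by (intro continuous_intros continuous_on_compose2[OF cont(1)] continuous_on_compose2[OF cont(2)]) auto
  moreover have "compact ?K" by (intro compact_Times compact_cball)
  moreover have "?K \<noteq> {}" using R by auto
  ultimately obtain q where q: "q \<in> ?K" "\<And>q'. q' \<in> ?K \<Longrightarrow> ?F q \<le> ?F q'"
    using continuous_attains_inf by (metis (no_types, lifting))
  obtain x1 y1 where q_def: "q = (x1, y1)" by (cases q)
  have x1: "x1 \<in> cball z R" and y1: "y1 \<in> cball z R" using q(1) q_def by auto
  have min: "V x1 + W y1 - \<Phi> x1 y1 \<le> V x' + W y' - \<Phi> x' y'" if "x' \<in> cball z R" "y' \<in> cball z R" for x' y'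
    using q(2)[of "(x', y')"] that q_def by simp
  have "V x1 + W y1 - \<Phi> x1 y1 \<ge> 0"
  proof (rule ccontr)
    assume neg: "\<not> V x1 + W y1 - \<Phi> x1 y1 \<ge> 0"
    then have \<Phi>1: "\<Phi> x1 y1 > 0" using nn x1 y1 by fastforce
    have s2: "norm (x1 - y1) \<le> 2 * R"
      using norm_triangle_ineq4[of "x1 - z" "y1 - z"] x1 y1 by (auto simp: dist_norm norm_minus_commute)
    have "A * norm (x1 - y1) - B * (norm (x1 - y1))\<^sup>2 = B * (norm (x1 - y1) * (2 * R - norm (x1 - y1)))"
      by (simp add: A_def power2_eq_square algebra_simps)
    also have "\<dots> \<ge> 0" using s2 pos by (intro mult_nonneg_nonneg) auto
    finally have s3: "A * norm (x1 - y1) - B * (norm (x1 - y1))\<^sup>2 \<ge> 0" .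
    have "1 - A * norm (x1 - y1) + B * (norm (x1 - y1))\<^sup>2 - \<beta> * ((norm (x1 - z))\<^sup>2 + (norm (y1 - z))\<^sup>2) > 0"
      using \<Phi>1 lam unfolding \<Phi>_def by (simp add: zero_less_mult_iff)
    then have "\<beta> * ((norm (x1 - z))\<^sup>2 + (norm (y1 - z))\<^sup>2) < 1" using s3 by simp
    then have "(norm (x1 - z))\<^sup>2 + (norm (y1 - z))\<^sup>2 < R\<^sup>2"
      using R by (simp add: \<beta>_def field_simps)
    then have "(norm (x1 - z))\<^sup>2 < R\<^sup>2" "(norm (y1 - z))\<^sup>2 < R\<^sup>2"
      using zero_le_power2[of "norm (x1 - z)"] zero_le_power2[of "norm (y1 - z)"] by linarith+
    then have xb: "x1 \<in> ball z R" and yb: "y1 \<in> ball z R"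
      using R by (auto simp: dist_norm norm_minus_commute power_less_imp_less_base dest!: power_less_imp_less_base)
    \<comment> \<open>The norm is not smooth on the diagonal, but there \<open>\<Phi>\<close> is at
      most \<open>lam\<close>, hence at most V + W.\<close>
    have ne: "x1 \<noteq> y1"
    proof
      assume "x1 = y1"
      then have "\<Phi> x1 y1 \<le> lam * 1"
        unfolding \<Phi>_def using pos lam by (intro mult_left_mono) (auto simp: zero_le_mult_iff)
      then show False using sum[OF x1] neg \<open>x1 = y1\<close> by simp
    qed
    obtain T f H where f: "open T" "x1 \<in> T" "has_hessian_on T f H" "trace_hess (H x1) \<le> 0" "f x1 = V x1"
      "\<And>y. y \<in> T \<Longrightarrow> V y \<le> f y"
      using sh(1)[OF xb] unfolding superharmonic_at_def by blast
    obtain T' g K where g: "open T'" "y1 \<in> T'" "has_hessian_on T' g K" "trace_hess (K y1) \<le> 0" "g y1 = W y1"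
      "\<And>y. y \<in> T' \<Longrightarrow> W y \<le> g y"
      using sh(2)[OF yb] unfolding superharmonic_at_def by blast
    obtain L where L: "\<And>v. D2 (\<lambda>t. f (x1 + t *\<^sub>R v)) (blinfun_apply L v) (H x1 v v)"
      using has_hessian_on_D2[OF f(3,1,2)] by blast
    obtain M where M: "\<And>v. D2 (\<lambda>t. g (y1 + t *\<^sub>R v)) (blinfun_apply M v) (K y1 v v)"
      using has_hessian_on_D2[OF g(3,1,2)] by blast
    define s0 where "s0 = norm (x1 - y1)"
    define e where "e = (1 / s0) *\<^sub>R (x1 - y1)"
    have s0: "s0 > 0" using ne by (simp add: s0_def)
    have e: "norm e = 1" "x1 - y1 = s0 *\<^sub>R e" using ne by (auto simp: e_def s0_def)
    have ee: "e \<bullet> e = 1" using e(1) by (simp add: norm_eq_1)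
    define m where "m i = i - (2 * (i \<bullet> e)) *\<^sub>R e" for i
    have key: "H x1 i i + K y1 (m i) (m i) - lam * (8 * B * (i \<bullet> e)\<^sup>2 - 4 * \<beta>) \<ge> 0" if i: "i \<in> Basis" for i
    proof -
      have ii: "i \<bullet> i = 1" using i by (simp add: inner_same_Basis)
      have mm: "m i \<bullet> m i = 1"
        by (simp add: m_def inner_diff_left inner_diff_right ee ii inner_commute[of e i])
      \<comment> \<open>Along the coupled lines the difference of the two points keeps the direction
        \<open>e\<close>, so its norm is affine in t for small t. Hence \<open>\<Phi>\<close> is
        exactly a quadratic polynomial there, with the coefficients \<open>c1\<close> and
        \<open>c2\<close>.\<close>
      define c1 where "c1 = lam * (- A * (2 * (i \<bullet> e)) + B * (4 * s0 * (i \<bullet> e)) - \<beta> * (2 * (i \<bullet> (x1 - z)) + 2 * (m i \<bullet> (y1 - z))))"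
      define c2 where "c2 = lam * (4 * B * (i \<bullet> e)\<^sup>2 - 2 * \<beta>)"
      have "\<forall>\<^sub>F t in nhds 0. s0 + 2 * t * (i \<bullet> e) > 0"
      proof -
        have "((\<lambda>t. s0 + 2 * t * (i \<bullet> e)) \<longlongrightarrow> s0 + 2 * 0 * (i \<bullet> e)) (nhds 0)"
          by (intro tendsto_intros filterlim_ident)
        then show ?thesis using s0 by (intro order_tendstoD) auto
      qed
      then have "\<forall>\<^sub>F t in nhds 0. \<Phi> (x1 + t *\<^sub>R i) (y1 + t *\<^sub>R m i) = \<Phi> x1 y1 + c1 * t + c2 * t\<^sup>2"
      proof eventually_elim
        case (elim t)
        have "(x1 + t *\<^sub>R i) - (y1 + t *\<^sub>R m i) = (x1 - y1) + (2 * t * (i \<bullet> e)) *\<^sub>R e"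
          by (simp add: m_def algebra_simps)
        also have "\<dots> = (s0 + 2 * t * (i \<bullet> e)) *\<^sub>R e" by (simp add: e(2) algebra_simps)
        finally have 1: "norm ((x1 + t *\<^sub>R i) - (y1 + t *\<^sub>R m i)) = s0 + 2 * t * (i \<bullet> e)"
          using elim e(1) by simp
        have 2: "(norm (x1 + t *\<^sub>R i - z))\<^sup>2 = (norm (x1 - z))\<^sup>2 + 2 * t * (i \<bullet> (x1 - z)) + t\<^sup>2"
          using ii norm_line[of "x1 - z" t i] by (simp add: algebra_simps)
        have 3: "(norm (y1 + t *\<^sub>R m i - z))\<^sup>2 = (norm (y1 - z))\<^sup>2 + 2 * t * (m i \<bullet> (y1 - z)) + t\<^sup>2"
          using mm norm_line[of "y1 - z" t "m i"] by (simp add: algebra_simps)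
        show ?case
          unfolding \<Phi>_def 1 2 3 c1_def c2_def s0_def[symmetric] by (simp add: power2_eq_square algebra_simps)
      qed
      then have D\<Phi>: "D2 (\<lambda>t. \<Phi> (x1 + t *\<^sub>R i) (y1 + t *\<^sub>R m i)) c1 (2 * c2)"
        by (rule D2_cong) (rule D2_quadratic)
      note D = D2_diff[OF D2_add[OF L[of i] M[of "m i"]] D\<Phi>]
      have "\<forall>\<^sub>F t in nhds 0. x1 + t *\<^sub>R i \<in> T \<inter> ball z R"
        using f xb by (intro eventually_line eventually_nhds_in_open) auto
      moreover have "\<forall>\<^sub>F t in nhds 0. y1 + t *\<^sub>R m i \<in> T' \<inter> ball z R"
        using g yb by (intro eventually_line eventually_nhds_in_open) auto
      ultimately have "\<forall>\<^sub>F t in nhds 0. f (x1 + 0 *\<^sub>R i) + g (y1 + 0 *\<^sub>R m i) - \<Phi> (x1 + 0 *\<^sub>R i) (y1 + 0 *\<^sub>R m i)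
          \<le> f (x1 + t *\<^sub>R i) + g (y1 + t *\<^sub>R m i) - \<Phi> (x1 + t *\<^sub>R i) (y1 + t *\<^sub>R m i)"
      proof eventually_elim
        case (elim t)
        then have "V (x1 + t *\<^sub>R i) \<le> f (x1 + t *\<^sub>R i)" "W (y1 + t *\<^sub>R m i) \<le> g (y1 + t *\<^sub>R m i)"
          using f(6) g(6) by auto
        moreover have "V x1 + W y1 - \<Phi> x1 y1 \<le> V (x1 + t *\<^sub>R i) + W (y1 + t *\<^sub>R m i) - \<Phi> (x1 + t *\<^sub>R i) (y1 + t *\<^sub>R m i)"
          using elim by (intro min) auto
        ultimately show ?case using f(5) g(5) by simp
      qed
      from D2_min(2)[OF D this] show ?thesis by (simp add: c2_def algebra_simps)
    qed
    have sq: "(\<Sum>i\<in>(Basis::'a set). (i \<bullet> e)\<^sup>2) = 1"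
      using ee euclidean_inner[of e e] by (simp add: inner_commute power2_eq_square)
    have "0 \<le> (\<Sum>i\<in>Basis. H x1 i i + K y1 (m i) (m i) - lam * (8 * B * (i \<bullet> e)\<^sup>2 - 4 * \<beta>))"
      by (intro sum_nonneg key)
    also have "\<dots> = trace_hess (H x1) + trace_hess (K y1) - lam * (8 * B - 4 * n * \<beta>)"
      using trace_hess_reflect[OF e(1), of "K y1"] sq
      by (simp add: sum.distrib sum_subtractf trace_hess_def m_def n_def right_diff_distrib flip: sum_distrib_left)
    also have "\<dots> \<le> - (lam * (4 * B))" using f(4) g(4) by (simp add: B_def algebra_simps)
    also have "\<dots> < 0" using lam pos by simp
    finally show False by simp
  qed
  moreover have "\<Phi> x y \<ge> lam / 2"
  proof -
    define \<rho> where "\<rho> = R / (20 * n)"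
    have d: "norm (x - z) \<le> \<rho>" "norm (y - z) \<le> \<rho>"
      using xy by (auto simp: dist_norm norm_minus_commute \<rho>_def n_def)
    have "norm (x - y) \<le> 2 * \<rho>"
      using norm_triangle_ineq4[of "x - z" "y - z"] d by simp
    then have "A * norm (x - y) \<le> A * (2 * \<rho>)" using pos by (intro mult_left_mono) auto
    also have "\<dots> = 1 / 5" using R n by (simp add: A_def B_def \<beta>_def \<rho>_def power2_eq_square field_simps)
    finally have 1: "A * norm (x - y) \<le> 1 / 5" .
    have "(norm (x - z))\<^sup>2 \<le> \<rho>\<^sup>2" "(norm (y - z))\<^sup>2 \<le> \<rho>\<^sup>2" using d by (auto intro: power_mono)
    then have "\<beta> * ((norm (x - z))\<^sup>2 + (norm (y - z))\<^sup>2) \<le> \<beta> * (2 * \<rho>\<^sup>2)"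
      using pos by (intro mult_left_mono) auto
    also have "\<dots> = 1 / (200 * n\<^sup>2)" using R n by (simp add: \<beta>_def \<rho>_def power2_eq_square field_simps)
    also have "\<dots> \<le> 1 / 200" using n by (simp add: field_simps)
    finally have 2: "\<beta> * ((norm (x - z))\<^sup>2 + (norm (y - z))\<^sup>2) \<le> 1 / 200" .
    have "lam * (1 / 2) \<le> \<Phi> x y"
      unfolding \<Phi>_def
    proof (intro mult_left_mono)
      have "B * (norm (x - y))\<^sup>2 \<ge> 0" using pos by simp
      then show "1 / 2 \<le> 1 - A * norm (x - y) + B * (norm (x - y))\<^sup>2 - \<beta> * ((norm (x - z))\<^sup>2 + (norm (y - z))\<^sup>2)"
        using 1 2 by linarith
    qed (use lam in simp)
    then show ?thesis by simp
  qed
  moreover have "R / (20 * n) \<le> R" using R n by (simp add: field_simps)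
  then have "V x1 + W y1 - \<Phi> x1 y1 \<le> V x + W y - \<Phi> x y"
    using xy by (intro min) (auto simp: n_def)
  ultimately show ?thesis by linarith
qed

subsection \<open>Flat solutions\<close>

text \<open>The situation after rescaling to the unit ball; \<open>e\<close> stands for the last
  coordinate direction and \<open>i0\<close> for the first component. The planes are strictly apart,
  the case of equal planes being settled in the theorem itself.\<close>

locale flat_solution =
  fixes p :: real and u :: "'a::euclidean_space \<Rightarrow> real^'m" and i0 :: 'm and e :: 'a and a b :: real
  assumes p0: "0 < p" and p1: "p < 1"
    and visc: "viscosity_solution p (ball 0 1) u"
    and e: "norm e = 1"
    and upper: "\<And>x. x \<in> ball 0 1 \<Longrightarrow> norm (u x) \<le> u0 p (x \<bullet> e + b)"
    and lower: "\<And>x. x \<in> ball 0 1 \<Longrightarrow> x \<bullet> e \<ge> - a \<Longrightarrow> u0 p (x \<bullet> e + a) \<le> u x $ i0"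
    and ab: "a < b"
begin

lemmas p01 = p0 p1

abbreviation d :: real where "d \<equiv> b - a"

lemma cont: "continuous_on (ball 0 1) u"
  using visc by (rule viscosity_solution_continuous)

lemma open_pos: "open (posset (ball 0 1) u)"
  by (intro open_posset open_ball cont)

lemma ee: "e \<bullet> e = 1"
  using e by (simp add: norm_eq_1)

lemma inner_e_close: "dist z x \<le> r \<Longrightarrow> \<bar>x \<bullet> e - z \<bullet> e\<bar> \<le> r"
  using Cauchy_Schwarz_ineq2[of "x - z" e] e by (simp add: inner_diff_left dist_norm norm_minus_commute)

lemma component_le: "\<bar>u x $ i\<bar> \<le> norm (u x)"
  by (rule component_le_norm_cart)

lemma plane_hessian:
  "\<exists>H. has_hessian_on {x. x \<bullet> e + c > 0} (\<lambda>x. u0 p (x \<bullet> e + c)) H \<and> (\<forall>x. trace_hess (H x) = ddu0 p (x \<bullet> e + c))"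
proof -
  have l: "level e c 0 0 0 = (\<lambda>x. x \<bullet> e + c)" "level_grad e 0 0 0 x = e" "level_lap 0 0 0 x = 0" for x
    by (auto simp: level_def level_grad_def level_lap_def)
  have "continuous_on {x. x \<bullet> e + c > 0} (\<lambda>x. ddu0 p (x \<bullet> e + c))"
    by (rule continuous_on_compose2[OF continuous_on_ddu0[OF p01]]) (auto intro!: continuous_intros)
  then have "\<exists>H. has_hessian_on {x. x \<bullet> e + c > 0} (\<lambda>x. u0 p (level e c 0 0 0 x)) H \<and>
     (\<forall>x. trace_hess (H x) = ddu0 p (level e c 0 0 0 x) * (level_grad e 0 0 0 x \<bullet> level_grad e 0 0 0 x) +
        du0 p (level e c 0 0 0 x) * level_lap 0 0 0 x)"
    by (intro has_hessian_on_level u0_deriv[OF p01] du0_deriv[OF p01]) (auto simp: l)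
  then show ?thesis by (simp add: l ee)
qed

lemma open_halfspace: "open {x. x \<bullet> e + c > 0}"
  by (intro open_Collect_less continuous_intros)

lemma powr_p1_antimono: "0 < s \<Longrightarrow> s \<le> t \<Longrightarrow> t powr (p - 1) \<le> s powr (p - 1)"
  using p1 by (intro powr_mono2') auto

text \<open>The vector character costs nothing here: |u|^(p-2) u^1 is at most |u|^(p-1), and |u|
  lies above u^1 and hence above the plane profile.\<close>

lemma superharmonic_lower:
  assumes x: "x \<in> ball 0 1" "x \<bullet> e + a > 0"
  shows "superharmonic_at (\<lambda>x. u x $ i0 - u0 p (x \<bullet> e + a)) x"
proof -
  let ?T = "posset (ball 0 1) u \<inter> {x. x \<bullet> e + a > 0}"
  have pos: "0 < u0 p (x \<bullet> e + a)" using x by (intro u0_pos[OF p01])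
  have le: "u0 p (x \<bullet> e + a) \<le> u x $ i0" using x by (intro lower) auto
  have le': "u x $ i0 \<le> norm (u x)" using component_le[of x i0] by linarith
  have xT: "x \<in> ?T" using x pos le le' by (auto simp: posset_def)
  obtain H where H: "has_hessian_on (posset (ball 0 1) u) (\<lambda>x. u x \<bullet> axis i0 1) H"
    "\<And>x. x \<in> posset (ball 0 1) u \<Longrightarrow> trace_hess (H x) = norm (u x) powr (p - 2) * (u x \<bullet> axis i0 1)"
    using viscosity_solution_hessian[OF visc] by blast
  obtain K where K: "has_hessian_on {x. x \<bullet> e + a > 0} (\<lambda>x. u0 p (x \<bullet> e + a)) K"
    "\<And>x. trace_hess (K x) = ddu0 p (x \<bullet> e + a)"
    using plane_hessian by blast
  have "trace_hess (H x) \<le> norm (u x) powr (p - 2) * norm (u x)"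
    using xT le' by (simp add: H(2) inner_axis mult_left_mono)
  also have "\<dots> = norm (u x) powr (p - 1)"
    using xT powr_add[of "norm (u x)" "p - 2" 1] by (simp add: posset_def)
  also have "\<dots> \<le> u0 p (x \<bullet> e + a) powr (p - 1)"
    using pos le le' by (intro powr_p1_antimono) auto
  also have "\<dots> = trace_hess (K x)" using x by (simp add: K(2) ddu0_def)
  finally have "trace_hess (H x - K x) \<le> 0" by (simp add: trace_hess_diff)
  moreover have "has_hessian_on ?T (\<lambda>x. u x $ i0 - u0 p (x \<bullet> e + a)) (\<lambda>x. H x - K x)"
    using has_hessian_on_diff[OF has_hessian_on_subset[OF H(1), of ?T] has_hessian_on_subset[OF K(1), of ?T]]
    by (simp add: inner_axis)
  ultimately show ?thesis
    unfolding superharmonic_at_def using xT open_pos open_halfspace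
    by (intro exI[of _ ?T] exI[of _ "\<lambda>x. u x $ i0 - u0 p (x \<bullet> e + a)"] exI[of _ "\<lambda>x. H x - K x"]) auto
qed

text \<open>The norm \<open>|u|\<close> is replaced by its smooth minorant \<open>\<langle>u, f\<rangle>\<close> with \<open>f\<close> the direction of \<open>u\<close> at the point,
  so that no Kato inequality is needed.\<close>

lemma superharmonic_upper:
  assumes x: "x \<in> ball 0 1" "u x \<noteq> 0"
  shows "superharmonic_at (\<lambda>x. u0 p (x \<bullet> e + b) - norm (u x)) x"
proof -
  let ?T = "posset (ball 0 1) u \<inter> {x. x \<bullet> e + b > 0}"
  define f where "f = (1 / norm (u x)) *\<^sub>R u x"
  have f: "norm f = 1" "u x \<bullet> f = norm (u x)"
    using x by (auto simp: f_def power2_norm_eq_inner[symmetric] power2_eq_square)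
  have le: "0 < norm (u x)" "norm (u x) \<le> u0 p (x \<bullet> e + b)" using x upper by auto
  then have "x \<bullet> e + b > 0" using u0_nonpos[OF p01, of "x \<bullet> e + b"] by linarith
  then have xT: "x \<in> ?T" using x by (auto simp: posset_def)
  obtain H where H: "has_hessian_on (posset (ball 0 1) u) (\<lambda>x. u x \<bullet> f) H"
    "\<And>x. x \<in> posset (ball 0 1) u \<Longrightarrow> trace_hess (H x) = norm (u x) powr (p - 2) * (u x \<bullet> f)"
    using viscosity_solution_hessian[OF visc] by blast
  obtain K where K: "has_hessian_on {x. x \<bullet> e + b > 0} (\<lambda>x. u0 p (x \<bullet> e + b)) K"
    "\<And>x. trace_hess (K x) = ddu0 p (x \<bullet> e + b)"
    using plane_hessian by blast
  have "trace_hess (K x) = u0 p (x \<bullet> e + b) powr (p - 1)" using xT by (simp add: K(2) ddu0_def)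
  also have "\<dots> \<le> norm (u x) powr (p - 1)" using le by (intro powr_p1_antimono)
  also have "\<dots> = trace_hess (H x)"
    using xT powr_add[of "norm (u x)" "p - 2" 1] by (simp add: posset_def H(2) f(2))
  finally have "trace_hess (K x - H x) \<le> 0" by (simp add: trace_hess_diff)
  moreover have "has_hessian_on ?T (\<lambda>x. u0 p (x \<bullet> e + b) - u x \<bullet> f) (\<lambda>x. K x - H x)"
    by (intro has_hessian_on_diff has_hessian_on_subset[OF H(1)] has_hessian_on_subset[OF K(1)]) auto
  moreover have "u y \<bullet> f \<le> norm (u y)" for y
    using norm_cauchy_schwarz[of "u y" f] f(1) by simp
  ultimately show ?thesis
    unfolding superharmonic_at_def using xT open_pos open_halfspace f(2)
    by (intro exI[of _ ?T] exI[of _ "\<lambda>x. u0 p (x \<bullet> e + b) - u x \<bullet> f"] exI[of _ "\<lambda>x. K x - H x"]) auto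
qed

text \<open>It holds because u0' is homogeneous of degree kappa - 1 < 1. It compares u0' at all
  heights between t/2 and 2t with one constant for every t, which is needed since \<open>a\<close>
  has no upper bound in \<open>harnack_shift\<close>.\<close>

lemma du0_quadruple: "t > 0 \<Longrightarrow> du0 p (4 * t) \<le> 4 * du0 p t"
proof -
  assume t: "t > 0"
  have "4 powr (kappa p - 1) \<le> (4::real) powr 1"
    using kappa_lt_2[OF p01] by (intro powr_mono) auto
  then have "4 powr (kappa p - 1) * t powr (kappa p - 1) \<le> 4 * t powr (kappa p - 1)"
    by (intro mult_right_mono) auto
  then show ?thesis
    using t kappa_gt_1[OF p01] c_p_pos[OF p01]
    by (simp add: du0_def powr_mult mult_left_mono mult.left_commute[of 4])
qed

text \<open>\<open>doubling\<close> is applied to V and W on the ball of radius 1/20, where heights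
  lie between t/2 and 3t/2; its inner radius is then 1/(400 n). A shift by d/32 changes u0 by at
  most 4 u0'(t/2) d/32, which is \<open>lam / 4\<close>, so a gain of \<open>lam / 4\<close> in
  value yields the shift.\<close>

lemma harnack_shift:
  assumes z: "cball z (1/20) \<subseteq> ball 0 1" "z \<bullet> e + a \<ge> 1/10"
    and d: "d \<le> 1/20" "2 * CARD('m) * d powr (1/4) \<le> u0 p (1/20) * du0 p (1/20)"
    and others: "\<And>x i. x \<in> ball 0 1 \<Longrightarrow> i \<noteq> i0 \<Longrightarrow> \<bar>u x $ i\<bar> \<le> d powr (5/8)"
  shows "(\<forall>x\<in>cball z (1 / (400 * DIM('a))). u0 p (x \<bullet> e + a + d / 32) \<le> u x $ i0) \<or>
    (\<forall>x\<in>cball z (1 / (400 * DIM('a))). norm (u x) \<le> u0 p (x \<bullet> e + b - d / 32))"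
proof -
  define t where "t = z \<bullet> e + a"
  have d0: "d > 0" using ab by simp
  \<comment> \<open>By convexity the two planes differ by at least u0'(t/2) d. Half of this is kept
    as \<open>lam\<close>; the other half absorbs |u| - u^1.\<close>
  define lam where "lam = du0 p (t / 2) * d / 2"
  let ?V = "\<lambda>x. u x $ i0 - u0 p (x \<bullet> e + a)" and ?W = "\<lambda>x. u0 p (x \<bullet> e + b) - norm (u x)"
  have t: "t \<ge> 1/10" using z by (simp add: t_def)
  have du0_pos: "du0 p (t / 2) > 0" using t c_p_pos[OF p01] kappa_gt_1[OF p01] by (simp add: du0_def)
  have lam: "lam > 0" using du0_pos d0 by (simp add: lam_def)
  have s: "t / 2 \<le> x \<bullet> e + a" "x \<bullet> e + a \<le> 3/2 * t" "x \<in> ball 0 1" if "x \<in> cball z (1/20)" for x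
  proof -
    have "\<bar>x \<bullet> e - z \<bullet> e\<bar> \<le> 1/20" using that by (intro inner_e_close) auto
    then have "z \<bullet> e - 1/20 \<le> x \<bullet> e" "x \<bullet> e \<le> z \<bullet> e + 1/20" by (auto simp only: abs_le_iff)
    then show "t / 2 \<le> x \<bullet> e + a" "x \<bullet> e + a \<le> 3/2 * t" using t unfolding t_def by auto
    show "x \<in> ball 0 1" using that z by blast
  qed
  have low: "u0 p (x \<bullet> e + a) \<le> u x $ i0" if "x \<in> cball z (1/20)" for x
    using s[OF that] t by (intro lower) auto
  have gap: "lam \<le> ?V x + ?W x" if x: "x \<in> cball z (1/20)" for x
  proof -
    \<comment> \<open>\<open>U\<close> bounds |u| + u^1 from below, and |u| - u^1 is the quotient of
      |u|^2 - (u^1)^2 by this sum. The numerator is of order d^(5/4), and its extra factor d^(1/4)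
      is made small by the hypothesis on d.\<close>
    define U where "U = u0 p (t / 2)"
    have U: "U > 0" using t by (auto simp: U_def intro!: u0_pos[OF p01])
    have U_le: "U \<le> u x $ i0" using low[OF x] u0_mono[OF p01 s(1)[OF x]] by (simp add: U_def)
    have le_norm: "u x $ i0 \<le> norm (u x)" using component_le[of x i0] by linarith
    have "(norm (u x))\<^sup>2 = (\<Sum>i\<in>UNIV. (u x $ i)\<^sup>2)"
      unfolding power2_norm_eq_inner inner_vec_def by (simp add: power2_eq_square)
    also have "\<dots> = (u x $ i0)\<^sup>2 + (\<Sum>i\<in>UNIV - {i0}. (u x $ i)\<^sup>2)"
      by (simp add: sum.remove)
    also have "(\<Sum>i\<in>UNIV - {i0}. (u x $ i)\<^sup>2) \<le> (\<Sum>i\<in>UNIV - {i0}. d powr (5/4))"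
    proof (intro sum_mono)
      fix i assume "i \<in> UNIV - {i0}"
      then have "\<bar>u x $ i\<bar> \<le> d powr (5/8)" using others s(3)[OF x] by auto
      then have "\<bar>u x $ i\<bar>\<^sup>2 \<le> (d powr (5/8))\<^sup>2" by (intro power_mono) auto
      also have "\<dots> = d powr (5/4)" by (simp add: power2_eq_square powr_add[symmetric])
      finally show "(u x $ i)\<^sup>2 \<le> d powr (5/4)" by simp
    qed
    also have "\<dots> \<le> CARD('m) * d powr (5/4)"
      by (simp add: mult_right_mono)
    finally have "(norm (u x))\<^sup>2 - (u x $ i0)\<^sup>2 \<le> CARD('m) * d powr (5/4)" by simp
    moreover have "U * (norm (u x) - u x $ i0) \<le> (norm (u x) + u x $ i0) * (norm (u x) - u x $ i0)"
      using U U_le le_norm by (intro mult_right_mono) auto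
    moreover have "(norm (u x) + u x $ i0) * (norm (u x) - u x $ i0) = (norm (u x))\<^sup>2 - (u x $ i0)\<^sup>2"
      by (simp add: power2_eq_square algebra_simps)
    moreover have "CARD('m) * d powr (5/4) \<le> U * lam"
    proof -
      have "u0 p (1/20) * du0 p (1/20) \<le> U * du0 p (t / 2)"
        unfolding U_def using t u0_nonneg[OF p01] du0_nonneg[OF p01]
        by (intro mult_mono u0_mono[OF p01] du0_mono[OF p01]) auto
      then have "(2 * CARD('m) * d powr (1/4)) * (d / 2) \<le> (U * du0 p (t / 2)) * (d / 2)"
        using d d0 by (intro mult_right_mono) auto
      moreover have "d powr (5/4) = d powr (1/4) * d"
        using powr_add[of d "1/4" 1] d0 by simp
      then have "CARD('m) * d powr (5/4) = (2 * CARD('m) * d powr (1/4)) * (d / 2)" by simp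
      moreover have "U * lam = (U * du0 p (t / 2)) * (d / 2)" by (simp add: lam_def)
      ultimately show ?thesis by linarith
    qed
    ultimately have "U * (norm (u x) - u x $ i0) \<le> U * lam" by linarith
    then have 1: "norm (u x) - u x $ i0 \<le> lam" using U by simp
    have "du0 p (t / 2) * d \<le> du0 p (x \<bullet> e + a) * d"
      using d0 s[OF x] by (intro mult_right_mono du0_mono[OF p01]) auto
    moreover have "u0 p (x \<bullet> e + a) + du0 p (x \<bullet> e + a) * d \<le> u0 p (x \<bullet> e + b)"
      using u0_increment(1)[OF p01, of d "x \<bullet> e + a"] d0 by simp
    ultimately have "2 * lam \<le> u0 p (x \<bullet> e + b) - u0 p (x \<bullet> e + a)"
      unfolding lam_def by linarith
    with 1 show ?thesis by simp
  qed
  have Vpos: "?V x \<ge> 0" if "x \<in> cball z (1/20)" for x using low[OF that] by simp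
  have Wpos: "?W x \<ge> 0" if "x \<in> cball z (1/20)" for x using upper s(3)[OF that] by simp
  have cu: "continuous_on (cball z (1/20)) u" using cont z(1) by (rule continuous_on_subset)
  have cV: "continuous_on (cball z (1/20)) ?V" and cW: "continuous_on (cball z (1/20)) ?W"
    by (intro continuous_intros continuous_on_u0[OF p01] cu)+
  have nz: "u x \<noteq> 0" if x: "x \<in> cball z (1/20)" for x
  proof -
    have "0 < x \<bullet> e + a" using s(1)[OF x] t by simp
    then have "0 < u x $ i0" using low[OF x] u0_pos[OF p01] by fastforce
    then show ?thesis by auto
  qed
  have rho: "1/20 / (20 * DIM('a)) = 1 / (400 * DIM('a))" by simp
  have "real DIM('a) \<ge> 1" using DIM_positive[where 'a='a] by linarith
  then have "20 \<le> 400 * real DIM('a)" by linarith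
  then have "1 / (400 * real DIM('a)) \<le> 1 / 20" by (intro frac_le) simp_all
  then have rho_le: "cball z (1 / (400 * DIM('a))) \<subseteq> cball z (1/20)"
    by (intro subset_cball) simp
  have sum: "?V x + ?W y \<ge> lam / 2" if "x \<in> cball z (1 / (400 * DIM('a)))" "y \<in> cball z (1 / (400 * DIM('a)))" for x y
  proof (rule doubling[OF _ lam cV cW Vpos Wpos _ _ gap])
    show "superharmonic_at ?V x" if "x \<in> ball z (1/20)" for x
      using s[of x] that t by (intro superharmonic_lower) auto
    show "superharmonic_at ?W x" if "x \<in> ball z (1/20)" for x
      using s[of x] that nz by (intro superharmonic_upper) auto
  qed (use that rho in auto)
  have quad: "du0 p s \<le> 4 * du0 p (t / 2)" if "s \<le> 2 * t" for s
    using du0_quadruple[of "t / 2"] du0_mono[OF p01 that] t by simp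
  show ?thesis
  \<comment> \<open>In \<open>sum\<close> the points x and y are independent. If V is below
    \<open>lam / 4\<close> at a single point, W exceeds \<open>lam / 4\<close> on the whole
    ball.\<close>
  proof (cases "\<forall>x\<in>cball z (1 / (400 * DIM('a))). lam / 4 \<le> ?V x")
    case True
    have "u0 p (x \<bullet> e + a + d / 32) \<le> u x $ i0" if x: "x \<in> cball z (1 / (400 * DIM('a)))" for x
    proof -
      have x': "x \<in> cball z (1/20)" using x rho_le by blast
      have "u0 p (x \<bullet> e + a + d / 32) \<le> u0 p (x \<bullet> e + a) + du0 p (x \<bullet> e + a + d / 32) * (d / 32)"
        using d0 by (intro u0_increment[OF p01]) auto
      also have "du0 p (x \<bullet> e + a + d / 32) * (d / 32) \<le> (4 * du0 p (t / 2)) * (d / 32)"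
      proof (intro mult_right_mono quad)
        show "x \<bullet> e + a + d / 32 \<le> 2 * t" using d0 d(1) t s(2)[OF x'] by argo
        show "0 \<le> d / 32" using d0 by simp
      qed
      also have "\<dots> = lam / 4" by (simp add: lam_def)
      finally show ?thesis using True x by force
    qed
    then show ?thesis by blast
  next
    case False
    then obtain x0 where x0: "x0 \<in> cball z (1 / (400 * DIM('a)))" "?V x0 < lam / 4" by force
    have "norm (u x) \<le> u0 p (x \<bullet> e + b - d / 32)" if x: "x \<in> cball z (1 / (400 * DIM('a)))" for x
    proof -
      have x': "x \<in> cball z (1/20)" using x rho_le by blast
      have "u0 p (x \<bullet> e + b) \<le> u0 p (x \<bullet> e + b - d / 32) + du0 p (x \<bullet> e + b) * (d / 32)"
        using d0 u0_increment(2)[OF p01, of "d / 32" "x \<bullet> e + b - d / 32"] by simp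
      also have "du0 p (x \<bullet> e + b) * (d / 32) \<le> (4 * du0 p (t / 2)) * (d / 32)"
      proof (intro mult_right_mono quad)
        show "x \<bullet> e + b \<le> 2 * t" using d0 d(1) t s(2)[OF x'] by argo
        show "0 \<le> d / 32" using d0 by simp
      qed
      also have "\<dots> = lam / 4" by (simp add: lam_def)
      finally show ?thesis using sum[OF x0(1) x] x0(2) by simp
    qed
    then show ?thesis by blast
  qed
qed

end

subsection \<open>The barrier from above\<close>

lemma D2_level:
  assumes "i \<bullet> i = 1"
  shows "D2 (\<lambda>t. level e c h k z (x + t *\<^sub>R i)) (level_grad e h k z x \<bullet> i)
    (h * gauss k z x * (4 * k\<^sup>2 * ((x - z) \<bullet> i)\<^sup>2 - 2 * k))"
proof -
  let ?w = "\<lambda>t. exp (- k * ((x - z) \<bullet> (x - z) + 2 * t * ((x - z) \<bullet> i) + t\<^sup>2))"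
  have eq: "level e c h k z (x + t *\<^sub>R i) = x \<bullet> e + t * (i \<bullet> e) + c + h * ?w t" for t
  proof -
    have "(x + t *\<^sub>R i - z) \<bullet> (x + t *\<^sub>R i - z) = (x - z) \<bullet> (x - z) + 2 * t * ((x - z) \<bullet> i) + t\<^sup>2"
      using norm_line[of "x - z" t i] assms
      by (simp add: power2_norm_eq_inner algebra_simps inner_commute)
    then show ?thesis by (simp add: level_def gauss_def inner_add_left)
  qed
  show ?thesis
    unfolding D2_def eq
  proof (intro exI[of _ "\<lambda>t. i \<bullet> e + h * (?w t * (- k * (2 * ((x - z) \<bullet> i) + 2 * t)))"] conjI always_eventually allI)
    fix t
    show "((\<lambda>t. x \<bullet> e + t * (i \<bullet> e) + c + h * ?w t) has_real_derivative
      i \<bullet> e + h * (?w t * (- k * (2 * ((x - z) \<bullet> i) + 2 * t)))) (at t)"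
      by (rule derivative_eq_intros refl)+ simp
  next
    show "i \<bullet> e + h * (?w 0 * (- k * (2 * ((x - z) \<bullet> i) + 2 * 0))) = level_grad e h k z x \<bullet> i"
      by (simp add: level_grad_def gauss_def inner_diff_left inner_commute[of i e] algebra_simps)
    show "((\<lambda>t. i \<bullet> e + h * (?w t * (- k * (2 * ((x - z) \<bullet> i) + 2 * t)))) has_real_derivative
       h * gauss k z x * (4 * k\<^sup>2 * ((x - z) \<bullet> i)\<^sup>2 - 2 * k)) (at 0)"
      by (rule derivative_eq_intros refl)+ (simp add: gauss_def power2_eq_square algebra_simps)
  qed
qed

lemma sum_level_lap:
  "(\<Sum>i\<in>(Basis::'a::euclidean_space set). h * gauss k z x * (4 * k\<^sup>2 * ((x - z) \<bullet> i)\<^sup>2 - 2 * k)) = level_lap h k z x"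
proof -
  have "(\<Sum>i\<in>(Basis::'a set). ((x - z) \<bullet> i)\<^sup>2) = (norm (x - z))\<^sup>2"
    unfolding power2_norm_eq_inner euclidean_inner[of "x - z" "x - z"] by (simp add: power2_eq_square)
  then show ?thesis
    by (simp add: level_lap_def sum_subtractf flip: sum_distrib_left)
qed

text \<open>\<open>warp \<mu> \<delta>\<close> is a perturbation of the identity tending to \<open>-\<infinity>\<close> at \<open>0\<close>. With \<open>q\<close> the \<open>1/\<kappa>\<close>-th power of
  a solution, the level sets of \<open>warp \<mu> \<delta> q\<close> are those of a positive supersolution, so that contact can
  only take place where the solution does not vanish.\<close>

definition warp :: "real \<Rightarrow> real \<Rightarrow> real \<Rightarrow> real" where
  "warp \<mu> \<delta> q = q + \<delta> powr \<mu> * q powr (1 - \<mu>) / (\<mu> * (1 - \<mu>)) + \<delta> * ln q"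

definition dwarp :: "real \<Rightarrow> real \<Rightarrow> real \<Rightarrow> real" where
  "dwarp \<mu> \<delta> q = 1 + (\<delta> / q) powr \<mu> / \<mu> + \<delta> / q"

lemma warp_deriv:
  assumes "0 < \<mu>" "\<mu> < 1" "0 < \<delta>" "0 < q"
  shows "(warp \<mu> \<delta> has_real_derivative dwarp \<mu> \<delta> q) (at q)"
proof -
  have "(\<delta> / q) powr \<mu> = \<delta> powr \<mu> * q powr (- \<mu>)"
    using assms by (simp add: powr_divide powr_minus_divide)
  moreover have "(warp \<mu> \<delta> has_real_derivative
      1 + \<delta> powr \<mu> * ((1 - \<mu>) * q powr (1 - \<mu> - 1)) / (\<mu> * (1 - \<mu>)) + \<delta> * (1 / q)) (at q)"
    unfolding warp_def[abs_def] using assms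
    by (intro DERIV_add DERIV_cmult DERIV_cdivide DERIV_ident has_real_derivative_powr)
       (auto intro!: derivative_eq_intros)
  ultimately show ?thesis
    using assms by (simp add: dwarp_def)
qed

lemma dwarp_deriv:
  assumes "0 < \<mu>" "\<mu> < 1" "0 < \<delta>" "0 < q"
  shows "(dwarp \<mu> \<delta> has_real_derivative - ((\<delta> / q) powr \<mu> + \<delta> / q) / q) (at q)"
proof -
  have "((\<lambda>q. \<delta> / q) has_real_derivative - (\<delta> / q) / q) (at q)"
    using assms by (auto intro!: derivative_eq_intros)
  moreover have "(\<delta> / q) powr (\<mu> - 1) = (\<delta> / q) powr \<mu> / (\<delta> / q)"
    using assms by (simp add: powr_diff)
  ultimately show ?thesis
    unfolding dwarp_def[abs_def] using assms
    by (auto intro!: derivative_eq_intros simp: field_simps)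
qed

lemma dwarp_ge_1: "0 < \<mu> \<Longrightarrow> 0 < \<delta> \<Longrightarrow> 0 < q \<Longrightarrow> dwarp \<mu> \<delta> q \<ge> 1"
  by (simp add: dwarp_def)

lemma warp_mono:
  assumes "0 < \<mu>" "\<mu> < 1" "0 < \<delta>" "0 < q" "q \<le> q'"
  shows "warp \<mu> \<delta> q \<le> warp \<mu> \<delta> q'"
  using assms unfolding warp_def
  by (intro add_mono mult_left_mono divide_right_mono powr_mono2) auto

text \<open>This is exactly the supersolution inequality U'' <= U^(p-1) for the profile U obtained
  by composing u0 with the inverse of \<open>warp \<mu> \<delta>\<close>, when \<mu> = kappa - 1.
  The logarithm drives \<open>warp\<close> to minus infinity, but alone it would violate the
  inequality for small \<delta> / q when \<mu> < 1/2; the power term supplies what is missing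
  there.\<close>

lemma dwarp_ineq:
  assumes \<mu>: "0 < \<mu>" "\<mu> < 1" and "0 < \<delta>" "0 < q"
  shows "(\<delta> / q) powr \<mu> + \<delta> / q \<le> \<mu> * ((dwarp \<mu> \<delta> q) ^ 3 - dwarp \<mu> \<delta> q)"
proof -
  define t where "t = \<delta> / q"
  define y where "y = t powr \<mu>"
  define D where "D = dwarp \<mu> \<delta> q"
  have t: "t > 0" using assms by (simp add: t_def)
  then have y: "y > 0" by (simp add: y_def)
  have D: "D = 1 + y / \<mu> + t" by (simp add: D_def dwarp_def y_def t_def)
  have D1: "D \<ge> 1" using y t \<mu> by (simp add: D)
  have "\<mu> * (D ^ 3 - D) = (\<mu> * (D - 1)) * (D * (D + 1))"
    by (simp add: power3_eq_cube algebra_simps)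
  also have "\<mu> * (D - 1) = y + \<mu> * t" using \<mu> by (simp add: D field_simps)
  finally have eq: "\<mu> * (D ^ 3 - D) = (y + \<mu> * t) * (D * (D + 1))" .
  have DD: "D * (D + 1) \<ge> 2" using mult_mono[of 1 D 2 "D + 1"] D1 by simp
  have "y + t \<le> (y + \<mu> * t) * (D * (D + 1))"
  \<comment> \<open>For t at most 1 the power y dominates t, and the factor
    \<open>D * (D + 1)\<close>, at least 2, suffices. For larger t the growth of \<open>D\<close>
    gives \<open>1 \<le> \<mu> * D\<close>, which pays for t separately.\<close>
  proof (cases "t \<le> 1")
    case True
    then have "t \<le> y" using powr_mono'[of \<mu> 1 t] t \<mu> by (simp add: y_def)
    then have "y + t \<le> y * 2" by simp
    also have "\<dots> \<le> (y + \<mu> * t) * (D * (D + 1))"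
      using DD y t \<mu> by (intro mult_mono) auto
    finally show ?thesis .
  next
    case False
    then have "y \<ge> 1" using ge_one_powr_ge_zero[of t \<mu>] \<mu> by (simp add: y_def)
    moreover have "\<mu> * D = \<mu> + y + \<mu> * t" using \<mu> by (simp add: D field_simps)
    ultimately have "1 \<le> \<mu> * D" using \<mu> t mult_pos_pos[of \<mu> t] by linarith
    then have "1 * 1 \<le> (\<mu> * D) * (D + 1)" using D1 by (intro mult_mono) auto
    then have "t * 1 \<le> t * (\<mu> * D * (D + 1))" using t by (intro mult_left_mono) auto
    moreover have "y * 1 \<le> y * (D * (D + 1))" using DD y by (intro mult_left_mono) auto
    ultimately show ?thesis by (simp add: algebra_simps)
  qed
  then show ?thesis using eq by (simp add: D_def y_def t_def)
qed

lemma warp_at_bot: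
  assumes "0 < \<mu>" "\<mu> < 1" "0 < \<delta>"
  shows "\<exists>q0>0. \<forall>q. 0 < q \<and> q < q0 \<longrightarrow> warp \<mu> \<delta> q < B"
proof -
  have "((\<lambda>q. q + \<delta> powr \<mu> * q powr (1 - \<mu>) / (\<mu> * (1 - \<mu>))) \<longlongrightarrow> 0 + \<delta> powr \<mu> * 0 powr (1 - \<mu>) / (\<mu> * (1 - \<mu>))) (at_right 0)"
    using assms by (intro tendsto_intros tendsto_powr') (auto simp: eventually_at_right_less intro: eventually_mono[OF eventually_at_right_less])
  moreover have "filterlim (\<lambda>q. \<delta> * ln q) at_bot (at_right 0)"
    using assms(3) by (intro filterlim_tendsto_pos_mult_at_bot[OF tendsto_const] ln_at_0)
  ultimately have "filterlim (warp \<mu> \<delta>) at_bot (at_right 0)"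
    unfolding warp_def[abs_def] by (simp add: filterlim_tendsto_add_at_bot_iff)
  then have "\<forall>\<^sub>F q in at_right 0. warp \<mu> \<delta> q < B"
    by (simp add: filterlim_at_bot_dense)
  then show ?thesis unfolding eventually_at_right_field by blast
qed

context flat_solution
begin

abbreviation mu :: real where "mu \<equiv> kappa p - 1"

text \<open>The height at which u0 takes the value |u|. Comparison of |u| with u0 at a plane becomes
  a linear inequality, see \<open>q_le_iff\<close>.\<close>

definition q :: "'a \<Rightarrow> real" where "q x = (norm (u x) / c_p p) powr (1 / kappa p)"

lemma mu: "0 < mu" "mu < 1"
  using kappa_gt_1[OF p01] kappa_lt_2[OF p01] by auto

lemma u0_root: "v > 0 \<Longrightarrow> u0 p ((v / c_p p) powr (1 / kappa p)) = v"
  using c_p_pos[OF p01] mu by (simp add: u0_def powr_powr)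

lemma u0_strict_mono: "0 < t \<Longrightarrow> s < t \<Longrightarrow> u0 p s < u0 p t"
proof -
  assume st: "0 < t" "s < t"
  then have "max s 0 powr kappa p < max t 0 powr kappa p"
    using mu by (intro powr_less_mono2) auto
  then show ?thesis using c_p_pos[OF p01] by (simp add: u0_def)
qed

lemma le_u0_iff:
  assumes "v > 0"
  shows "v \<le> u0 p t \<longleftrightarrow> (v / c_p p) powr (1 / kappa p) \<le> t"
proof
  have pos: "0 < (v / c_p p) powr (1 / kappa p)" using assms c_p_pos[OF p01] by simp
  show "v \<le> u0 p t \<Longrightarrow> (v / c_p p) powr (1 / kappa p) \<le> t"
    using u0_strict_mono[OF pos, of t] u0_root[OF assms] by linarith
  show "(v / c_p p) powr (1 / kappa p) \<le> t \<Longrightarrow> v \<le> u0 p t"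
    using u0_mono[OF p01] u0_root[OF assms] by metis
qed

lemma q_pos: "u x \<noteq> 0 \<Longrightarrow> q x > 0"
  using c_p_pos[OF p01] by (simp add: q_def)

text \<open>In the scalar case the height solves q Lap q = (kappa - 1)(1 - |grad q|^2), an equation
  without the singular power. At the contact point |u| is replaced by its smooth minorant in the
  direction of \<open>u y\<close>; since \<open>warp\<close> is increasing, the minimum persists.
  First derivatives identify the gradient of the level function with \<open>D\<close> times that of
  the height, second derivatives are summed, and \<open>dwarp_ineq\<close> eliminates the second
  derivative of \<open>warp\<close>.\<close>

lemma upper_touch:
  assumes y: "y \<in> ball 0 1" "u y \<noteq> 0" and \<delta>: "\<delta> > 0"
    and touch: "\<forall>\<^sub>F x in nhds y. u x \<noteq> 0 \<longrightarrow> level e c h k z y - warp mu \<delta> (q y) \<le> level e c h k z x - warp mu \<delta> (q x)"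
  shows "mu * dwarp mu \<delta> (q y) / q y * (1 - level_grad e h k z y \<bullet> level_grad e h k z y) \<le> level_lap h k z y"
proof -
  define v where "v = norm (u y)"
  define f where "f = (1 / v) *\<^sub>R u y"
  have v: "v > 0" using y by (simp add: v_def)
  have f: "norm f = 1" "u y \<bullet> f = v"
    using y by (auto simp: f_def v_def power2_norm_eq_inner[symmetric] power2_eq_square)
  have fle: "u x \<bullet> f \<le> norm (u x)" for x
    using norm_cauchy_schwarz[of "u x" f] f(1) by simp
  have yP: "y \<in> posset (ball 0 1) u" using y by (simp add: posset_def)
  obtain H where H: "has_hessian_on (posset (ball 0 1) u) (\<lambda>x. u x \<bullet> f) H"
    "\<And>x. x \<in> posset (ball 0 1) u \<Longrightarrow> trace_hess (H x) = norm (u x) powr (p - 2) * (u x \<bullet> f)"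
    using viscosity_solution_hessian[OF visc] by blast
  obtain L where L: "\<And>i. D2 (\<lambda>t. u (y + t *\<^sub>R i) \<bullet> f) (blinfun_apply L i) (H y i i)"
    using has_hessian_on_D2[OF H(1) open_pos yP] by blast
  let ?r = "\<lambda>v. (v / c_p p) powr (1 / kappa p)"
  define Q where "Q = q y"
  have Q: "Q > 0" "Q = ?r v" using q_pos[OF y(2)] by (auto simp: Q_def q_def v_def)
  define D where "D = dwarp mu \<delta> Q"
  define D' where "D' = - ((\<delta> / Q) powr mu + \<delta> / Q) / Q"
  have D1: "D \<ge> 1" using dwarp_ge_1[OF mu(1) \<delta> Q(1)] by (simp add: D_def)
  \<comment> \<open>\<open>r1\<close> and \<open>r2\<close> are the first and second derivatives at
    v of the root \<open>?r\<close>.\<close>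
  define r1 where "r1 = Q / (kappa p * v)"
  define r2 where "r2 = (1 / kappa p) * (1 / kappa p - 1) * Q / v\<^sup>2"
  have \<kappa>: "kappa p > 1" using mu by simp
  have dr: "(?r has_real_derivative ?r s / (kappa p * s)) (at s)" if "s > 0" for s
  proof -
    have "(s / c_p p) powr (1 / kappa p - 1) = ?r s / (s / c_p p)"
      using that c_p_pos[OF p01] by (simp add: powr_diff)
    then show ?thesis
      using that c_p_pos[OF p01] \<kappa> by (auto intro!: derivative_eq_intros simp: field_simps)
  qed
  have ddr: "((\<lambda>s. ?r s / (kappa p * s)) has_real_derivative r2) (at v)"
  proof -
    have "((\<lambda>s. ?r s / (kappa p * s)) has_real_derivative
        (?r v / (kappa p * v) * (kappa p * v) - ?r v * (kappa p * 1)) / ((kappa p * v) * (kappa p * v))) (at v)"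
      using v \<kappa> by (intro DERIV_divide dr DERIV_cmult DERIV_ident) auto
    moreover have "(Q / (kappa p * v) * (kappa p * v) - Q * (kappa p * 1)) / ((kappa p * v) * (kappa p * v)) = r2"
      using v \<kappa> by (simp add: r2_def field_simps power2_eq_square)
    ultimately show ?thesis using Q(2) by simp
  qed
  have ev_pos: "\<forall>\<^sub>F s in nhds s0. s > 0" if "s0 > 0" for s0 :: real
    using eventually_nhds_in_open[of "{0<..}" s0] that by simp
  define q1 where "q1 i = r1 * L i" for i
  define q2 where "q2 i = r2 * (L i)\<^sup>2 + r1 * H y i i" for i
  have D2q: "D2 (\<lambda>t. ?r (u (y + t *\<^sub>R i) \<bullet> f)) (q1 i) (q2 i)" for i
    using D2_compose[OF L[of i], of ?r "\<lambda>s. ?r s / (kappa p * s)" r2] v f(2) ddr Q(2)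
      eventually_mono[OF ev_pos[OF v], of "\<lambda>s. (?r has_real_derivative ?r s / (kappa p * s)) (at s)"] dr
    by (simp add: q1_def q2_def r1_def)
  have D2s: "D2 (\<lambda>t. warp mu \<delta> (?r (u (y + t *\<^sub>R i) \<bullet> f))) (D * q1 i) (D' * (q1 i)\<^sup>2 + D * q2 i)" for i
    using D2_compose[OF D2q[of i], of "warp mu \<delta>" "dwarp mu \<delta>" D'] f(2) Q
      eventually_mono[OF ev_pos[OF Q(1)], of "\<lambda>s. (warp mu \<delta> has_real_derivative dwarp mu \<delta> s) (at s)"]
      warp_deriv[OF mu \<delta>] dwarp_deriv[OF mu \<delta>, of Q]
    by (simp add: D_def D'_def)
  let ?g = "level_grad e h k z y"
  let ?l = "\<lambda>i. h * gauss k z y * (4 * k\<^sup>2 * ((y - z) \<bullet> i)\<^sup>2 - 2 * k)"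
  have *: "?g \<bullet> i = D * q1 i \<and> D' * (q1 i)\<^sup>2 + D * q2 i \<le> ?l i" if i: "i \<in> Basis" for i
  proof -
    have ii: "i \<bullet> i = 1" using i by (simp add: inner_same_Basis)
    note dd = D2_diff[OF D2_level[OF ii, of e c h k z y] D2s[of i]]
    have cF: "isCont (\<lambda>x. u x \<bullet> f) y"
      using cont y by (auto intro!: continuous_intros simp: continuous_on_eq_continuous_at)
    have "\<forall>\<^sub>F x in nhds y. u x \<bullet> f > 0"
    proof -
      have "((\<lambda>x. u x \<bullet> f) \<longlongrightarrow> u y \<bullet> f) (nhds y)"
        using cF unfolding isCont_def by (rule iffD1[OF tendsto_at_iff_tendsto_nhds[where g = "\<lambda>x. u x \<bullet> f"]])
      then show ?thesis using v f(2) by (intro order_tendstoD) auto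
    qed
    with touch have "\<forall>\<^sub>F x in nhds y. level e c h k z y - warp mu \<delta> (?r (u y \<bullet> f))
        \<le> level e c h k z x - warp mu \<delta> (?r (u x \<bullet> f))"
    proof eventually_elim
      case (elim x)
      have "u x \<noteq> 0" using elim by auto
      moreover have "warp mu \<delta> (?r (u x \<bullet> f)) \<le> warp mu \<delta> (q x)"
        unfolding q_def using elim fle[of x] c_p_pos[OF p01] \<kappa>
        by (intro warp_mono mu \<delta> powr_mono2 divide_right_mono) auto
      moreover have "q y = ?r (u y \<bullet> f)" using f(2) by (simp add: q_def v_def)
      ultimately show ?case using elim by simp
    qed
    then have "\<forall>\<^sub>F t in nhds 0. level e c h k z (y + 0 *\<^sub>R i) - warp mu \<delta> (?r (u (y + 0 *\<^sub>R i) \<bullet> f))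
        \<le> level e c h k z (y + t *\<^sub>R i) - warp mu \<delta> (?r (u (y + t *\<^sub>R i) \<bullet> f))"
      by (subst scaleR_zero_left, subst scaleR_zero_left, subst add_0_right, subst add_0_right) (rule eventually_line)
    from D2_min[OF dd this] show ?thesis by simp
  qed
  define g2 where "g2 = ?g \<bullet> ?g"
  define L2 where "L2 = (\<Sum>i\<in>Basis. (L i)\<^sup>2)"
  have "g2 = (\<Sum>i\<in>Basis. (?g \<bullet> i)\<^sup>2)"
    unfolding g2_def euclidean_inner[of ?g ?g] by (simp add: power2_eq_square)
  also have "\<dots> = (\<Sum>i\<in>Basis. D\<^sup>2 * r1\<^sup>2 * (L i)\<^sup>2)"
    using * by (intro sum.cong) (auto simp: q1_def power_mult_distrib)
  finally have g2: "g2 = D\<^sup>2 * r1\<^sup>2 * L2" by (simp add: L2_def sum_distrib_left)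
  have "(\<Sum>i\<in>Basis. D' * (q1 i)\<^sup>2 + D * q2 i) \<le> (\<Sum>i\<in>Basis. ?l i)"
    using * by (intro sum_mono) auto
  also have "\<dots> = level_lap h k z y" by (rule sum_level_lap)
  also have "(\<Sum>i\<in>Basis. D' * (q1 i)\<^sup>2 + D * q2 i) = D' * (r1\<^sup>2 * L2) + D * (r2 * L2 + r1 * trace_hess (H y))"
    by (simp add: q1_def q2_def L2_def trace_hess_def sum.distrib sum_distrib_left power_mult_distrib algebra_simps)
  finally have main: "D' * (r1\<^sup>2 * L2) + D * (r2 * L2 + r1 * trace_hess (H y)) \<le> level_lap h k z y" .
  have r1: "r1 * trace_hess (H y) = mu / Q"
  proof -
    have "trace_hess (H y) = v powr (p - 2) * v" using H(2)[OF yP] f(2) by (simp add: v_def)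
    also have "v powr (p - 2) = kappa p * mu / Q\<^sup>2"
      using u0_powr'[OF p01 Q(1)] u0_root[OF v] Q(2) by simp
    finally show ?thesis using v \<kappa> Q(1) by (simp add: r1_def power2_eq_square field_simps)
  qed
  have r2: "r2 * L2 = - (mu / Q) * (r1\<^sup>2 * L2)"
    using v \<kappa> Q(1) by (simp add: r1_def r2_def power2_eq_square field_simps)
  \<comment> \<open>\<open>X\<close> is the squared gradient of the height at y, computed from the
    smooth minorant; the bracket multiplied by \<open>D\<close> in fact \<open>1\<close> is its
    Laplacian.\<close>
  define X where "X = r1\<^sup>2 * L2"
  have X: "X \<ge> 0" "g2 = D\<^sup>2 * X" using g2 by (auto simp: X_def L2_def sum_nonneg)
  have 1: "D' * X + D * (- (mu / Q) * X + mu / Q) \<le> level_lap h k z y"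
    using main unfolding r1 r2 X_def .
  have "D' = - (((\<delta> / Q) powr mu + \<delta> / Q) / Q)" unfolding D'_def by (rule minus_divide_left[symmetric])
  then have "- (mu * (D ^ 3 - D) / Q) \<le> D'"
    using divide_right_mono[OF dwarp_ineq[OF mu \<delta> Q(1)], of Q] Q(1) unfolding D_def by linarith
  then have "- (mu / Q) * (D ^ 3 - D) \<le> D'" by simp
  then have 2: "- (mu / Q) * (D ^ 3 - D) * X \<le> D' * X" using X(1) by (intro mult_right_mono)
  have "mu * D / Q * (1 - g2) = - (mu / Q) * (D ^ 3 - D) * X + D * (- (mu / Q) * X + mu / Q)"
    unfolding X(2) using Q(1) by (simp add: power3_eq_cube power2_eq_square field_simps)
  also have "\<dots> \<le> D' * X + D * (- (mu / Q) * X + mu / Q)" using 2 by (rule add_right_mono)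
  also have "\<dots> \<le> level_lap h k z y" by (rule 1)
  finally show ?thesis unfolding g2_def D_def Q_def .
qed

lemma q_le_iff: "u x \<noteq> 0 \<Longrightarrow> norm (u x) \<le> u0 p t \<longleftrightarrow> q x \<le> t"
  unfolding q_def by (rule le_u0_iff) simp

text \<open>A violation at \<open>y0\<close> forces an interior minimum of level minus warped height
  on the annulus. On the inner sphere the gain d/32 exceeds h + \<gamma>. On the outer sphere only
  the old bound is available, and the subtracted mean of Gaussian values compensates for it. The
  interior minimum then contradicts \<open>upper_touch\<close>.\<close>

lemma upper_barrier:
  fixes z :: 'a and k :: real
  defines "z \<equiv> (1/5) *\<^sub>R e"
  assumes \<rho>: "0 < \<rho>" and k: "k * \<rho>\<^sup>2 \<ge> DIM('a) + 160"
    and d: "d \<le> 1/20" "k * d \<le> 1"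
    and b: "0 \<le> b" and a: "a \<le> 1/4"
    and inner: "\<And>x. x \<in> cball z \<rho> \<Longrightarrow> norm (u x) \<le> u0 p (x \<bullet> e + b - d / 32)"
    and y0: "\<rho> \<le> dist z y0" "dist z y0 \<le> 3/4" "u y0 \<noteq> 0"
  shows "q y0 \<le> y0 \<bullet> e + b - d / 64 * (gauss k z y0 - (exp (- 9/16 * k) + exp (- k / 4)) / 2)"
proof (rule ccontr)
  \<comment> \<open>\<open>h\<close> is half of the inner gain d/32. \<open>w1\<close> and
    \<open>w2\<close> are the Gaussian at distances 3/4 and 1/2 from z, \<open>w3\<close> their
    mean. The error \<gamma> allowed for the perturbed profile is chosen so that
    \<open>- h * w1 - \<gamma> = T\<close> on the outer sphere.\<close>
  define h where "h = d / 64"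
  define w1 where "w1 = exp (- 9/16 * k)"
  define w2 where "w2 = exp (- k / 4)"
  define w3 where "w3 = (w1 + w2) / 2"
  define \<gamma> where "\<gamma> = h * (w2 - w1) / 2"
  define T where "T = - h * w3"
  have d0: "d > 0" and h: "h > 0" "h \<le> 1/1280" using ab d by (auto simp: h_def)
  have "k * \<rho>\<^sup>2 > 0" using k by linarith
  then have k0: "k > 0" using \<rho> by (simp add: zero_less_mult_iff)
  have w: "0 < w1" "w1 < w2" "w2 \<le> 1" "w3 > 0" using k0 by (auto simp: w1_def w2_def w3_def add_pos_pos)
  have \<gamma>: "0 < \<gamma>" "\<gamma> \<le> h / 2"
    using w h mult_left_mono[of "w2 - w1" 1 h] by (auto simp: \<gamma>_def)
  have T0: "T \<le> 0" using w h by (simp add: T_def)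
  have zb: "x \<in> ball 0 1" if "dist z x \<le> 3/4" for x
  proof -
    have "norm z = 1/5" using e by (simp add: z_def)
    moreover have "norm x \<le> norm z + norm (x - z)" using norm_triangle_ineq[of z "x - z"] by simp
    ultimately show ?thesis using that by (simp add: dist_norm norm_minus_commute)
  qed
  assume "\<not> ?thesis"
  then have Q0: "q y0 > y0 \<bullet> e + b - h * (gauss k z y0 - w3)" by (simp add: h_def w1_def w2_def w3_def)
  \<comment> \<open>As \<delta> tends to 0, \<open>warp\<close> tends to the identity. The three
    demands are: an error below \<gamma> for heights up to 2, derivative at most 2 for heights from
    1/20 on, and survival of the violation at \<open>y0\<close>.\<close>
  have "\<exists>\<delta>>0. \<delta> powr mu * 2 powr (1 - mu) / (mu * (1 - mu)) + \<delta> * ln 2 < \<gamma> \<and>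
     (20 * \<delta>) powr mu / mu + 20 * \<delta> < 1 \<and> warp mu \<delta> (q y0) > y0 \<bullet> e + b - h * (gauss k z y0 - w3)"
  proof -
    have pos: "\<forall>\<^sub>F \<delta> in at_right (0::real). \<delta> > 0" by (rule eventually_at_right_less)
    have "((\<lambda>\<delta>. \<delta> powr mu * 2 powr (1 - mu) / (mu * (1 - mu)) + \<delta> * ln 2) \<longlongrightarrow>
        0 powr mu * 2 powr (1 - mu) / (mu * (1 - mu)) + 0 * ln 2) (at_right 0)"
      using mu by (intro tendsto_intros tendsto_powr') (auto intro: eventually_mono[OF pos])
    then have 1: "\<forall>\<^sub>F \<delta> in at_right 0. \<delta> powr mu * 2 powr (1 - mu) / (mu * (1 - mu)) + \<delta> * ln 2 < \<gamma>"
      using \<gamma> by (intro order_tendstoD) auto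
    have "((\<lambda>\<delta>. (20 * \<delta>) powr mu / mu + 20 * \<delta>) \<longlongrightarrow> (20 * 0) powr mu / mu + 20 * 0) (at_right 0)"
      using mu by (intro tendsto_intros tendsto_powr') (auto intro: eventually_mono[OF pos])
    then have 2: "\<forall>\<^sub>F \<delta> in at_right 0. (20 * \<delta>) powr mu / mu + 20 * \<delta> < 1"
      by (intro order_tendstoD) auto
    have "((\<lambda>\<delta>. warp mu \<delta> (q y0)) \<longlongrightarrow> q y0 + 0 powr mu * q y0 powr (1 - mu) / (mu * (1 - mu)) + 0 * ln (q y0)) (at_right 0)"
      unfolding warp_def
      using mu by (intro tendsto_intros tendsto_powr') (auto intro: eventually_mono[OF pos])
    then have 3: "\<forall>\<^sub>F \<delta> in at_right 0. warp mu \<delta> (q y0) > y0 \<bullet> e + b - h * (gauss k z y0 - w3)"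
      using Q0 by (intro order_tendstoD) auto
    have "\<forall>\<^sub>F \<delta> in at_right 0. \<delta> > 0 \<and> \<delta> powr mu * 2 powr (1 - mu) / (mu * (1 - mu)) + \<delta> * ln 2 < \<gamma> \<and>
     (20 * \<delta>) powr mu / mu + 20 * \<delta> < 1 \<and> warp mu \<delta> (q y0) > y0 \<bullet> e + b - h * (gauss k z y0 - w3)"
      using pos 1 2 3 by eventually_elim auto
    then show ?thesis by (auto dest: eventually_happens)
  qed
  then obtain \<delta> where \<delta>: "\<delta> > 0" "\<delta> powr mu * 2 powr (1 - mu) / (mu * (1 - mu)) + \<delta> * ln 2 < \<gamma>"
     "(20 * \<delta>) powr mu / mu + 20 * \<delta> < 1" "warp mu \<delta> (q y0) > y0 \<bullet> e + b - h * (gauss k z y0 - w3)"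
    by blast
  let ?\<sigma> = "warp mu \<delta>"
  have \<sigma>_le: "?\<sigma> s \<le> s + \<gamma>" if "0 < s" "s \<le> 2" for s
  proof -
    have "\<delta> powr mu * s powr (1 - mu) / (mu * (1 - mu)) + \<delta> * ln s
       \<le> \<delta> powr mu * 2 powr (1 - mu) / (mu * (1 - mu)) + \<delta> * ln 2"
      using that mu \<delta>(1) by (intro add_mono divide_right_mono mult_left_mono powr_mono2) auto
    then show ?thesis using \<delta>(2) by (simp add: warp_def)
  qed
  let ?l = "level e b (- h) k z"
  define \<beta> where "\<beta> y = ?l y - ?\<sigma> (q y)" for y
  have \<beta>0: "\<beta> y0 < T" using \<delta>(4) by (simp add: \<beta>_def level_def T_def algebra_simps)
  let ?A = "{y. \<rho> \<le> dist z y \<and> dist z y \<le> 3/4}"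
  have A_ball: "y \<in> ball 0 1" if "y \<in> ?A" for y using zb that by auto
  have l_ge: "?l y \<ge> -2" if "y \<in> ?A" for y
  proof -
    have "\<bar>y \<bullet> e\<bar> \<le> 1" using Cauchy_Schwarz_ineq2[of y e] e A_ball[OF that] by simp
    moreover have "h * gauss k z y \<le> 1 * 1"
      using h gauss_le_1[of k z y] gauss_pos[of k z y] k0 by (intro mult_mono) auto
    ultimately show ?thesis using b by (simp add: level_def)
  qed
  \<comment> \<open>Below height \<open>q0\<close> the function \<open>\<beta>\<close> exceeds T, so
    the minimisation may be confined to the compact set where q is at least \<open>q0\<close>. There
    u does not vanish.\<close>
  obtain q0 where q0: "q0 > 0" "\<And>s. 0 < s \<Longrightarrow> s < q0 \<Longrightarrow> ?\<sigma> s < -2 - T"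
    using warp_at_bot[OF mu \<delta>(1), of "-2 - T"] by blast
  have \<beta>_ge: "\<beta> y > T" if "y \<in> ?A" "u y \<noteq> 0" "q y < q0" for y
    using l_ge[OF that(1)] q0(2)[of "q y"] q_pos[OF that(2)] that(3) by (simp add: \<beta>_def)
  let ?K = "{y \<in> ?A. q0 \<le> q y}"
  have compA: "compact ?A"
  proof -
    have "?A = cball z (3/4) - ball z \<rho>" by auto
    then show ?thesis by (simp add: compact_diff)
  qed
  have cuA: "continuous_on ?A u"
    using A_ball by (intro continuous_on_subset[OF cont]) auto
  have cq: "continuous_on ?A q"
    unfolding q_def[abs_def] using cuA mu c_p_pos[OF p01] by (intro continuous_intros continuous_on_powr') auto
  have clK: "closed (?A \<inter> q -` {q0..})"
    by (rule continuous_closed_preimage[OF cq compact_imp_closed[OF compA] closed_atLeast])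
  have "?K = ?A \<inter> (?A \<inter> q -` {q0..})" by blast
  then have compK: "compact ?K" using compact_Int_closed[OF compA clK] by (simp only:)
  have y0K: "y0 \<in> ?K" using y0 \<beta>0 \<beta>_ge[of y0] by force
  have c\<beta>: "continuous_on ?K \<beta>"
  proof -
    have "continuous_on ?K (\<lambda>y. ?\<sigma> (q y))"
    proof (rule continuous_on_compose2[of "{0<..}" ?\<sigma>])
      show "continuous_on {0<..} ?\<sigma>"
        using warp_deriv[OF mu \<delta>(1)] by (intro continuous_at_imp_continuous_on) (auto dest: DERIV_isCont)
      show "continuous_on ?K q" by (rule continuous_on_subset[OF cq]) auto
    qed (use q0 in auto)
    then show ?thesis unfolding \<beta>_def by (intro continuous_intros)
  qed
  obtain y where y: "y \<in> ?K" "\<And>x. x \<in> ?K \<Longrightarrow> \<beta> y \<le> \<beta> x"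
    using continuous_attains_inf[OF compK _ c\<beta>] y0K by blast
  have yA: "y \<in> ?A" and yq: "q y > 0" using y(1) q0 by auto
  have uy: "u y \<noteq> 0" using yq by (auto simp: q_def)
  have \<beta>y: "\<beta> y < T" using y(2)[OF y0K] \<beta>0 by simp
  have q2: "q y \<le> y \<bullet> e + b" "q y \<le> 2"
  proof -
    show "q y \<le> y \<bullet> e + b" using upper[OF A_ball[OF yA]] q_le_iff[OF uy] by blast
    moreover have "y \<bullet> e \<le> 1" using Cauchy_Schwarz_ineq2[of y e] e A_ball[OF yA] by simp
    ultimately show "q y \<le> 2" using a d by linarith
  qed
  have \<sigma>y: "?\<sigma> (q y) \<le> q y + \<gamma>" by (rule \<sigma>_le[OF yq q2(2)])
  have out: "dist z y < 3/4"
  proof (rule ccontr)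
    assume "\<not> dist z y < 3/4"
    then have "dist z y = 3/4" using yA by auto
    then have "(y - z) \<bullet> (y - z) = (3/4)\<^sup>2" by (simp add: dist_norm norm_minus_commute flip: power2_norm_eq_inner)
    then have g: "gauss k z y = w1" by (simp add: gauss_def w1_def power2_eq_square)
    have "\<beta> y \<ge> - h * w1 - \<gamma>" using \<sigma>y q2(1) g by (simp add: \<beta>_def level_def)
    moreover have "- h * w1 - \<gamma> = T" by (simp add: \<gamma>_def T_def w3_def field_simps)
    ultimately show False using \<beta>y by simp
  qed
  have inn: "\<rho> < dist z y"
  proof (rule ccontr)
    assume "\<not> \<rho> < dist z y"
    then have "q y \<le> y \<bullet> e + b - d / 32" using inner[of y] q_le_iff[OF uy] by auto
    moreover have "h * gauss k z y \<le> h * 1" using h gauss_le_1[of k z y] k0 by (intro mult_left_mono) auto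
    ultimately have "\<beta> y \<ge> d / 32 - h - \<gamma>" using \<sigma>y by (simp add: \<beta>_def level_def)
    then show False using \<gamma>(2) d0 T0 \<beta>y unfolding h_def by argo
  qed
  have "open {x. \<rho> < dist z x \<and> dist z x < 3/4}"
    by (intro open_Collect_conj open_Collect_less continuous_intros)
  then have "\<forall>\<^sub>F x in nhds y. \<rho> < dist z x \<and> dist z x < 3/4"
    using eventually_nhds_in_open[of "{x. \<rho> < dist z x \<and> dist z x < 3/4}" y] out inn by simp
  then have touch: "\<forall>\<^sub>F x in nhds y. u x \<noteq> 0 \<longrightarrow> ?l y - ?\<sigma> (q y) \<le> ?l x - ?\<sigma> (q x)"
  proof eventually_elim
    case (elim x)
    then have x: "x \<in> ?A" by auto
    show ?case
      unfolding \<beta>_def[symmetric]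
    proof
      assume ux: "u x \<noteq> 0"
      show "\<beta> y \<le> \<beta> x"
      proof (cases "q x < q0")
        case True
        then show ?thesis using \<beta>_ge[OF x ux] \<beta>y by simp
      next
        case False
        then show ?thesis using x y(2)[of x] by auto
      qed
    qed
  qed
  define r where "r = norm (y - z)"
  define g where "g = gauss k z y"
  have r: "\<rho> \<le> r" "r \<le> 1" using inn out by (auto simp: r_def dist_norm norm_minus_commute)
  have g: "0 < g" "g \<le> 1" using gauss_pos[of k z y] gauss_le_1[of k z y] k0 by (auto simp: g_def)
  define Lam where "Lam = mu * dwarp mu \<delta> (q y) / q y"
  have Lam0: "Lam > 0" using mu yq dwarp_ge_1[OF mu(1) \<delta>(1) yq] by (simp add: Lam_def)
  \<comment> \<open>The factor that decides the sign of 1 - |grad|^2. Its correction term is at most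
    1/64 because k d <= 1.\<close>
  define X where "X = (y - z) \<bullet> e + k * h * g * r\<^sup>2"
  have "Lam * (1 - level_grad e (- h) k z y \<bullet> level_grad e (- h) k z y) \<le> level_lap (- h) k z y"
    unfolding Lam_def by (rule upper_touch[OF A_ball[OF yA] uy \<delta>(1) touch])
  moreover have "1 - level_grad e (- h) k z y \<bullet> level_grad e (- h) k z y = - (4 * k * h * g) * X"
    by (simp add: norm_level_grad[OF e] X_def g_def r_def power2_eq_square algebra_simps)
  moreover have "level_lap (- h) k z y = - (h * g) * (4 * k\<^sup>2 * r\<^sup>2 - 2 * k * DIM('a))"
    by (simp add: level_lap_def g_def r_def)
  ultimately have "(h * g) * (4 * k\<^sup>2 * r\<^sup>2 - 2 * k * DIM('a)) \<le> (h * g) * (Lam * (4 * k * X))"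
    by (simp add: mult_ac)
  then have "4 * k\<^sup>2 * r\<^sup>2 - 2 * k * DIM('a) \<le> Lam * (4 * k * X)"
    by (rule mult_left_le_imp_le) (use h g in simp)
  then have "k * (4 * (k * r\<^sup>2) - 2 * DIM('a)) \<le> k * (4 * Lam * X)" by (simp add: power2_eq_square algebra_simps)
  then have main: "4 * (k * r\<^sup>2) - 2 * DIM('a) \<le> 4 * Lam * X"
    by (rule mult_left_le_imp_le) (rule k0)
  have "\<rho>\<^sup>2 \<le> r\<^sup>2" using r \<rho> by (intro power_mono) auto
  then have "k * \<rho>\<^sup>2 \<le> k * r\<^sup>2" using k0 by (intro mult_left_mono) auto
  \<comment> \<open>The bound on k makes the left side of \<open>main\<close> at least 640, whereas
    \<open>Lam \<le> 40\<close> and \<open>X \<le> 2\<close>, shown below, keep the right side at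
    320 or less.\<close>
  then have big: "320 < 4 * Lam * X" using main k by linarith
  have "(k * h) * (g * r\<^sup>2) \<le> (1/64) * (1 * 1)"
    using d h g r \<rho> k0 by (intro mult_mono) (auto simp: h_def power_le_one)
  then have khgr: "k * h * g * r\<^sup>2 \<le> 1/64" by (simp add: mult_ac)
  have ye: "(y - z) \<bullet> e = y \<bullet> e - 1/5" by (simp add: z_def inner_diff_left ee)
  \<comment> \<open>Positivity of \<open>X\<close> places the contact point at most 1/64 below the
    height of z. Hence q is at least 1/20 there and \<open>Lam\<close> is bounded, away from the
    singularity of the equation.\<close>
  have X0: "X > 0" using big Lam0 by (smt (verit) zero_less_mult_iff)
  then have "y \<bullet> e > 1/10" using khgr by (simp add: X_def ye)
  have "q y \<ge> 1/20"
  proof -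
    have "h * gauss k z y \<le> h * 1" using g h by (intro mult_left_mono) (auto simp: g_def)
    then have "?l y - \<beta> y \<ge> y \<bullet> e + b - h" using \<beta>y T0 by (simp add: level_def)
    then show ?thesis using \<sigma>y \<open>y \<bullet> e > 1/10\<close> b h \<gamma> unfolding \<beta>_def by linarith
  qed
  then have "\<delta> / q y \<le> \<delta> / (1/20)" using \<delta>(1) by (intro divide_left_mono) auto
  then have le20: "\<delta> / q y \<le> 20 * \<delta>" by simp
  then have "(\<delta> / q y) powr mu / mu \<le> (20 * \<delta>) powr mu / mu"
    using \<delta>(1) yq mu by (intro divide_right_mono powr_mono2) auto
  then have dw: "dwarp mu \<delta> (q y) \<le> 2" using le20 \<delta>(3) by (simp add: dwarp_def)
  have "mu * dwarp mu \<delta> (q y) / q y \<le> (1 * 2) / (1/20)"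
    using dw mu \<open>q y \<ge> 1/20\<close> dwarp_ge_1[OF mu(1) \<delta>(1) yq] by (intro frac_le mult_mono) auto
  then have Lam40: "Lam \<le> 40" by (simp add: Lam_def)
  have "(y - z) \<bullet> e \<le> r" using norm_cauchy_schwarz[of "y - z" e] e by (simp add: r_def)
  then have "X \<le> 2" using khgr r by (simp add: X_def)
  then have "Lam * X \<le> 40 * 2" using Lam40 Lam0 X0 by (intro mult_mono) auto
  then show False using big by simp
qed

end

subsection \<open>The barrier from below\<close>

context flat_solution
begin

lemma viscosity_hessian_component:
  "\<exists>H. has_hessian_on (posset (ball 0 1) u) (\<lambda>x. u x $ i) H \<and>
    (\<forall>x\<in>posset (ball 0 1) u. trace_hess (H x) = norm (u x) powr (p - 2) * u x $ i)"
  using viscosity_solution_hessian[OF visc, of "axis i 1"] by (simp add: inner_axis)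

text \<open>Where \<open>u $ i0\<close> is negative, \<open>- u $ i0\<close> is a subsolution of \<open>\<Delta> v = V v\<close> with \<open>V \<ge> \<kappa> (\<kappa> - 1) / d\<^sup>2\<close>,
  and the quadratic \<open>|x - y|\<^sup>2 + K d\<^sup>2\<close> is a supersolution of this equation.\<close>

lemma strip_bound:
  assumes y: "cball y (1/25) \<subseteq> ball 0 1"
  shows "u y $ i0 \<ge> - (1250 * DIM('a) * c_p p / (kappa p * mu) * d powr kappa p * d\<^sup>2)"
proof -
  \<comment> \<open>625 is the square of 25: on the sphere of radius 1/25 the quadratic reaches
    u0(d), which bounds |u| there. \<open>K\<close> is chosen so that the Laplacian 2 n M equals the
    least coefficient kappa (kappa - 1) / d^2 times the value M K d^2 at the centre.\<close>
  define M where "M = 625 * (c_p p * d powr kappa p)"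
  define K where "K = 2 * DIM('a) / (kappa p * mu)"
  have d0: "d > 0" using ab by simp
  have M: "M > 0" using c_p_pos[OF p01] d0 by (simp add: M_def)
  have \<kappa>: "kappa p > 0" using mu by simp
  have K: "K > 0" using mu \<kappa> by (simp add: K_def)
  define w where "w x = u x $ i0 + M * ((norm (x - y))\<^sup>2 + K * d\<^sup>2)" for x
  have "continuous_on (cball y (1/25)) w"
    unfolding w_def using continuous_on_subset[OF cont y] by (intro continuous_intros) auto
  then obtain x where x: "x \<in> cball y (1/25)" "\<And>x'. x' \<in> cball y (1/25) \<Longrightarrow> w x \<le> w x'"
    using continuous_attains_inf[of "cball y (1/25)" w] by (metis compact_cball cball_eq_empty less_le_not_le zero_le_divide_1_iff zero_le_numeral)
  have "w x \<ge> 0"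
  proof (rule ccontr)
    assume neg: "\<not> w x \<ge> 0"
    have "M * ((norm (x - y))\<^sup>2 + K * d\<^sup>2) \<ge> 0" using M K by simp
    then have u_neg: "u x $ i0 < 0" using neg by (simp add: w_def)
    have xb: "x \<in> ball 0 1" using x(1) y by blast
    \<comment> \<open>Negativity confines x to the side where the lower bound is silent. There the
      upper plane has height below d, so |u| is at most u0(d) and the coefficient |u|^(p-2) is
      large.\<close>
    have "x \<bullet> e < - a"
      using lower[OF xb] u_neg u0_nonneg[OF p01, of "x \<bullet> e + a"] by force
    then have "u0 p (x \<bullet> e + b) \<le> u0 p d" by (intro u0_mono[OF p01]) simp
    with upper[OF xb] have ud: "norm (u x) \<le> u0 p d" by simp
    have uxd: "u0 p d = c_p p * d powr kappa p" using d0 by (simp add: u0_pos_eq[OF p01])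
    have "norm (x - y) < 1/25"
    proof (rule ccontr)
      assume "\<not> norm (x - y) < 1/25"
      then have "norm (x - y) = 1/25" using x(1) by (simp add: dist_norm norm_minus_commute)
      then have "(norm (x - y))\<^sup>2 = 1/625" by (simp only: power_divide) simp
      then have "M * (norm (x - y))\<^sup>2 = u0 p d" by (simp add: M_def uxd)
      then have "w x \<ge> u x $ i0 + u0 p d" using M K by (simp add: w_def distrib_left)
      then show False using neg ud component_le[of x i0] by simp
    qed
    then have xint: "x \<in> ball y (1/25)" by (simp add: dist_norm norm_minus_commute)
    have "u x \<noteq> 0" using u_neg by auto
    then have xP: "x \<in> posset (ball 0 1) u" and up: "norm (u x) > 0" using xb by (auto simp: posset_def)
    obtain H where H: "has_hessian_on (posset (ball 0 1) u) (\<lambda>x. u x $ i0) H"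
      "\<And>x. x \<in> posset (ball 0 1) u \<Longrightarrow> trace_hess (H x) = norm (u x) powr (p - 2) * u x $ i0"
      using viscosity_hessian_component by blast
    obtain L where L: "\<And>i. D2 (\<lambda>t. u (x + t *\<^sub>R i) $ i0) (blinfun_apply L i) (H x i i)"
      using has_hessian_on_D2[OF H(1) open_pos xP] by blast
    have key: "H x i i + 2 * M \<ge> 0" if i: "i \<in> Basis" for i
    proof -
      have ii: "i \<bullet> i = 1" using i by (simp add: inner_same_Basis)
      have eq: "w (x + t *\<^sub>R i) = u (x + t *\<^sub>R i) $ i0 +
         (M * ((norm (x - y))\<^sup>2 + K * d\<^sup>2) + (M * 2 * (i \<bullet> (x - y))) * t + M * t\<^sup>2)" for t
      proof -
        have "(x - y) + t *\<^sub>R i = x + t *\<^sub>R i - y" by simp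
        then have "(norm (x + t *\<^sub>R i - y))\<^sup>2 = (norm (x - y))\<^sup>2 + 2 * t * (i \<bullet> (x - y)) + t\<^sup>2"
          using norm_line[of "x - y" t i] ii by (simp only: \<open>(x - y) + t *\<^sub>R i = x + t *\<^sub>R i - y\<close>)
        then show ?thesis unfolding w_def by (simp add: distrib_left right_diff_distrib mult_ac)
      qed
      have "D2 (\<lambda>t. w (x + t *\<^sub>R i)) (L i + M * 2 * (i \<bullet> (x - y))) (H x i i + 2 * M)"
        unfolding eq by (intro D2_add L D2_quadratic)
      moreover have "\<forall>\<^sub>F t in nhds 0. x + t *\<^sub>R i \<in> ball y (1/25)"
        using xint by (intro eventually_line eventually_nhds_in_open) auto
      then have "\<forall>\<^sub>F t in nhds 0. w (x + 0 *\<^sub>R i) \<le> w (x + t *\<^sub>R i)"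
        by eventually_elim (auto intro!: x(2))
      ultimately show ?thesis by (rule D2_min(2))
    qed
    have "0 \<le> (\<Sum>i\<in>Basis. H x i i + 2 * M)" by (intro sum_nonneg key)
    also have "\<dots> = trace_hess (H x) + 2 * DIM('a) * M" by (simp add: trace_hess_def sum.distrib)
    finally have 1: "norm (u x) powr (p - 2) * (- u x $ i0) \<le> 2 * DIM('a) * M" using H(2)[OF xP] by simp
    have "kappa p * mu / d\<^sup>2 = u0 p d powr (p - 2)" using u0_powr'[OF p01 d0] by simp
    also have "\<dots> \<le> norm (u x) powr (p - 2)" using ud up p1 by (intro powr_mono2') auto
    finally have 2: "kappa p * mu / d\<^sup>2 \<le> norm (u x) powr (p - 2)" .
    have "M * (norm (x - y))\<^sup>2 \<ge> 0" using M by simp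
    then have 3: "- u x $ i0 > M * (K * d\<^sup>2)" using neg unfolding w_def distrib_left by linarith
    have "2 * DIM('a) * M = kappa p * mu / d\<^sup>2 * (M * (K * d\<^sup>2))"
      using d0 mu \<kappa> by (simp add: K_def)
    also have "\<dots> < kappa p * mu / d\<^sup>2 * (- u x $ i0)"
      using 3 d0 mu \<kappa> by (intro mult_strict_left_mono) auto
    also have "\<dots> \<le> norm (u x) powr (p - 2) * (- u x $ i0)"
      using 2 u_neg by (intro mult_right_mono) auto
    finally show False using 1 by simp
  qed
  then have "w y \<ge> 0" using x(2)[of y] by simp
  then show ?thesis by (simp add: w_def M_def K_def algebra_simps)
qed

text \<open>Linear below 0, and an increasing bijection of the real line for positive \<delta>.
  Contact can therefore be expressed through its inverse, with possibly negative values of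
  \<open>u $ i0\<close> included.\<close>

definition tilt :: "real \<Rightarrow> real \<Rightarrow> real" where "tilt \<delta> s = u0 p s + \<delta> * s"

lemma tilt_deriv: "(tilt \<delta> has_real_derivative du0 p s + \<delta>) (at s)"
  unfolding tilt_def[abs_def]
  by (auto intro!: derivative_eq_intros u0_deriv[OF p01])

lemma tilt_increment: "s \<le> t \<Longrightarrow> \<delta> * (t - s) \<le> tilt \<delta> t - tilt \<delta> s"
  using u0_mono[OF p01, of s t] by (simp add: tilt_def algebra_simps)

lemma tilt_strict_mono: "\<delta> > 0 \<Longrightarrow> s < t \<Longrightarrow> tilt \<delta> s < tilt \<delta> t"
  using u0_mono[OF p01, of s t] by (simp add: tilt_def add_le_less_mono)

lemma tilt_0: "tilt \<delta> 0 = 0"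
  by (simp add: tilt_def u0_def)

lemma tilt_le_iff: "\<delta> > 0 \<Longrightarrow> tilt \<delta> s \<le> tilt \<delta> t \<longleftrightarrow> s \<le> t"
  using tilt_strict_mono by (metis le_less not_le)

lemma tilt_surj: 
  assumes "\<delta> > 0"
  shows "\<exists>s. tilt \<delta> s = v"
proof -
  have "continuous_on {- \<bar>v\<bar> / \<delta>..\<bar>v\<bar> / \<delta>} (tilt \<delta>)"
    using tilt_deriv by (intro continuous_at_imp_continuous_on) (auto dest: DERIV_isCont)
  moreover have "tilt \<delta> (- \<bar>v\<bar> / \<delta>) \<le> v" "v \<le> tilt \<delta> (\<bar>v\<bar> / \<delta>)"
    using assms u0_nonneg[OF p01, of "\<bar>v\<bar> / \<delta>"] u0_nonpos[OF p01, of "- \<bar>v\<bar> / \<delta>"]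
    by (auto simp: tilt_def divide_nonpos_pos)
  moreover have "- \<bar>v\<bar> / \<delta> \<le> \<bar>v\<bar> / \<delta>" using assms by (intro divide_right_mono) auto
  ultimately show ?thesis using IVT'[of "tilt \<delta>"] by blast
qed

text \<open>The slope \<open>\<delta>\<close> at \<open>0\<close> makes \<open>tilt \<delta>\<close> admissible in the viscosity condition. At a contact point with
  \<open>u $ i0 = 0\<close> but \<open>u \<noteq> 0\<close> that condition is void; there the term \<open>u0\<close> of order \<open>t powr \<kappa>\<close>, \<open>\<kappa> < 2\<close>,
  would lie below a remainder of order \<open>t\<^sup>2\<close>.\<close>

lemma lower_touch:
  fixes x :: 'a and c h k :: real
  assumes r0: "r0 > 0" "ball x r0 \<subseteq> ball 0 1" and \<delta>: "\<delta> > 0"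
    and le: "\<And>y. y \<in> ball x r0 \<Longrightarrow> tilt \<delta> (level e c h k z y) \<le> u y $ i0"
    and eq: "tilt \<delta> (level e c h k z x) = u x $ i0"
    and sub_neg: "\<And>y. y \<in> ball x r0 \<Longrightarrow> level e c h k z y < 0 \<Longrightarrow> level_lap h k z y > 0"
    and sub_pos: "\<And>y. y \<in> ball x r0 \<Longrightarrow> level e c h k z y > 0 \<Longrightarrow>
       ddu0 p (level e c h k z y) * (level_grad e h k z y \<bullet> level_grad e h k z y - 1) +
       (du0 p (level e c h k z y) + \<delta>) * level_lap h k z y > 0"
    and grad: "level_grad e h k z x \<bullet> e > 1/2"
  shows False
proof -
  let ?S = "level e c h k z"
  let ?g = "level_grad e h k z"
  define \<phi> where "\<phi> y = tilt \<delta> (?S y)" for y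
  have sgn: "\<phi> y > 0 \<longleftrightarrow> ?S y > 0" "\<phi> y < 0 \<longleftrightarrow> ?S y < 0" "\<phi> y = 0 \<longleftrightarrow> ?S y = 0" for y
    using tilt_strict_mono[OF \<delta>, of 0 "?S y"] tilt_strict_mono[OF \<delta>, of "?S y" 0] tilt_0[of \<delta>]
    unfolding \<phi>_def by (cases "?S y" "0::real" rule: linorder_cases; force)+
  have xx: "x \<in> ball x r0" using r0 by simp
  then have x01: "x \<in> ball 0 1" using r0 by blast
  let ?X = "ball x r0 \<inter> {y. \<phi> y \<noteq> 0}"
  have cS: "continuous_on UNIV ?S" by (intro continuous_intros)
  have "continuous_on ?X (\<lambda>y. ddu0 p (?S y))"
    by (rule continuous_on_compose2[OF continuous_on_ddu0[OF p01] continuous_on_subset[OF cS]]) (auto simp: sgn)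
  moreover have "((\<lambda>s. du0 p s + \<delta>) has_real_derivative ddu0 p s) (at s)" if "s \<noteq> 0" for s
    using DERIV_add[OF du0_deriv[OF p01 that] DERIV_const[of \<delta>]] by simp
  ultimately have "\<exists>K. has_hessian_on ?X (\<lambda>y. tilt \<delta> (?S y)) K \<and> (\<forall>y. trace_hess (K y) =
     ddu0 p (?S y) * (?g y \<bullet> ?g y) + (du0 p (?S y) + \<delta>) * level_lap h k z y)"
    by (intro has_hessian_on_level tilt_deriv) (auto simp: sgn)
  then obtain K where K: "has_hessian_on ?X \<phi> K" "\<And>y. trace_hess (K y) =
     ddu0 p (?S y) * (?g y \<bullet> ?g y) + (du0 p (?S y) + \<delta>) * level_lap h k z y"
    unfolding \<phi>_def[abs_def, symmetric] by blast
  \<comment> \<open>Adding \<delta> s to u0 raises the value where s > 0, and hence lowers its power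
    p - 1 below u0''. The remaining strictness comes from the Laplacian of the level
    function.\<close>
  have strict: "trace_hess (K y) > (if \<phi> y > 0 then \<phi> y powr (p - 1) else 0)" if y: "y \<in> ?X" for y
  proof (cases "?S y > 0")
    case True
    have "\<phi> y powr (p - 1) \<le> u0 p (?S y) powr (p - 1)"
      using True \<delta> u0_pos[OF p01 True] by (intro powr_p1_antimono) (auto simp: \<phi>_def tilt_def)
    also have "\<dots> = ddu0 p (?S y)" using True by (simp add: ddu0_def)
    finally show ?thesis using sub_pos[of y] y True sgn(1)[of y] by (simp add: K(2) algebra_simps)
  next
    case False
    then have neg: "?S y < 0" using y sgn(3)[of y] by auto
    then have "trace_hess (K y) = \<delta> * level_lap h k z y" by (simp add: K(2) ddu0_def du0_def)
    then show ?thesis using sub_neg[of y] y neg \<delta> sgn(1)[of y] by simp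
  qed
  have inc: "\<forall>\<^sub>F t in at_right 0. ?S (x + t *\<^sub>R e) > ?S x + t / 2"
  proof -
    have "((\<lambda>t. ?S (x + t *\<^sub>R e)) has_real_derivative ?g x \<bullet> e) (at 0)"
      by (rule D2_imp_deriv[OF D2_level[OF ee]])
    then have "((\<lambda>t. ?S (x + t *\<^sub>R e) - t / 2) has_real_derivative ?g x \<bullet> e - 1/2) (at 0)"
      by (auto intro!: derivative_eq_intros)
    from DERIV_pos_inc_right[OF this] grad
    obtain e' where e': "e' > 0" "\<forall>t>0. t < e' \<longrightarrow> ?S (x + 0 *\<^sub>R e) - 0 / 2 < ?S (x + (0 + t) *\<^sub>R e) - (0 + t) / 2"
      by auto
    then have "\<forall>t>0. t < e' \<longrightarrow> ?S x + t / 2 < ?S (x + t *\<^sub>R e)" by (simp add: less_diff_eq)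
    then show ?thesis unfolding eventually_at_right_field using e'(1) by blast
  qed
  have ev_ball: "\<forall>\<^sub>F t in nhds 0. x + t *\<^sub>R e \<in> ball x r0"
    using xx by (intro eventually_line eventually_nhds_in_open) auto
  have right: "\<forall>\<^sub>F t in at_right 0. P t" if "\<forall>\<^sub>F t in nhds 0. P t" for P :: "real \<Rightarrow> bool"
    using that by (auto simp: eventually_at_filter elim: eventually_mono)
  have eq': "\<phi> x = u x $ i0" using eq by (simp add: \<phi>_def)
  show False
  \<comment> \<open>There are four kinds of contact point: with nonzero value of \<phi>, where the
    equation is used; with \<phi> = 0 but u nonzero; at the free boundary, where the viscosity
    condition applies; and in the interior of the zero set, where \<phi> becomes positive along
    \<open>e\<close>.\<close>
  proof (cases "\<phi> x = 0")
    case False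
    then have xX: "x \<in> ?X" using xx by simp
    have "u x \<noteq> 0" using False eq' by auto
    then have xP: "x \<in> posset (ball 0 1) u" using x01 by (simp add: posset_def)
    obtain H where H: "has_hessian_on (posset (ball 0 1) u) (\<lambda>x. u x $ i0) H"
      "\<And>x. x \<in> posset (ball 0 1) u \<Longrightarrow> trace_hess (H x) = norm (u x) powr (p - 2) * u x $ i0"
      using viscosity_hessian_component by blast
    have "open (ball x r0 \<inter> {y. ?S y \<noteq> 0})"
      by (intro open_Int open_ball open_Collect_neq cS continuous_on_const)
    then have oX: "open ?X" by (simp add: sgn)
    have "\<forall>\<^sub>F y in nhds x. y \<in> ball x r0" using xx by (intro eventually_nhds_in_open) auto
    then have "\<forall>\<^sub>F y in nhds x. u y $ i0 - \<phi> y \<ge> u x $ i0 - \<phi> x"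
      by eventually_elim (use le eq' in \<open>simp add: \<phi>_def\<close>)
    from trace_hess_min[OF H(1) open_pos xP K(1) oX xX this]
    have tr: "trace_hess (K x) \<le> norm (u x) powr (p - 2) * \<phi> x" using H(2)[OF xP] eq' by simp
    show False
    proof (cases "\<phi> x > 0")
      case True
      have "norm (u x) powr (p - 2) * \<phi> x \<le> \<phi> x powr (p - 2) * \<phi> x"
        using True component_le[of x i0] eq' p1 by (intro mult_right_mono powr_mono2') auto
      also have "\<dots> = \<phi> x powr (p - 1)" using True powr_add[of "\<phi> x" "p - 2" 1] by simp
      finally show False using tr strict[OF xX] True by simp
    next
      case neg: False
      then have "norm (u x) powr (p - 2) * \<phi> x \<le> 0" by (intro mult_nonneg_nonpos) auto
      then show False using tr strict[OF xX] neg by simp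
    qed
  next
    case True
    then have Sx: "?S x = 0" using sgn(3) by simp
    show False
    proof (cases "u x = 0")
      case False
      then have xP: "x \<in> posset (ball 0 1) u" using x01 by (simp add: posset_def)
      obtain H where H: "has_hessian_on (posset (ball 0 1) u) (\<lambda>x. u x $ i0) H"
        using viscosity_hessian_component by blast
      obtain L where L: "\<And>v. D2 (\<lambda>t. u (x + t *\<^sub>R v) $ i0) (blinfun_apply L v) (H x v v)"
        using has_hessian_on_D2[OF H open_pos xP] by blast
      \<comment> \<open>\<open>?G\<close> is twice differentiable at 0 and has a minimum with value
        0 there, so it is O(t^2). It also dominates u0(t/2) for small t > 0 by \<open>inc\<close>,
        and kappa < 2 makes this impossible.\<close>
      let ?G = "\<lambda>t. u (x + t *\<^sub>R e) $ i0 - \<delta> * ?S (x + t *\<^sub>R e)"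
      have G0: "?G 0 = 0" using True eq' Sx by simp
      have Gge: "\<forall>\<^sub>F t in nhds 0. u0 p (?S (x + t *\<^sub>R e)) \<le> ?G t"
        using ev_ball by eventually_elim (use le in \<open>force simp: tilt_def\<close>)
      note D = D2_diff[OF L[of e] D2_cmult[OF D2_level[OF ee, of e c h k z x], of \<delta>]]
      have min: "\<forall>\<^sub>F t in nhds 0. ?G 0 \<le> ?G t"
        using Gge unfolding G0 by eventually_elim (use u0_nonneg[OF p01] order_trans in blast)
      from D2_quadratic_bound[OF D[unfolded D2_min(1)[OF D min]] G0] obtain C where C: "\<forall>\<^sub>F t in at_right 0. ?G t \<le> C * t\<^sup>2" by blast
      have "((\<lambda>t. C * t powr (2 - kappa p)) \<longlongrightarrow> C * 0 powr (2 - kappa p)) (at_right 0)"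
        using mu by (intro tendsto_intros tendsto_powr') (auto intro: eventually_mono[OF eventually_at_right_less])
      then have small: "\<forall>\<^sub>F t in at_right 0. C * t powr (2 - kappa p) < c_p p * (1/2) powr kappa p"
        using mu c_p_pos[OF p01] by (intro order_tendstoD) auto
      have "\<forall>\<^sub>F t in at_right (0::real). False"
        using C small inc right[OF Gge] eventually_at_right_less[of "0::real"]
      proof eventually_elim
        case (elim t)
        have "c_p p * (t / 2) powr kappa p = u0 p (t / 2)" using elim by (simp add: u0_pos_eq[OF p01])
        also have "\<dots> \<le> u0 p (?S (x + t *\<^sub>R e))" using elim Sx by (intro u0_mono[OF p01]) simp
        also have "\<dots> \<le> C * t\<^sup>2" using elim by linarith
        also have "t\<^sup>2 = t powr (2 - kappa p) * t powr kappa p"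
          using elim powr_realpow[of t 2] by (simp flip: powr_add)
        also have "C * (t powr (2 - kappa p) * t powr kappa p) = (C * t powr (2 - kappa p)) * t powr kappa p" by simp
        also have "\<dots> < (c_p p * (1/2) powr kappa p) * t powr kappa p"
          using elim by (intro mult_strict_right_mono) auto
        also have "\<dots> = c_p p * (t / 2) powr kappa p"
          using elim powr_mult[of "1/2" t "kappa p"] by simp
        finally show False by simp
      qed
      then show False by simp
    next
      case ux: True
      have nP: "x \<notin> posset (ball 0 1) u" using ux by (simp add: posset_def)
      show False
      proof (cases "x \<in> closure (posset (ball 0 1) u)")
        case cl: True
        have "x \<in> freebd (ball 0 1) u"
          using cl nP x01 interior_subset by (auto simp: freebd_def frontier_def)
        moreover have "admissible_test p (ball x r0) x \<phi>"
          unfolding admissible_test_def classical_laplace_gt_def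
        proof (intro conjI exI)
          have der: "(\<phi> has_derivative (\<lambda>v. ((du0 p (?S y) + \<delta>) *\<^sub>R ?g y) \<bullet> v)) (at y)" for y
            unfolding \<phi>_def
            using has_derivative_compose[OF level_derivative, of "tilt \<delta>" "(*) (du0 p (?S y) + \<delta>)" e c h k z y] tilt_deriv
            by (simp add: has_field_derivative_def)
          show "C1_on (ball x r0) \<phi>"
            unfolding C1_on_def
          proof (intro exI[of _ "\<lambda>y. blinfun_inner_right ((du0 p (?S y) + \<delta>) *\<^sub>R ?g y)"] conjI ballI)
            show "(\<phi> has_derivative blinfun_apply (blinfun_inner_right ((du0 p (?S y) + \<delta>) *\<^sub>R ?g y))) (at y)" for y
              using der[of y] by (simp only: blinfun_inner_right.rep_eq)
            show "continuous_on (ball x r0) (\<lambda>y. blinfun_inner_right ((du0 p (?S y) + \<delta>) *\<^sub>R ?g y))"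
              unfolding level_grad_def
              by (intro bounded_linear.continuous_on[OF bounded_linear_blinfun_inner_right] continuous_intros
                  continuous_on_du0[OF p01])
          qed
          show "\<phi> x = 0" by (rule True)
          show "(\<phi> has_derivative (\<lambda>v. ((du0 p (?S x) + \<delta>) *\<^sub>R ?g x) \<bullet> v)) (at x)" by (rule der)
          show "(\<lambda>v. ((du0 p (?S x) + \<delta>) *\<^sub>R ?g x) \<bullet> v) \<noteq> (\<lambda>_. 0)"
          proof
            assume "(\<lambda>v. ((du0 p (?S x) + \<delta>) *\<^sub>R ?g x) \<bullet> v) = (\<lambda>_. 0)"
            then have "((du0 p (?S x) + \<delta>) *\<^sub>R ?g x) \<bullet> e = 0" by (rule fun_cong)
            moreover have "du0 p (?S x) + \<delta> > 0" using \<delta> du0_nonneg[OF p01, of "?S x"] by linarith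
            ultimately show False using grad by simp
          qed
          show "has_hessian_on ?X \<phi> K" by (rule K(1))
          show "\<forall>x\<in>?X. (if 0 < \<phi> x then \<phi> x powr (p - 1) else 0) < trace_hess (K x)" using strict by blast
        qed
        moreover have "\<forall>y\<in>ball x r0. \<phi> y \<le> u y \<bullet> axis i0 1" using le by (simp add: \<phi>_def inner_axis)
        ultimately show False using visc r0 unfolding viscosity_solution_def by blast
      next
        case False
        then have "\<forall>\<^sub>F y in nhds x. y \<in> - closure (posset (ball 0 1) u)"
          by (intro eventually_nhds_in_open) auto
        then have "\<forall>\<^sub>F t in nhds 0. x + t *\<^sub>R e \<in> - closure (posset (ball 0 1) u)" by (rule eventually_line)
        from right[OF this] right[OF ev_ball] inc eventually_at_right_less[of "0::real"]
        have "\<forall>\<^sub>F t in at_right (0::real). False"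
        proof eventually_elim
          case (elim t)
          have "x + t *\<^sub>R e \<notin> posset (ball 0 1) u" using elim closure_subset by blast
          then have "u (x + t *\<^sub>R e) = 0" using elim r0 by (auto simp: posset_def)
          then have "\<phi> (x + t *\<^sub>R e) \<le> 0" using le[of "x + t *\<^sub>R e"] elim by (simp add: \<phi>_def)
          moreover have "?S (x + t *\<^sub>R e) > 0" using elim Sx by simp
          ultimately show False using sgn(1) by (simp add: not_less[symmetric])
        qed
        then show False by simp
      qed
    qed
  qed
qed

text \<open>Lowering the height by g pays for the slope \<delta>: with t = s - g, convexity gives a
  surplus of u0'(t) g, and t^(kappa - 1) is at least t/2 for t up to 2. Hence the surplus is at
  least \<delta> t.\<close>

lemma tilt_le_u0:
  assumes "0 \<le> s" "s \<le> 2" "0 \<le> g" "0 \<le> \<delta>" "\<delta> \<le> kappa p * c_p p * g / 2"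
  shows "tilt \<delta> (s - g) \<le> u0 p s"
proof (cases "s \<le> g")
  case True
  then have "\<delta> * (s - g) \<le> 0" using assms by (intro mult_nonneg_nonpos) auto
  then show ?thesis using True u0_nonpos[OF p01, of "s - g"] u0_nonneg[OF p01, of s] by (simp add: tilt_def)
next
  case False
  define t where "t = s - g"
  have t: "0 < t" "t \<le> 2" using False assms by (auto simp: t_def)
  have "t / 2 \<le> (t / 2) powr mu" using powr_mono'[of mu 1 "t / 2"] mu t by simp
  also have "\<dots> \<le> 2 powr mu * (t / 2) powr mu"
    using ge_one_powr_ge_zero[of 2 mu] mu mult_right_mono[of 1 "2 powr mu" "(t / 2) powr mu"] by simp
  also have "\<dots> = t powr mu" using powr_mult[of 2 "t / 2" mu] t by simp
  finally have "t / 2 \<le> t powr mu" .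
  then have "(kappa p * c_p p * g) * (t / 2) \<le> (kappa p * c_p p * g) * t powr mu"
    using assms mu c_p_pos[OF p01] by (intro mult_left_mono mult_nonneg_nonneg) auto
  also have "\<dots> = du0 p t * g" using t by (simp add: du0_def)
  finally have "(kappa p * c_p p * g / 2) * t \<le> du0 p t * g" by simp
  moreover have "\<delta> * t \<le> (kappa p * c_p p * g / 2) * t" using assms t by (intro mult_right_mono) auto
  moreover have "u0 p t + du0 p t * g \<le> u0 p s"
    using u0_increment(1)[OF p01 assms(3), of t] by (simp add: t_def)
  ultimately show ?thesis by (simp add: tilt_def t_def)
qed

text \<open>The mirror image of \<open>upper_barrier\<close>, with height measured by the inverse of
  \<open>tilt\<close>. The additional difficulty is that nothing is assumed about
  \<open>u $ i0\<close> below the plane of height 0, while the minimisation runs over the whole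
  annulus; \<open>crude\<close> extends the lower bound there.\<close>

lemma lower_barrier:
  fixes z :: 'a and k :: real
  defines "z \<equiv> (1/5) *\<^sub>R e"
  assumes \<rho>: "0 < \<rho>" "\<rho> \<le> 1/10" and k: "k * \<rho>\<^sup>2 \<ge> DIM('a) + 160"
    and d: "d \<le> 1/20" "k * d \<le> 1"
    and small: "1250 * DIM('a) / (kappa p * mu) * d powr kappa p \<le>
      kappa p * ((exp (- k / 4) - exp (- 9/16 * k)) / 128)\<^sup>2 / 2"
    and b: "0 \<le> b" and a: "a \<le> 1/4"
    and inner: "\<And>x. x \<in> cball z \<rho> \<Longrightarrow> u0 p (x \<bullet> e + a + d / 32) \<le> u x $ i0"
    and y0: "\<rho> \<le> dist z y0" "dist z y0 \<le> 3/4"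
  shows "u0 p (y0 \<bullet> e + a + d / 64 * (gauss k z y0 - (exp (- 9/16 * k) + exp (- k / 4)) / 2)) \<le> u y0 $ i0
    \<or> y0 \<bullet> e + a + d / 64 * (gauss k z y0 - (exp (- 9/16 * k) + exp (- k / 4)) / 2) < 0"
proof (rule ccontr)
  define h where "h = d / 64"
  define w1 where "w1 = exp (- 9/16 * k)"
  define w2 where "w2 = exp (- k / 4)"
  define w3 where "w3 = (w1 + w2) / 2"
  define \<gamma> where "\<gamma> = h * (w2 - w1) / 2"
  define T where "T = - h * w3"
  \<comment> \<open>The largest slope that \<open>tilt_le_u0\<close> permits for a loss of height
    \<gamma>.\<close>
  define \<delta> where "\<delta> = kappa p * c_p p * \<gamma> / 2"
  have d0: "d > 0" and h: "h > 0" "h \<le> 1/1280" using ab d by (auto simp: h_def)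
  have "k * \<rho>\<^sup>2 > 0" using k by linarith
  then have k0: "k > 0" using \<rho> by (simp add: zero_less_mult_iff)
  have w: "0 < w1" "w1 < w2" "w2 \<le> 1" "w3 > 0" using k0 by (auto simp: w1_def w2_def w3_def add_pos_pos)
  have \<gamma>: "0 < \<gamma>" "\<gamma> \<le> h / 2"
    using w h mult_left_mono[of "w2 - w1" 1 h] by (auto simp: \<gamma>_def)
  have \<delta>: "\<delta> > 0" using \<gamma> mu c_p_pos[OF p01] by (simp add: \<delta>_def)
  have T0: "T \<le> 0" using w h by (simp add: T_def)
  have zb: "norm x \<le> 19/20" if "dist z x \<le> 3/4" for x
  proof -
    have "norm z = 1/5" using e by (simp add: z_def)
    moreover have "norm x \<le> norm z + norm (x - z)" using norm_triangle_ineq[of z "x - z"] by simp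
    ultimately show ?thesis using that by (simp add: dist_norm norm_minus_commute)
  qed
  let ?A = "{y. \<rho> \<le> dist z y \<and> dist z y \<le> 3/4}"
  have A_ball: "y \<in> ball 0 1" if "dist z y \<le> 3/4" for y using zb[OF that] by simp
  have xe: "\<bar>y \<bullet> e\<bar> \<le> 1" if "dist z y \<le> 3/4" for y
    using Cauchy_Schwarz_ineq2[of y e] e zb[OF that] by simp
  assume "\<not> ?thesis"
  then have bad: "u y0 $ i0 < u0 p (y0 \<bullet> e + a + h * (gauss k z y0 - w3))" "y0 \<bullet> e + a + h * (gauss k z y0 - w3) \<ge> 0"
    by (auto simp: h_def w1_def w2_def w3_def)
  \<comment> \<open>Below the plane the tilted profile is at most
    \<open>- \<delta> * \<gamma>\<close>, a multiple of d^2, while the negative part of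
    \<open>u $ i0\<close> is of order d^(kappa + 2). The hypothesis \<open>small\<close> is this
    comparison.\<close>
  have crude: "tilt \<delta> (y \<bullet> e + a - \<gamma>) \<le> u y $ i0" if y: "dist z y \<le> 3/4" for y
  proof (cases "y \<bullet> e + a \<ge> 0")
    case True
    have "tilt \<delta> (y \<bullet> e + a - \<gamma>) \<le> u0 p (y \<bullet> e + a)"
      using True xe[OF y] a \<gamma> \<delta> by (intro tilt_le_u0) (auto simp: \<delta>_def)
    also have "\<dots> \<le> u y $ i0" using True A_ball[OF y] by (intro lower) auto
    finally show ?thesis .
  next
    case False
    \<comment> \<open>The annulus lies in the ball of radius 19/20, and 19/20 + 1/25 < 1.\<close>
    have "cball y (1/25) \<subseteq> ball 0 1"
    proof
      fix x assume "x \<in> cball y (1/25)"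
      then have "norm (x - y) \<le> 1/25" by (simp add: dist_norm norm_minus_commute)
      moreover have "norm x \<le> norm y + norm (x - y)" using norm_triangle_ineq[of y "x - y"] by simp
      ultimately show "x \<in> ball 0 1" using zb[OF y] by simp
    qed
    note strip = strip_bound[OF this]
    have \<gamma>d: "\<gamma> = d * ((w2 - w1) / 128)" by (simp add: \<gamma>_def h_def)
    have "1250 * DIM('a) * c_p p / (kappa p * mu) * d powr kappa p * d\<^sup>2
        = (1250 * DIM('a) / (kappa p * mu) * d powr kappa p) * (c_p p * d\<^sup>2)" by simp
    also have "\<dots> \<le> (kappa p * ((w2 - w1) / 128)\<^sup>2 / 2) * (c_p p * d\<^sup>2)"
      using small c_p_pos[OF p01] by (intro mult_right_mono) (auto simp: w1_def w2_def)
    also have "\<dots> = \<delta> * \<gamma>" by (simp add: \<delta>_def \<gamma>d power2_eq_square)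
    finally have "- (\<delta> * \<gamma>) \<le> u y $ i0" using strip by linarith
    moreover have "\<delta> * (y \<bullet> e + a - \<gamma>) \<le> \<delta> * (- \<gamma>)" using False \<delta> by (intro mult_left_mono) auto
    moreover have "u0 p (y \<bullet> e + a - \<gamma>) = 0" using False \<gamma> by (intro u0_nonpos[OF p01]) simp
    ultimately show ?thesis by (simp add: tilt_def)
  qed
  \<comment> \<open>The inverse of \<open>tilt \<delta>\<close>; its slope is at most 1 / \<delta>,
    which gives the continuity required for the minimisation.\<close>
  define G where "G v = (SOME s. tilt \<delta> s = v)" for v
  have G: "tilt \<delta> (G v) = v" for v unfolding G_def using tilt_surj[OF \<delta>] by (rule someI_ex)
  have le_G: "s \<le> G v \<longleftrightarrow> tilt \<delta> s \<le> v" for s v using tilt_le_iff[OF \<delta>, of s "G v"] G by simp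
  have "\<bar>G v - G w\<bar> \<le> (1 / \<delta>) * \<bar>v - w\<bar>" for v w
    using tilt_increment[of "G v" "G w" \<delta>] tilt_increment[of "G w" "G v" \<delta>] G[of v] G[of w] \<delta>
    by (cases "G v \<le> G w") (auto simp: field_simps abs_if)
  then have "lipschitz_on (1 / \<delta>) UNIV G"
    using \<delta> by (intro lipschitz_onI) (auto simp: dist_real_def)
  then have contG: "continuous_on UNIV G" by (rule lipschitz_on_continuous_on)
  define \<alpha> where "\<alpha> y = G (u y $ i0) - (y \<bullet> e + a + h * gauss k z y)" for y
  have \<alpha>0: "\<alpha> y0 < T"
  proof (rule ccontr)
    let ?s = "y0 \<bullet> e + a + h * (gauss k z y0 - w3)"
    assume "\<not> \<alpha> y0 < T"
    then have "?s \<le> G (u y0 $ i0)" by (simp add: \<alpha>_def T_def algebra_simps)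
    then have "tilt \<delta> ?s \<le> u y0 $ i0" by (simp only: le_G)
    moreover have "\<delta> * ?s \<ge> 0" using \<delta> bad(2) by simp
    ultimately show False using bad(1) by (simp add: tilt_def)
  qed
  have "?A = cball z (3/4) - ball z \<rho>" by auto
  then have compA: "compact ?A" by (simp add: compact_diff)
  have "continuous_on ?A \<alpha>"
    unfolding \<alpha>_def using A_ball
    by (intro continuous_intros continuous_on_compose2[OF contG] continuous_on_subset[OF cont]) auto
  moreover have y0A: "y0 \<in> ?A" using y0 by simp
  ultimately obtain y where y: "y \<in> ?A" "\<And>x. x \<in> ?A \<Longrightarrow> \<alpha> y \<le> \<alpha> x"
    using continuous_attains_inf[OF compA] by blast
  define m where "m = \<alpha> y"
  have mT: "m < T" using y(2)[OF y0A] \<alpha>0 by (simp add: m_def)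
  have y34: "dist z y \<le> 3/4" using y(1) by simp
  have gle: "h * gauss k z x \<le> h" for x
    using h gauss_le_1[of k z x] k0 by simp
  have crude': "y \<bullet> e + a - \<gamma> \<le> G (u y $ i0)" using crude[OF y34] by (simp only: le_G)
  \<comment> \<open>The minimum is negative but small. So at the contact level the heights above z
    remain at least 1/10.\<close>
  have m_ge: "m \<ge> - 2 * h" using crude' gle[of y] \<gamma> unfolding m_def \<alpha>_def by linarith
  have out: "dist z y < 3/4"
  proof (rule ccontr)
    assume "\<not> dist z y < 3/4"
    then have "dist z y = 3/4" using y34 by auto
    then have "(y - z) \<bullet> (y - z) = (3/4)\<^sup>2" by (simp add: dist_norm norm_minus_commute flip: power2_norm_eq_inner)
    then have g: "gauss k z y = w1" by (simp add: gauss_def w1_def power2_eq_square)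
    have "m \<ge> - h * w1 - \<gamma>" using crude' g by (simp add: m_def \<alpha>_def)
    moreover have "- h * w1 - \<gamma> = T" by (simp add: \<gamma>_def T_def w3_def field_simps)
    ultimately show False using mT by simp
  qed
  have ze: "z \<bullet> e = 1/5" by (simp add: z_def ee)
  have inn: "\<rho> < dist z y"
  proof (rule ccontr)
    assume "\<not> \<rho> < dist z y"
    then have yc: "dist z y \<le> \<rho>" by simp
    define s where "s = y \<bullet> e + a + d / 32"
    have "\<bar>y \<bullet> e - z \<bullet> e\<bar> \<le> \<rho>" by (rule inner_e_close[OF yc])
    then have "y \<bullet> e \<ge> 1/10" using ze \<rho> by linarith
    then have s0: "s \<ge> 0" using b d d0 unfolding s_def by argo
    have "s \<le> 2" using xe[OF y34] a d unfolding s_def by argo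
    then have "tilt \<delta> (s - \<gamma>) \<le> u0 p s"
      using s0 \<gamma> \<delta> by (intro tilt_le_u0) (auto simp: \<delta>_def)
    also have "\<dots> \<le> u y $ i0" unfolding s_def using yc by (intro inner) auto
    finally have "s - \<gamma> \<le> G (u y $ i0)" by (simp only: le_G)
    then have "m \<ge> d / 32 - h - \<gamma>" using gle[of y] unfolding m_def \<alpha>_def s_def by linarith
    then show False using \<gamma>(2) d0 T0 mT unfolding h_def by argo
  qed
  have "open {x. \<rho> < dist z x \<and> dist z x < 3/4}"
    by (intro open_Collect_conj open_Collect_less continuous_intros)
  then obtain r0 where r0: "r0 > 0" "ball y r0 \<subseteq> {x. \<rho> < dist z x \<and> dist z x < 3/4}"
    using out inn by (auto simp: open_contains_ball)
  let ?c = "a + m"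
  let ?S = "level e ?c h k z"
  have Seq: "?S x = x \<bullet> e + a + h * gauss k z x + m" for x by (simp add: level_def)
  have lap: "level_lap h k z x \<ge> 640 * (k * h * gauss k z x)" if "\<rho> < dist z x" for x
  proof -
    have "\<rho>\<^sup>2 \<le> (norm (x - z))\<^sup>2" using that \<rho> by (intro power_mono) (auto simp: dist_norm norm_minus_commute)
    then have "k * \<rho>\<^sup>2 \<le> k * (norm (x - z))\<^sup>2" using k0 by (intro mult_left_mono) auto
    then have "640 \<le> 4 * (k * (norm (x - z))\<^sup>2) - 2 * DIM('a)" using k by linarith
    then have "(k * h * gauss k z x) * 640 \<le> (k * h * gauss k z x) * (4 * (k * (norm (x - z))\<^sup>2) - 2 * DIM('a))"
      using k0 h gauss_pos[of k z x] by (intro mult_left_mono) auto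
    also have "\<dots> = level_lap h k z x" by (simp add: level_lap_def power2_eq_square algebra_simps)
    finally show ?thesis by simp
  qed
  have kh0: "k * h * gauss k z x > 0" for x using k0 h gauss_pos[of k z x] by simp
  have kh: "k * h * gauss k z x \<le> 1/64" for x
  proof -
    have "(k * h) * gauss k z x \<le> (1/64) * 1"
      using d k0 h gauss_le_1[of k z x] gauss_pos[of k z x] by (intro mult_mono) (auto simp: h_def)
    then show ?thesis by simp
  qed
  have grad2: "level_grad e h k z x \<bullet> level_grad e h k z x - 1 \<ge> - 4 * (k * h * gauss k z x) * ((x - z) \<bullet> e)" for x
    unfolding norm_level_grad[OF e] by simp
  have inner_le: "\<bar>(x - z) \<bullet> e\<bar> \<le> 1" if "dist z x < 3/4" for x
    using Cauchy_Schwarz_ineq2[of "x - z" e] e that by (simp add: dist_norm norm_minus_commute)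
  show False
  proof (rule lower_touch[OF r0(1) _ \<delta>, where x = y and c = ?c and h = h and k = k and z = z])
    show "ball y r0 \<subseteq> ball 0 1" using r0(2) A_ball by force
    show "tilt \<delta> (?S x) \<le> u x $ i0" if "x \<in> ball y r0" for x
    proof -
      have "x \<in> ?A" using r0(2) that by force
      then have "m \<le> \<alpha> x" using y(2)[of x] unfolding m_def by blast
      then have "?S x \<le> G (u x $ i0)" using Seq[of x] unfolding \<alpha>_def by linarith
      then show ?thesis by (simp only: le_G)
    qed
    have "?S y = G (u y $ i0)" using Seq[of y] m_def unfolding \<alpha>_def by linarith
    then show "tilt \<delta> (?S y) = u y $ i0" using G by simp
    show "level_lap h k z x > 0" if "x \<in> ball y r0" for x
      using lap[of x] kh0[of x] r0(2) that by force
    show "level_grad e h k z y \<bullet> e > 1/2"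
    proof -
      have "level_grad e h k z y \<bullet> e = 1 - 2 * ((k * h * gauss k z y) * ((y - z) \<bullet> e))"
        by (simp add: level_grad_def inner_diff_left ee algebra_simps)
      moreover have "(k * h * gauss k z y) * ((y - z) \<bullet> e) \<le> (1/64) * 1"
      proof -
        have "(k * h * gauss k z y) * ((y - z) \<bullet> e) \<le> (k * h * gauss k z y) * 1"
          using kh0[of y] inner_le[OF out] by (intro mult_left_mono) auto
        then show ?thesis using kh[of y] by simp
      qed
      ultimately show ?thesis by simp
    qed
    show "ddu0 p (?S x) * (level_grad e h k z x \<bullet> level_grad e h k z x - 1) +
       (du0 p (?S x) + \<delta>) * level_lap h k z x > 0" if x: "x \<in> ball y r0" "?S x > 0" for x
    proof -
      define s where "s = ?S x"
      define t where "t = k * h * gauss k z x"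
      have t: "t > 0" using kh0[of x] by (simp add: t_def)
      have xr: "\<rho> < dist z x" "dist z x < 3/4" using r0(2) x(1) by auto
      have s: "s > 0" using x by (simp add: s_def)
      have dpos: "du0 p s > 0" using s mu c_p_pos[OF p01] by (simp add: du0_def)
      have ddnn: "ddu0 p s \<ge> 0" using mu dpos s by (simp add: ddu0_eq[OF p01])
      have l: "level_lap h k z x \<ge> 640 * t" using lap[OF xr(1)] by (simp add: t_def)
      have lp: "level_lap h k z x > 0" using l t by linarith
      have 1: "ddu0 p s * (level_grad e h k z x \<bullet> level_grad e h k z x - 1) \<ge> - (4 * t * ((x - z) \<bullet> e) * ddu0 p s)"
        using mult_left_mono[OF grad2[of x] ddnn] by (simp add: t_def mult_ac)
      \<comment> \<open>Below z the singular term has the good sign. Above z the height is at least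
        1/10, so u0'' is at most 10 u0'; the resulting 40 is beaten by the 640 in
        \<open>lap\<close>.\<close>
      have 2: "4 * t * ((x - z) \<bullet> e) * ddu0 p s \<le> 40 * t * du0 p s"
      proof (cases "(x - z) \<bullet> e \<le> 0")
        case True
        then have "4 * t * ((x - z) \<bullet> e) * ddu0 p s \<le> 0" using t ddnn by (intro mult_nonpos_nonneg mult_nonneg_nonpos) auto
        moreover have "40 * t * du0 p s \<ge> 0" using t dpos by simp
        ultimately show ?thesis by linarith
      next
        case False
        then have "x \<bullet> e > 1/5" using ze by (simp add: inner_diff_left)
        moreover have "h * gauss k z x > 0" using h gauss_pos[of k z x] by simp
        ultimately have "s \<ge> 1/10" using m_ge b d h unfolding s_def Seq by argo
        then have "mu * du0 p s / s \<le> 1 * du0 p s / (1/10)"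
          using mu dpos by (intro frac_le mult_right_mono) auto
        then have dd: "ddu0 p s \<le> 10 * du0 p s" using s by (simp add: ddu0_eq[OF p01])
        have "4 * t * ((x - z) \<bullet> e) \<le> 4 * t * 1" using t inner_le[OF xr(2)] by (intro mult_left_mono) auto
        then have "4 * t * ((x - z) \<bullet> e) * ddu0 p s \<le> (4 * t * 1) * (10 * du0 p s)"
          by (rule mult_mono[OF _ dd]) (use t ddnn in auto)
        then show ?thesis by simp
      qed
      have "du0 p s * level_lap h k z x \<ge> du0 p s * (640 * t)" using l dpos by (intro mult_left_mono) auto
      moreover have "du0 p s * t > 0" using dpos t by simp
      moreover have "\<delta> * level_lap h k z x > 0" using \<delta> lp by simp
      ultimately show ?thesis
        using 1 2 unfolding s_def[symmetric] by (simp add: distrib_right mult_ac)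
    qed
  qed
qed

end

subsection \<open>Improvement of flatness\<close>

text \<open>\<rho> is the radius in \<open>harnack_shift\<close>, k is as large as the barriers
  require, and \<eta> is capped by the height that the barriers gain near the origin, in units of
  d.\<close>

lemma (in flat_solution) improvement:
  fixes k \<rho> \<eta> :: real
  assumes \<rho>_def: "\<rho> = 1 / (400 * DIM('a))"
    and k_def: "k = (DIM('a) + 160) / \<rho>\<^sup>2"
    and \<eta>_def: "\<eta> = min \<rho> ((exp (- k / 4) - exp (- 9/16 * k)) / 128)"
    and d: "d \<le> 1/20" "k * d \<le> 1" "2 * CARD('m) * d powr (1/4) \<le> u0 p (1/20) * du0 p (1/20)"
    and small: "1250 * DIM('a) / (kappa p * mu) * d powr kappa p \<le>
      kappa p * ((exp (- k / 4) - exp (- 9/16 * k)) / 128)\<^sup>2 / 2"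
    and others: "\<And>x i. x \<in> ball 0 1 \<Longrightarrow> i \<noteq> i0 \<Longrightarrow> \<bar>u x $ i\<bar> \<le> d powr (5/8)"
    and b: "0 \<le> b"
  shows "(\<forall>x\<in>ball 0 \<eta>. x \<bullet> e + (a + \<eta> * d) \<ge> 0 \<longrightarrow> u0 p (x \<bullet> e + (a + \<eta> * d)) \<le> u x $ i0) \<or>
    (\<forall>x\<in>ball 0 \<eta>. norm (u x) \<le> u0 p (x \<bullet> e + (b - \<eta> * d)))"
proof -
  have "real DIM('a) \<ge> 1" using DIM_positive[where 'a='a] by linarith
  then have "400 \<le> 400 * real DIM('a)" by linarith
  then have "1 / (400 * real DIM('a)) \<le> 1 / 400" by (intro frac_le) simp_all
  then have \<rho>: "0 < \<rho>" "\<rho> \<le> 1/400" by (simp_all add: \<rho>_def)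
  have k: "k * \<rho>\<^sup>2 = DIM('a) + 160" using \<rho>(1) by (simp add: k_def)
  have k0: "k > 0" using \<rho>(1) by (simp add: k_def)
  have \<eta>: "\<eta> \<le> \<rho>" "\<eta> \<le> (exp (- k / 4) - exp (- 9/16 * k)) / 128"
    unfolding \<eta>_def by (rule min.cobounded1, rule min.cobounded2)
  have d0: "d > 0" using ab by simp
  have \<eta>32: "\<eta> * d \<le> d / 32"
  proof -
    have "\<eta> * d \<le> (1 / 32) * d" using \<eta>(1) \<rho>(2) d0 by (intro mult_right_mono) auto
    then show ?thesis by simp
  qed
  show ?thesis
  \<comment> \<open>If a > 1/4, the origin is at height at least 1/10 and the Harnack alternative
    applies there directly. Otherwise it is applied at z = e/5, whose height exceeds 1/10 because b
    >= 0 and d <= 1/20, and a barrier transports the gain.\<close>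
  proof (cases "a \<le> 1/4")
    case False
    have sub: "x \<in> cball 0 \<rho>" if "x \<in> ball 0 \<eta>" for x :: 'a using that \<eta>(1) by auto
    have "(\<forall>x\<in>cball 0 \<rho>. u0 p (x \<bullet> e + a + d / 32) \<le> u x $ i0) \<or>
      (\<forall>x\<in>cball 0 \<rho>. norm (u x) \<le> u0 p (x \<bullet> e + b - d / 32))"
      unfolding \<rho>_def using False d others by (intro harnack_shift) auto
    then show ?thesis
    proof
      assume *: "\<forall>x\<in>cball 0 \<rho>. u0 p (x \<bullet> e + a + d / 32) \<le> u x $ i0"
      have "u0 p (x \<bullet> e + (a + \<eta> * d)) \<le> u x $ i0" if "x \<in> ball 0 \<eta>" for x
        using * sub[OF that] u0_mono[OF p01, of "x \<bullet> e + (a + \<eta> * d)" "x \<bullet> e + a + d / 32"] \<eta>32 by force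
      then show ?thesis by blast
    next
      assume *: "\<forall>x\<in>cball 0 \<rho>. norm (u x) \<le> u0 p (x \<bullet> e + b - d / 32)"
      have "norm (u x) \<le> u0 p (x \<bullet> e + (b - \<eta> * d))" if "x \<in> ball 0 \<eta>" for x
        using * sub[OF that] u0_mono[OF p01, of "x \<bullet> e + b - d / 32" "x \<bullet> e + (b - \<eta> * d)"] \<eta>32 by force
      then show ?thesis by blast
    qed
  next
    case True
    define z where "z = (1/5) *\<^sub>R e"
    have nz: "norm z = 1/5" using e by (simp add: z_def)
    have ze: "z \<bullet> e = 1/5" by (simp add: z_def ee)
    have zb: "cball z (1/20) \<subseteq> ball 0 1"
    proof
      fix x assume "x \<in> cball z (1/20)"
      then have "norm (x - z) \<le> 1/20" by (simp add: dist_norm norm_minus_commute)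
      then show "x \<in> ball 0 1" using norm_triangle_ineq[of z "x - z"] nz by simp
    qed
    have x_z: "\<rho> \<le> dist z x \<and> dist z x \<le> 1/2" if "x \<in> ball 0 \<eta>" for x
    proof -
      have "norm x < \<eta>" using that by simp
      moreover have "norm z - norm x \<le> dist z x" "dist z x \<le> norm z + norm x"
        unfolding dist_norm by (rule norm_triangle_ineq2, rule norm_triangle_ineq4)
      ultimately show ?thesis using nz \<eta>(1) \<rho>(2) by linarith
    qed
    \<comment> \<open>Near the origin the distance to z is at most 1/2, so the Gaussian is at least
      its value at that distance. What remains after subtracting the mean is half the difference of
      the two values.\<close>
    have shift: "\<eta> * d \<le> d / 64 * (gauss k z x - (exp (- 9/16 * k) + exp (- k / 4)) / 2)" if "x \<in> ball 0 \<eta>" for x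
    proof -
      have "(norm (x - z))\<^sup>2 \<le> (1/2)\<^sup>2"
        using x_z[OF that] by (intro power_mono) (auto simp: dist_norm norm_minus_commute)
      then have "k * (norm (x - z))\<^sup>2 \<le> k * (1/4)" using k0 by (intro mult_left_mono) (auto simp: power2_eq_square)
      then have "gauss k z x \<ge> exp (- k / 4)" by (simp add: gauss_def power2_norm_eq_inner)
      then have "(exp (- k / 4) - exp (- 9/16 * k)) / 2 \<le> gauss k z x - (exp (- 9/16 * k) + exp (- k / 4)) / 2"
        by argo
      then have "d / 64 * ((exp (- k / 4) - exp (- 9/16 * k)) / 2) \<le> d / 64 * (gauss k z x - (exp (- 9/16 * k) + exp (- k / 4)) / 2)"
        using d0 by (intro mult_left_mono) auto
      moreover have "\<eta> * d \<le> ((exp (- k / 4) - exp (- 9/16 * k)) / 128) * d"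
        using \<eta>(2) d0 by (intro mult_right_mono) auto
      moreover have "((exp (- k / 4) - exp (- 9/16 * k)) / 128) * d = d / 64 * ((exp (- k / 4) - exp (- 9/16 * k)) / 2)"
        by simp
      ultimately show ?thesis by linarith
    qed
    have "(\<forall>x\<in>cball z \<rho>. u0 p (x \<bullet> e + a + d / 32) \<le> u x $ i0) \<or>
      (\<forall>x\<in>cball z \<rho>. norm (u x) \<le> u0 p (x \<bullet> e + b - d / 32))"
      unfolding \<rho>_def using d(1,3) b ze others by (intro harnack_shift zb) argo+
    then show ?thesis
    proof
      assume *: "\<forall>x\<in>cball z \<rho>. u0 p (x \<bullet> e + a + d / 32) \<le> u x $ i0"
      have "u0 p (x \<bullet> e + (a + \<eta> * d)) \<le> u x $ i0" if x: "x \<in> ball 0 \<eta>" "x \<bullet> e + (a + \<eta> * d) \<ge> 0" for x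
      proof -
        let ?s = "x \<bullet> e + a + d / 64 * (gauss k z x - (exp (- 9/16 * k) + exp (- k / 4)) / 2)"
        have le: "x \<bullet> e + (a + \<eta> * d) \<le> ?s" using shift[OF x(1)] by linarith
        have "u0 p ?s \<le> u x $ i0 \<or> ?s < 0"
          unfolding z_def
          by (rule lower_barrier[of \<rho>]) (use \<rho> k d small b True * x_z[OF x(1)] in \<open>auto simp: z_def\<close>)
        then show ?thesis using le x(2) u0_mono[OF p01 le] by linarith
      qed
      then show ?thesis by blast
    next
      assume *: "\<forall>x\<in>cball z \<rho>. norm (u x) \<le> u0 p (x \<bullet> e + b - d / 32)"
      have "norm (u x) \<le> u0 p (x \<bullet> e + (b - \<eta> * d))" if x: "x \<in> ball 0 \<eta>" for x
      proof (cases "u x = 0")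
        case False
        have "q x \<le> x \<bullet> e + b - d / 64 * (gauss k z x - (exp (- 9/16 * k) + exp (- k / 4)) / 2)"
          unfolding z_def
          by (rule upper_barrier[of \<rho>]) (use \<rho> k d b True * x_z[OF x] False in \<open>auto simp: z_def\<close>)
        then have "q x \<le> x \<bullet> e + (b - \<eta> * d)" using shift[OF x] by linarith
        then show ?thesis using q_le_iff[OF False] by blast
      qed (simp add: u0_nonneg[OF p01])
      then show ?thesis by blast
    qed
  qed
qed

lemma small_constants:
  fixes A B C D E \<kappa> :: real
  assumes "A > 0" "C > 0" "E > 0" "\<kappa> > 0"
  shows "\<exists>\<epsilon>>0. \<forall>d. 0 < d \<and> d \<le> \<epsilon> \<longrightarrow> d \<le> 1/20 \<and> A * d \<le> 1 \<and> B * d powr (1/4) \<le> C \<and> D * d powr \<kappa> \<le> E"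
proof -
  have pos: "\<forall>\<^sub>F d in at_right (0::real). d > 0" by (rule eventually_at_right_less)
  have "((\<lambda>d. d) \<longlongrightarrow> 0) (at_right (0::real))" by (rule tendsto_ident_at)
  then have 1: "\<forall>\<^sub>F d in at_right (0::real). d < 1/20" by (rule order_tendstoD) simp
  have "((\<lambda>d. A * d) \<longlongrightarrow> A * 0) (at_right (0::real))" by (intro tendsto_intros)
  then have 2: "\<forall>\<^sub>F d in at_right (0::real). A * d < 1" by (rule order_tendstoD) simp
  have "((\<lambda>d. B * d powr (1/4)) \<longlongrightarrow> B * 0 powr (1/4)) (at_right (0::real))"
    by (intro tendsto_intros tendsto_powr') (auto intro: eventually_mono[OF pos])
  then have 3: "\<forall>\<^sub>F d in at_right (0::real). B * d powr (1/4) < C" by (rule order_tendstoD) (simp add: assms)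
  have "((\<lambda>d. D * d powr \<kappa>) \<longlongrightarrow> D * 0 powr \<kappa>) (at_right (0::real))"
    using assms by (intro tendsto_intros tendsto_powr') (auto intro: eventually_mono[OF pos])
  then have 4: "\<forall>\<^sub>F d in at_right (0::real). D * d powr \<kappa> < E" by (rule order_tendstoD) (simp add: assms)
  have "\<forall>\<^sub>F d in at_right (0::real). d \<le> 1/20 \<and> A * d \<le> 1 \<and> B * d powr (1/4) \<le> C \<and> D * d powr \<kappa> \<le> E"
    using 1 2 3 4 by eventually_elim auto
  then obtain s where "s > 0" "\<And>d. 0 < d \<Longrightarrow> d < s \<Longrightarrow>
      d \<le> 1/20 \<and> A * d \<le> 1 \<and> B * d powr (1/4) \<le> C \<and> D * d powr \<kappa> \<le> E"
    unfolding eventually_at_right_field by blast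
  then show ?thesis by (intro exI[of _ "s / 2"]) auto
qed

lemma xn_inner: "xn x = x \<bullet> axis (Max UNIV) 1"
  by (simp add: xn_def inner_axis)

text \<open>The upper bound forces u to vanish below its plane, so a point of the closed positivity
  set cannot lie there. Through this the hypothesis on \<open>x0\<close> becomes
  \<open>b \<ge> 0\<close> after rescaling.\<close>

lemma height_nonneg:
  fixes u :: "'a::euclidean_space \<Rightarrow> real^'m"
  assumes p: "0 < p" "p < 1" and x0: "x0 \<in> closure (posset \<Omega> u)" "r > 0"
    and upper: "\<And>x. x \<in> ball x0 r \<Longrightarrow> norm (u x) \<le> u0 p (x \<bullet> e + b)"
  shows "x0 \<bullet> e + b \<ge> 0"
proof (rule ccontr)
  assume "\<not> x0 \<bullet> e + b \<ge> 0"
  moreover have o: "open (ball x0 r \<inter> {x. x \<bullet> e + b < 0})"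
    by (intro open_Int open_ball open_Collect_less continuous_intros)
  moreover have "x0 \<in> ball x0 r" using x0(2) by simp
  ultimately have "x0 \<in> ball x0 r \<inter> {x. x \<bullet> e + b < 0} \<inter> closure (posset \<Omega> u)"
    using x0(1) by simp
  then have "ball x0 r \<inter> {x. x \<bullet> e + b < 0} \<inter> posset \<Omega> u \<noteq> {}"
    using open_Int_closure_eq_empty[OF o, of "posset \<Omega> u"] by blast
  then obtain y where y: "y \<in> posset \<Omega> u" "y \<in> ball x0 r" "y \<bullet> e + b < 0" by blast
  then show False using upper[of y] u0_nonpos[OF p, of "y \<bullet> e + b"] by (simp add: posset_def)
qed

theorem theorem3p1:
  fixes p :: real
  assumes "CARD('n::{finite,linorder}) \<ge> 2" and "0 < p" and "p < 1"
  shows "\<exists>\<epsilon>>0. \<exists>\<eta>. 0 < \<eta> \<and> \<eta> < 1 \<and>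
    (\<forall>(u :: real^('n::{finite,linorder}) \<Rightarrow> real^('m::{finite,linorder})) x0 r a0 b0.
       viscosity_solution p (ball 0 1) u \<and>
       x0 \<in> posset (ball 0 1) u \<union> freebd (ball 0 1) u \<and>
       r > 0 \<and> ball x0 r \<subseteq> ball 0 1 \<and>
       a0 \<le> b0 \<and> b0 - a0 \<le> \<epsilon> * r \<and>
       (\<forall>x\<in>ball x0 r. norm (u x) \<le> u0 p (xn x + b0)) \<and>
       (\<forall>x\<in>ball x0 r. xn x \<ge> - a0 \<longrightarrow> u0 p (xn x + a0) \<le> u x $ first_idx) \<and>
       (\<forall>x\<in>ball x0 r. \<forall>i. i \<noteq> first_idx \<longrightarrow>
           \<bar>u x $ i\<bar> \<le> r powr (kappa p) * ((b0 - a0) / r) powr (5/8))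
     \<longrightarrow> (\<exists>a1 b1. a0 \<le> a1 \<and> a1 \<le> b1 \<and> b1 \<le> b0 \<and> b1 - a1 = (1 - \<eta>) * (b0 - a0) \<and>
           (\<forall>x\<in>ball x0 (\<eta> * r). norm (u x) \<le> u0 p (xn x + b1)) \<and>
           (\<forall>x\<in>ball x0 (\<eta> * r). xn x \<ge> - a1 \<longrightarrow> u0 p (xn x + a1) \<le> u x $ first_idx)))"
proof -
  note p = assms(2,3)
  note \<kappa> = kappa_gt_1[OF p] kappa_lt_2[OF p]
  define n where "n = real DIM(real^('n::{finite,linorder}))"
  define \<rho> where "\<rho> = 1 / (400 * n)"
  define k where "k = (n + 160) / \<rho>\<^sup>2"
  \<comment> \<open>1/128 is half of 1/64: the barrier has amplitude d/64, and half the difference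
    of the two Gaussian values survives near the origin.\<close>
  define W where "W = (exp (- k / 4) - exp (- 9/16 * k)) / 128"
  define \<eta> where "\<eta> = min \<rho> W"
  have "n \<ge> 1" using DIM_positive[where 'a = "real^('n::{finite,linorder})"] unfolding n_def by linarith
  then have \<rho>: "0 < \<rho>" "\<rho> < 1" by (auto simp: \<rho>_def divide_less_eq)
  have k: "k > 0" using \<rho> \<open>n \<ge> 1\<close> by (simp add: k_def)
  have W: "W > 0" using k by (simp add: W_def)
  have \<eta>: "0 < \<eta>" "\<eta> < 1" using \<rho> W by (auto simp: \<eta>_def)
  have "u0 p (1/20) * du0 p (1/20) > 0"
    using u0_pos[OF p, of "1/20"] c_p_pos[OF p] \<kappa> by (simp add: du0_def)
  moreover have "kappa p * W\<^sup>2 / 2 > 0" using \<kappa> W by simp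
  ultimately obtain \<epsilon> where \<epsilon>: "\<epsilon> > 0" "\<And>d. 0 < d \<Longrightarrow> d \<le> \<epsilon> \<Longrightarrow> d \<le> 1/20 \<and> k * d \<le> 1 \<and>
      2 * CARD('m) * d powr (1/4) \<le> u0 p (1/20) * du0 p (1/20) \<and>
      1250 * n / (kappa p * (kappa p - 1)) * d powr kappa p \<le> kappa p * W\<^sup>2 / 2"
    using small_constants[OF k, of "u0 p (1/20) * du0 p (1/20)" "kappa p * W\<^sup>2 / 2" "kappa p"
        "2 * CARD('m)" "1250 * n / (kappa p * (kappa p - 1))"] \<kappa> by auto
  show ?thesis
  proof (rule exI[of _ \<epsilon>], rule conjI[OF \<epsilon>(1)], rule exI[of _ \<eta>], rule conjI[OF \<eta>(1)], rule conjI[OF \<eta>(2)],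
      intro allI impI, elim conjE)
    fix u :: "real^('n::{finite,linorder}) \<Rightarrow> real^('m::{finite,linorder})" and x0 r a0 b0
    assume visc: "viscosity_solution p (ball 0 1) u"
      and x0: "x0 \<in> posset (ball 0 1) u \<union> freebd (ball 0 1) u"
      and r: "0 < r" "ball x0 r \<subseteq> ball 0 1" and ab0: "a0 \<le> b0" "b0 - a0 \<le> \<epsilon> * r"
      and ub: "\<forall>x\<in>ball x0 r. norm (u x) \<le> u0 p (xn x + b0)"
      and lb: "\<forall>x\<in>ball x0 r. - a0 \<le> xn x \<longrightarrow> u0 p (xn x + a0) \<le> u x $ first_idx"
      and others: "\<forall>x\<in>ball x0 r. \<forall>i. i \<noteq> first_idx \<longrightarrow> \<bar>u x $ i\<bar> \<le> r powr kappa p * ((b0 - a0) / r) powr (5/8)"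
    have small: "ball x0 (\<eta> * r) \<subseteq> ball x0 r" using \<eta> r by (intro subset_ball) simp
    show "\<exists>a1 b1. a0 \<le> a1 \<and> a1 \<le> b1 \<and> b1 \<le> b0 \<and> b1 - a1 = (1 - \<eta>) * (b0 - a0) \<and>
           (\<forall>x\<in>ball x0 (\<eta> * r). norm (u x) \<le> u0 p (xn x + b1)) \<and>
           (\<forall>x\<in>ball x0 (\<eta> * r). - a1 \<le> xn x \<longrightarrow> u0 p (xn x + a1) \<le> u x $ first_idx)"
    \<comment> \<open>For coinciding planes both sides of the width equation vanish and the old
      planes serve.\<close>
    proof (cases "a0 = b0")
      case True
      then show ?thesis using ub lb small by (intro exI[of _ a0] exI[of _ b0]) auto
    next
      case False
      define v where "v y = (r powr - kappa p) *\<^sub>R u (x0 + r *\<^sub>R y)" for y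
      define e :: "real^('n::{finite,linorder})" where "e = axis (Max UNIV) 1"
      \<comment> \<open>Moving \<open>x0\<close> to the origin adds its height to both offsets, and
        the dilation divides them by r.\<close>
      define a where "a = (xn x0 + a0) / r"
      define b where "b = (xn x0 + b0) / r"
      have xe: "xn x = x \<bullet> e" for x :: "real^('n::{finite,linorder})" by (simp add: xn_inner e_def)
      have ba: "b - a = (b0 - a0) / r" by (simp add: a_def b_def flip: diff_divide_distrib)
      have in_ball: "x0 + r *\<^sub>R y \<in> ball x0 r" if "y \<in> ball 0 1" for y
        using that r by (simp add: dist_norm)
      have scaleb: "xn (x0 + r *\<^sub>R y) + (r * c - xn x0) = r * (y \<bullet> e + c)" for y c
        by (simp add: xe inner_add_left algebra_simps)
      have ra: "r * a - xn x0 = a0" and rb: "r * b - xn x0 = b0" using r by (simp_all add: a_def b_def)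
      have rd: "r * (b - a) = b0 - a0" unfolding ba using r by simp
      have \<eta>_nonneg: "\<eta> * (b0 - a0) \<ge> 0" using \<eta> ab0 by simp
      have \<eta>_le: "\<eta> * (b0 - a0) \<le> b0 - a0" using mult_right_mono[of \<eta> 1 "b0 - a0"] \<eta> ab0 by simp
      have rest: "(b0 - a0) - \<eta> * (b0 - a0) = (1 - \<eta>) * (b0 - a0)" by (simp add: algebra_simps)
      have rr: "r powr - kappa p * r powr kappa p = 1" using r by (simp flip: powr_add)
      have u0s: "r powr - kappa p * u0 p (r * t) = u0 p t" for t
        using rr r by (simp add: u0_scale[OF p])
      interpret flat_solution p v first_idx e a b
      proof
        show "viscosity_solution p (ball 0 1) v"
          unfolding v_def by (rule viscosity_solution_rescale[OF p r visc])
        show "norm e = 1" by (simp add: e_def norm_axis_1)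
        show "norm (v y) \<le> u0 p (y \<bullet> e + b)" if y: "y \<in> ball 0 1" for y
        proof -
          have "norm (u (x0 + r *\<^sub>R y)) \<le> u0 p (r * (y \<bullet> e + b))"
            using bspec[OF ub in_ball[OF y]] scaleb[of y b] by (simp add: rb)
          then have "r powr - kappa p * norm (u (x0 + r *\<^sub>R y)) \<le> r powr - kappa p * u0 p (r * (y \<bullet> e + b))"
            by (intro mult_left_mono) auto
          then show ?thesis by (simp add: v_def u0s)
        qed
        show "u0 p (y \<bullet> e + a) \<le> v y $ first_idx" if y: "y \<in> ball 0 1" "- a \<le> y \<bullet> e" for y
        proof -
          have "xn (x0 + r *\<^sub>R y) + a0 \<ge> 0" using scaleb[of y a] y(2) r by (simp add: ra)
          then have "u0 p (r * (y \<bullet> e + a)) \<le> u (x0 + r *\<^sub>R y) $ first_idx"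
            using bspec[OF lb in_ball[OF y(1)]] scaleb[of y a] by (simp add: ra)
          then have "r powr - kappa p * u0 p (r * (y \<bullet> e + a)) \<le> r powr - kappa p * u (x0 + r *\<^sub>R y) $ first_idx"
            by (intro mult_left_mono) auto
          then show ?thesis by (simp add: v_def u0s)
        qed
        have "b - a > 0" unfolding ba using False ab0 r by simp
        then show "a < b" by simp
      qed (use p in auto)
      have others': "\<bar>v y $ i\<bar> \<le> (b - a) powr (5/8)" if y: "y \<in> ball 0 1" "i \<noteq> first_idx" for y i
      proof -
        have "r powr - kappa p * \<bar>u (x0 + r *\<^sub>R y) $ i\<bar> \<le> r powr - kappa p * (r powr kappa p * (b - a) powr (5/8))"
          using bspec[OF others in_ball[OF y(1)]] y(2) unfolding ba by (intro mult_left_mono) auto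
        also have "\<dots> = (b - a) powr (5/8)" using rr by (simp flip: mult.assoc)
        finally show ?thesis by (simp add: v_def abs_mult)
      qed
      have "x0 \<in> closure (posset (ball 0 1) u)"
        using x0 closure_subset by (auto simp: freebd_def frontier_def)
      then have "x0 \<bullet> e + b0 \<ge> 0"
        using ub xe by (intro height_nonneg[OF p _ r(1), of x0 "ball 0 1" u e b0]) auto
      then have b0: "b \<ge> 0" using r by (simp add: b_def xe)
      have "b - a \<le> \<epsilon>" unfolding ba using ab0 r by (simp add: divide_le_eq)
      note small_d = \<epsilon>(2)[OF _ this]
      have back_ball: "x = x0 + r *\<^sub>R ((1 / r) *\<^sub>R (x - x0)) \<and> (1 / r) *\<^sub>R (x - x0) \<in> ball 0 \<eta>"
        if "x \<in> ball x0 (\<eta> * r)" for x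
        using that r by (simp add: dist_norm norm_minus_commute divide_less_eq)
      have un_v: "u (x0 + r *\<^sub>R y) = (r powr kappa p) *\<^sub>R v y" for y
        using rr by (simp add: v_def mult.commute)
      have "(\<forall>y\<in>ball 0 \<eta>. y \<bullet> e + (a + \<eta> * (b - a)) \<ge> 0 \<longrightarrow> u0 p (y \<bullet> e + (a + \<eta> * (b - a))) \<le> v y $ first_idx) \<or>
        (\<forall>y\<in>ball 0 \<eta>. norm (v y) \<le> u0 p (y \<bullet> e + (b - \<eta> * (b - a))))"
      proof (rule improvement[where k = k and \<rho> = \<rho> and \<eta> = \<eta>])
        show "\<rho> = 1 / (400 * DIM(real^('n::{finite,linorder})))"
          "k = (DIM(real^('n::{finite,linorder})) + 160) / \<rho>\<^sup>2"
          "\<eta> = min \<rho> ((exp (- k / 4) - exp (- 9/16 * k)) / 128)"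
          by (simp_all only: \<rho>_def k_def n_def \<eta>_def W_def of_nat_mult of_nat_add of_nat_numeral)
        show "b - a \<le> 1/20" "k * (b - a) \<le> 1"
          "2 * CARD('m) * (b - a) powr (1/4) \<le> u0 p (1/20) * du0 p (1/20)"
          "1250 * DIM(real^('n::{finite,linorder})) / (kappa p * (kappa p - 1)) * (b - a) powr kappa p \<le>
            kappa p * ((exp (- k / 4) - exp (- 9/16 * k)) / 128)\<^sup>2 / 2"
          using small_d ab unfolding n_def W_def by simp_all
        show "\<bar>v y $ i\<bar> \<le> (b - a) powr (5/8)" if "y \<in> ball 0 1" "i \<noteq> first_idx" for y i
          using that by (rule others')
        show "0 \<le> b" by (rule b0)
      qed
      then show ?thesis
      proof
        assume *: "\<forall>y\<in>ball 0 \<eta>. y \<bullet> e + (a + \<eta> * (b - a)) \<ge> 0 \<longrightarrow> u0 p (y \<bullet> e + (a + \<eta> * (b - a))) \<le> v y $ first_idx"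
        \<comment> \<open>Only one plane moves in each alternative, by \<eta> times the original
          gap; the other is kept.\<close>
        define a1 where "a1 = a0 + \<eta> * (b0 - a0)"
        have a1: "a1 = r * (a + \<eta> * (b - a)) - xn x0" 
        proof -
          have "r * (a + \<eta> * (b - a)) - xn x0 = (r * a - xn x0) + \<eta> * (r * (b - a))" by (simp add: algebra_simps)
          then show ?thesis unfolding ra rd a1_def by simp
        qed
        have "u0 p (xn x + a1) \<le> u x $ first_idx" if x: "x \<in> ball x0 (\<eta> * r)" "- a1 \<le> xn x" for x
        proof -
          define y where "y = (1 / r) *\<^sub>R (x - x0)"
          have y: "x = x0 + r *\<^sub>R y" "y \<in> ball 0 \<eta>" using back_ball[OF x(1)] by (auto simp: y_def)
          have eq: "xn x + a1 = r * (y \<bullet> e + (a + \<eta> * (b - a)))" unfolding y(1) a1 by (rule scaleb)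
          then have "r * (y \<bullet> e + (a + \<eta> * (b - a))) \<ge> 0" using x(2) by linarith
          then have "u0 p (y \<bullet> e + (a + \<eta> * (b - a))) \<le> v y $ first_idx"
            using * y(2) r by (simp add: zero_le_mult_iff)
          moreover have "u x = (r powr kappa p) *\<^sub>R v y" using un_v[of y] y(1) by simp
          ultimately show ?thesis
            using r unfolding eq u0_scale[OF p r(1)] by (simp add: mult_left_mono)
        qed
        moreover have "a0 \<le> a1" "a1 \<le> b0" "b0 - a1 = (1 - \<eta>) * (b0 - a0)"
          using \<eta>_nonneg \<eta>_le rest unfolding a1_def by linarith+
        ultimately show ?thesis
          using ub small by (intro exI[of _ a1] exI[of _ b0]) blast
      next
        assume *: "\<forall>y\<in>ball 0 \<eta>. norm (v y) \<le> u0 p (y \<bullet> e + (b - \<eta> * (b - a)))"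
        define b1 where "b1 = b0 - \<eta> * (b0 - a0)"
        have b1: "b1 = r * (b - \<eta> * (b - a)) - xn x0" 
        proof -
          have "r * (b - \<eta> * (b - a)) - xn x0 = (r * b - xn x0) - \<eta> * (r * (b - a))" by (simp add: algebra_simps)
          then show ?thesis unfolding rb rd b1_def by simp
        qed
        have "norm (u x) \<le> u0 p (xn x + b1)" if x: "x \<in> ball x0 (\<eta> * r)" for x
        proof -
          define y where "y = (1 / r) *\<^sub>R (x - x0)"
          have y: "x = x0 + r *\<^sub>R y" "y \<in> ball 0 \<eta>" using back_ball[OF x(1)] by (auto simp: y_def)
          have eq: "xn x + b1 = r * (y \<bullet> e + (b - \<eta> * (b - a)))" unfolding y(1) b1 by (rule scaleb)
          have "norm (v y) \<le> u0 p (y \<bullet> e + (b - \<eta> * (b - a)))" using * y(2) by blast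
          moreover have "u x = (r powr kappa p) *\<^sub>R v y" using un_v[of y] y(1) by simp
          ultimately show ?thesis
            using r unfolding eq u0_scale[OF p r(1)] by (simp add: mult_left_mono)
        qed
        moreover have "a0 \<le> b1" "b1 \<le> b0" "b1 - a0 = (1 - \<eta>) * (b0 - a0)"
          using \<eta>_nonneg \<eta>_le rest unfolding b1_def by linarith+
        ultimately show ?thesis
          using lb small by (intro exI[of _ a0] exI[of _ b1]) blast
      qed
    qed
  qed
qed

end
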